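(* Let $R\to A$ be a homomorphism of associative rings, and let $(\mathcal F,\mathcal C)$ be a hereditary complete cotorsion pair in the category of left $R$-modules. Assume that the left $R$-module $A$ belongs to $\mathcal F$, and that for every left $R$-module $F\in\mathcal F$ the underlying left $R$-module of $\operatorname{Hom}_R(A,F)$ also belongs to $\mathcal F$. Assume further that, for some finite integer $k\ge0$, the $\mathcal F$-resolution dimension of any countable product of modules from $\mathcal F$ (taken in the category of left $R$-modules) does not exceed $k$. Let $\mathcal F_A$ be the class of all left $A$-modules whose underlying left $R$-modules belong to $\mathcal F$, and put $\mathcal C_A=\mathrm{Cof}_{\omega+k}(\operatorname{Hom}_R(A,\mathcal C))^\oplus$, where $\omega+k$ is the $k$-th successor ordinal of the first infinite ordinal $\omega$. Then $(\mathcal F_A,\mathcal C_A)$ is a hereditary complete cotorsion pair in the category of left $A$-modules.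
   Context: Rings are associative and unital, ring homomorphisms preserve the unit, and modules are unital. For a left $R$-module $M$, $\operatorname{Hom}_R(A,M)$ is a left $A$-module via the right multiplication of $A$ on itself (the module coinduced from $M$); for a class $\mathcal T$ of left $R$-modules, $\operatorname{Hom}_R(A,\mathcal T)$ denotes the class of all left $A$-modules of the form $\operatorname{Hom}_R(A,T)$, $T\in\mathcal T$. For a class $\mathcal X$ of left modules over a ring $S$: $\mathcal X^{\perp_1}=\{Y\mid \operatorname{Ext}^1_S(X,Y)=0\ \forall X\in\mathcal X\}$, ${}^{\perp_1}\mathcal X=\{Y\mid\operatorname{Ext}^1_S(Y,X)=0\ \forall X\in\mathcal X\}$, and $\mathcal X^\oplus$ is the class of all direct summands of modules from $\mathcal X$. A cotorsion pair is a pair of classes $(\mathcal F,\mathcal C)$ with $\mathcal C=\mathcal F^{\perp_1}$ and $\mathcal F={}^{\perp_1}\mathcal C$. It is complete if for every module $M$ there are short exact sequences $0\to C'\to F\to M\to0$ and $0\to M\to C\to F'\to0$ with $F,F'\in\mathcal F$ and $C,C'\in\mathcal C$. It is hereditary if $\operatorname{Ext}^n(F,C)=0$ for all $F\in\mathcal F$, $C\in\mathcal C$, $n\ge1$ (equivalently, $\mathcal F$ is closed under kernels of surjective morphisms). A module $M$ has $\mathcal F$-resolution dimension $\le k$ if there is an exact sequence $0\to F_k\to\dots\to F_1\to F_0\to M\to0$ with all $F_i\in\mathcal F$. For an ordinal $\alpha$, an $\alpha$-cofiltration on a module $N$ consists of modules $G_iN$, $0\le i\le\alpha$, and morphisms $G_iN\to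 G_jN$ for $0\le j<i\le\alpha$, compatible with compositions, such that $G_0N=0$, $G_\alpha N=N$, the map $G_iN\to\varprojlim_{j<i}G_jN$ is an isomorphism for every limit ordinal $i\le\alpha$, and $G_{i+1}N\to G_iN$ is surjective for all $0\le i<\alpha$. For a class of modules $\mathcal T$, $\mathrm{Cof}_\alpha(\mathcal T)$ is the class of all modules $N$ admitting an $\alpha$-cofiltration such that $\ker(G_{i+1}N\to G_iN)$ is isomorphic to a module from $\mathcal T$ for all $0\le i<\alpha$. *)

theory Defs
  imports "HOL-Algebra.Module" "HOL-Algebra.AbelCoset" "HOL-Library.Equipollence"
begin

text \<open>
  Categories of modules are taken relative to a universe \<open>U\<close> of sets of elements of a type
  \<open>'u\<close>, since HOL cannot quantify over modules of all types. The closure conditions are those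
  used to form free modules, countable products and coinduced modules. A Grothendieck universe
  (\<open>U\<close> the sets of cardinality below a strongly inaccessible one) satisfies them for all rings
  in it, and for given rings they can also be met within HOL: by the lemmas below,
  \<open>U = UNIV\<close> will do if \<open>'u\<close> is \<open>'s list \<Rightarrow> bool\<close> and \<open>nat\<close> and the types of the rings embed
  in \<open>'s\<close>.
\<close>

definition small :: "'u set set \<Rightarrow> 'x set \<Rightarrow> bool" where
  "small U X \<longleftrightarrow> (\<exists>Z\<in>U. X \<lesssim> Z)"

definition powers_small :: "'u set set \<Rightarrow> 'i set \<Rightarrow> bool" where
  "powers_small U I \<longleftrightarrow> (\<forall>X\<in>U. small U (I \<rightarrow>\<^sub>E X))"

definition universe :: "'u set set \<Rightarrow> bool" where
  "universe U \<longleftrightarrow>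
     (\<forall>X. small U X \<longrightarrow> X \<in> U) \<and>
     small U (UNIV :: nat set) \<and>
     (\<forall>X\<in>U. \<forall>Y\<in>U. small U (X \<times> Y)) \<and>
     powers_small U (UNIV :: nat set)"

lemma small_exists:
  fixes I :: "'i set" and f :: "'i \<Rightarrow> 's"
  assumes "inj f"
  shows "small (UNIV :: ('s list \<Rightarrow> bool) set set) I"
proof -
  have "inj_on (\<lambda>i l. l = [f i]) I"
    by (rule inj_onI) (metis assms injD list.inject)
  then show ?thesis unfolding small_def lepoll_def by blast
qed

lemma powers_small_exists:
  fixes I :: "'i set" and f :: "'i \<Rightarrow> 's"
  assumes "inj f"
  shows "powers_small (UNIV :: ('s list \<Rightarrow> bool) set set) I"
  unfolding powers_small_def small_def
proof
  fix X :: "('s list \<Rightarrow> bool) set"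
  let ?e = "\<lambda>(g :: 'i \<Rightarrow> 's list \<Rightarrow> bool) l. case l of [] \<Rightarrow> False | s # t \<Rightarrow> (\<exists>i\<in>I. s = f i \<and> g i t)"
  have "inj_on ?e (I \<rightarrow>\<^sub>E X)"
  proof (rule inj_onI)
    fix g h assume g: "g \<in> I \<rightarrow>\<^sub>E X" and h: "h \<in> I \<rightarrow>\<^sub>E X" and eq: "?e g = ?e h"
    show "g = h"
    proof (rule PiE_ext[OF g h])
      fix i assume "i \<in> I"
      show "g i = h i"
      proof
        fix t
        from fun_cong[OF eq, of "f i # t"] \<open>i \<in> I\<close> show "g i t = h i t"
          using injD[OF assms] by auto
      qed
    qed
  qed
  then have "(I \<rightarrow>\<^sub>E X) \<lesssim> (UNIV :: ('s list \<Rightarrow> bool) set)"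
    unfolding lepoll_def by blast
  then show "\<exists>Z\<in>UNIV. (I \<rightarrow>\<^sub>E X) \<lesssim> (Z :: ('s list \<Rightarrow> bool) set)" by blast
qed

lemma universe_exists:
  fixes f :: "nat \<Rightarrow> 's"
  assumes "inj f"
  shows "universe (UNIV :: ('s list \<Rightarrow> bool) set set)"
proof -
  have prod: "small (UNIV :: ('s list \<Rightarrow> bool) set set) (X \<times> Y)"
    for X Y :: "('s list \<Rightarrow> bool) set"
  proof -
    have "inj_on (\<lambda>(x, y) l. case l of [] \<Rightarrow> False | s # t \<Rightarrow> if s = f 0 then x t else y t) (X \<times> Y)"
      (is "inj_on ?e _")
    proof (rule inj_onI)
      fix p q assume eq: "?e p = ?e q"
      obtain x y x' y' where pq: "p = (x, y)" "q = (x', y')" by (metis prod.exhaust)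
      have "f 1 \<noteq> f 0" using injD[OF assms, of 1 0] by auto
      then have "x t = x' t" "y t = y' t" for t
        using fun_cong[OF eq, of "f 0 # t"] fun_cong[OF eq, of "f 1 # t"] by (auto simp: pq)
      then show "p = q" by (auto simp: pq)
    qed
    then show ?thesis unfolding small_def lepoll_def by blast
  qed
  show ?thesis
    unfolding universe_def using small_exists[OF assms] prod powers_small_exists[OF assms] by blast
qed


text \<open>
  The locale \<open>module\<close> of the library requires a commutative ring. Left modules use the same
  record type; its fields \<open>mult\<close> and \<open>one\<close> are irrelevant here.
\<close>

locale left_module = R?: ring R + M?: abelian_group M
  for R (structure) and M :: "('r, 'm, 'z) module_scheme" (structure) +
  assumes smult_closed:
      "\<lbrakk>a \<in> carrier R; x \<in> carrier M\<rbrakk> \<Longrightarrow> a \<odot>\<^bsub>M\<^esub> x \<in> carrier M"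
    and smult_l_distr:
      "\<lbrakk>a \<in> carrier R; b \<in> carrier R; x \<in> carrier M\<rbrakk> \<Longrightarrow>
       (a \<oplus> b) \<odot>\<^bsub>M\<^esub> x = a \<odot>\<^bsub>M\<^esub> x \<oplus>\<^bsub>M\<^esub> b \<odot>\<^bsub>M\<^esub> x"
    and smult_r_distr:
      "\<lbrakk>a \<in> carrier R; x \<in> carrier M; y \<in> carrier M\<rbrakk> \<Longrightarrow>
       a \<odot>\<^bsub>M\<^esub> (x \<oplus>\<^bsub>M\<^esub> y) = a \<odot>\<^bsub>M\<^esub> x \<oplus>\<^bsub>M\<^esub> a \<odot>\<^bsub>M\<^esub> y"
    and smult_assoc1:
      "\<lbrakk>a \<in> carrier R; b \<in> carrier R; x \<in> carrier M\<rbrakk> \<Longrightarrow>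
       (a \<otimes> b) \<odot>\<^bsub>M\<^esub> x = a \<odot>\<^bsub>M\<^esub> (b \<odot>\<^bsub>M\<^esub> x)"
    and smult_one:
      "x \<in> carrier M \<Longrightarrow> \<one> \<odot>\<^bsub>M\<^esub> x = x"

definition LMod :: "'u set set \<Rightarrow> 'r ring \<Rightarrow> ('r, 'u) module set" where
  "LMod U R = {M. left_module R M \<and> carrier M \<in> U}"

definition mod_hom :: "'r ring \<Rightarrow> ('r, 'm) module \<Rightarrow> ('r, 'n) module \<Rightarrow> ('m \<Rightarrow> 'n) set" where
  "mod_hom R M N = {h \<in> carrier M \<rightarrow> carrier N.
     (\<forall>x\<in>carrier M. \<forall>y\<in>carrier M. h (x \<oplus>\<^bsub>M\<^esub> y) = h x \<oplus>\<^bsub>N\<^esub> h y) \<and>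
     (\<forall>r\<in>carrier R. \<forall>x\<in>carrier M. h (r \<odot>\<^bsub>M\<^esub> x) = r \<odot>\<^bsub>N\<^esub> h x)}"

definition mod_iso :: "'r ring \<Rightarrow> ('r, 'm) module \<Rightarrow> ('r, 'n) module \<Rightarrow> bool" where
  "mod_iso R M N \<longleftrightarrow> (\<exists>h\<in>mod_hom R M N. bij_betw h (carrier M) (carrier N))"

text \<open>Membership up to isomorphism, for modules whose elements are not of type \<open>'u\<close>.\<close>

definition in_class :: "'r ring \<Rightarrow> ('r, 'u) module set \<Rightarrow> ('r, 'm) module \<Rightarrow> bool" where
  "in_class R \<X> N \<longleftrightarrow> (\<exists>M\<in>\<X>. mod_iso R N M)"

definition short_exact ::
  "'r ring \<Rightarrow> ('r, 'l) module \<Rightarrow> ('l \<Rightarrow> 'm) \<Rightarrow> ('r, 'm) module \<Rightarrow> ('m \<Rightarrow> 'n) \<Rightarrow> ('r, 'n) module \<Rightarrow> bool"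
where
  "short_exact R L f M g N \<longleftrightarrow>
     f \<in> mod_hom R L M \<and> g \<in> mod_hom R M N \<and> inj_on f (carrier L) \<and>
     f ` carrier L = a_kernel M N g \<and> g ` carrier M = carrier N"

text \<open>\<open>\<dots> \<rightarrow> P 1 \<rightarrow> P 0 \<rightarrow> X \<rightarrow> 0\<close> is exact, with maps \<open>d n : P (n + 1) \<rightarrow> P n\<close> and \<open>e : P 0 \<rightarrow> X\<close>.\<close>

definition resolution ::
  "'r ring \<Rightarrow> (nat \<Rightarrow> ('r, 'u) module) \<Rightarrow> (nat \<Rightarrow> 'u \<Rightarrow> 'u) \<Rightarrow> ('u \<Rightarrow> 'x) \<Rightarrow> ('r, 'x) module \<Rightarrow> bool"
where
  "resolution R P d e X \<longleftrightarrow>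
     (\<forall>n. left_module R (P n) \<and> d n \<in> mod_hom R (P (Suc n)) (P n)) \<and>
     e \<in> mod_hom R (P 0) X \<and>
     e ` carrier (P 0) = carrier X \<and>
     d 0 ` carrier (P 1) = a_kernel (P 0) X e \<and>
     (\<forall>n. d (Suc n) ` carrier (P (Suc (Suc n))) = a_kernel (P (Suc n)) (P n) (d n))"

definition projective :: "'u set set \<Rightarrow> 'r ring \<Rightarrow> ('r, 'u) module \<Rightarrow> bool" where
  "projective U R P \<longleftrightarrow> P \<in> LMod U R \<and>
     (\<forall>M\<in>LMod U R. \<forall>N\<in>LMod U R. \<forall>g\<in>mod_hom R M N. \<forall>h\<in>mod_hom R P N.
        g ` carrier M = carrier N \<longrightarrow>
        (\<exists>h'\<in>mod_hom R P M. \<forall>x\<in>carrier P. g (h' x) = h x))"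

text \<open>Cocycles and coboundaries of degree \<open>n\<close> in the complex \<open>Hom(P, Y)\<close>.\<close>

definition cocycles ::
  "'r ring \<Rightarrow> (nat \<Rightarrow> ('r, 'u) module) \<Rightarrow> (nat \<Rightarrow> 'u \<Rightarrow> 'u) \<Rightarrow> ('r, 'u) module \<Rightarrow> nat \<Rightarrow> ('u \<Rightarrow> 'u) set"
where
  "cocycles R P d Y n =
     {f \<in> mod_hom R (P n) Y. \<forall>x\<in>carrier (P (Suc n)). f (d n x) = \<zero>\<^bsub>Y\<^esub>}"

definition coboundaries ::
  "'r ring \<Rightarrow> (nat \<Rightarrow> ('r, 'u) module) \<Rightarrow> (nat \<Rightarrow> 'u \<Rightarrow> 'u) \<Rightarrow> ('r, 'u) module \<Rightarrow> nat \<Rightarrow> ('u \<Rightarrow> 'u) set"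
where
  "coboundaries R P d Y n =
     {f \<in> mod_hom R (P n) Y.
        case n of 0 \<Rightarrow> \<forall>x\<in>carrier (P 0). f x = \<zero>\<^bsub>Y\<^esub>
        | Suc m \<Rightarrow> \<exists>g\<in>mod_hom R (P m) Y. \<forall>x\<in>carrier (P n). f x = g (d m x)}"

text \<open>\<open>Ext\<^sup>n(X, Y) = 0\<close>, computed with some projective resolution of \<open>X\<close>.\<close>

definition Ext_vanishes ::
  "'u set set \<Rightarrow> 'r ring \<Rightarrow> nat \<Rightarrow> ('r, 'u) module \<Rightarrow> ('r, 'u) module \<Rightarrow> bool" where
  "Ext_vanishes U R n X Y \<longleftrightarrow>
     (\<exists>P d e. resolution R P d e X \<and> (\<forall>i. projective U R (P i)) \<and>
        cocycles R P d Y n = coboundaries R P d Y n)"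

definition right_perp :: "'u set set \<Rightarrow> 'r ring \<Rightarrow> ('r, 'u) module set \<Rightarrow> ('r, 'u) module set" where
  "right_perp U R \<X> = {Y \<in> LMod U R. \<forall>X\<in>\<X>. Ext_vanishes U R 1 X Y}"

definition left_perp :: "'u set set \<Rightarrow> 'r ring \<Rightarrow> ('r, 'u) module set \<Rightarrow> ('r, 'u) module set" where
  "left_perp U R \<X> = {Y \<in> LMod U R. \<forall>X\<in>\<X>. Ext_vanishes U R 1 Y X}"

definition cotorsion_pair ::
  "'u set set \<Rightarrow> 'r ring \<Rightarrow> ('r, 'u) module set \<Rightarrow> ('r, 'u) module set \<Rightarrow> bool" where
  "cotorsion_pair U R \<F> \<C> \<longleftrightarrow> \<C> = right_perp U R \<F> \<and> \<F> = left_perp U R \<C>"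

definition complete_pair ::
  "'u set set \<Rightarrow> 'r ring \<Rightarrow> ('r, 'u) module set \<Rightarrow> ('r, 'u) module set \<Rightarrow> bool" where
  "complete_pair U R \<F> \<C> \<longleftrightarrow>
     (\<forall>M\<in>LMod U R.
        (\<exists>C'\<in>\<C>. \<exists>F\<in>\<F>. \<exists>f g. short_exact R C' f F g M) \<and>
        (\<exists>C\<in>\<C>. \<exists>F'\<in>\<F>. \<exists>f g. short_exact R M f C g F'))"

definition hereditary_pair ::
  "'u set set \<Rightarrow> 'r ring \<Rightarrow> ('r, 'u) module set \<Rightarrow> ('r, 'u) module set \<Rightarrow> bool" where
  "hereditary_pair U R \<F> \<C> \<longleftrightarrow> (\<forall>F\<in>\<F>. \<forall>C\<in>\<C>. \<forall>n\<ge>1. Ext_vanishes U R n F C)"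

definition hereditary_complete_cotorsion_pair ::
  "'u set set \<Rightarrow> 'r ring \<Rightarrow> ('r, 'u) module set \<Rightarrow> ('r, 'u) module set \<Rightarrow> bool" where
  "hereditary_complete_cotorsion_pair U R \<F> \<C> \<longleftrightarrow>
     cotorsion_pair U R \<F> \<C> \<and> complete_pair U R \<F> \<C> \<and> hereditary_pair U R \<F> \<C>"

text \<open>A finite resolution is one that is continued by zero modules.\<close>

definition res_dim_le ::
  "'r ring \<Rightarrow> ('r, 'u) module set \<Rightarrow> nat \<Rightarrow> ('r, 'x) module \<Rightarrow> bool" where
  "res_dim_le R \<F> k M \<longleftrightarrow>
     (\<exists>P d e. resolution R P d e M \<and> (\<forall>i\<le>k. P i \<in> \<F>) \<and> (\<forall>i>k. carrier (P i) = {\<zero>\<^bsub>P i\<^esub>}))"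

definition prod_module :: "'i set \<Rightarrow> ('i \<Rightarrow> ('r, 'm) module) \<Rightarrow> ('r, 'i \<Rightarrow> 'm) module" where
  "prod_module I M = \<lparr>carrier = (\<Pi>\<^sub>E i\<in>I. carrier (M i)), mult = undefined, one = undefined,
     zero = (\<lambda>i\<in>I. \<zero>\<^bsub>M i\<^esub>), add = (\<lambda>x y. \<lambda>i\<in>I. x i \<oplus>\<^bsub>M i\<^esub> y i),
     smult = (\<lambda>r x. \<lambda>i\<in>I. r \<odot>\<^bsub>M i\<^esub> x i)\<rparr>"

definition direct_sum :: "('r, 'm) module \<Rightarrow> ('r, 'n) module \<Rightarrow> ('r, 'm \<times> 'n) module" where
  "direct_sum M N = \<lparr>carrier = carrier M \<times> carrier N, mult = undefined, one = undefined,
     zero = (\<zero>\<^bsub>M\<^esub>, \<zero>\<^bsub>N\<^esub>), add = (\<lambda>(x, y) (x', y'). (x \<oplus>\<^bsub>M\<^esub> x', y \<oplus>\<^bsub>N\<^esub> y')),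
     smult = (\<lambda>r (x, y). (r \<odot>\<^bsub>M\<^esub> x, r \<odot>\<^bsub>N\<^esub> y))\<rparr>"

definition summands :: "'u set set \<Rightarrow> 'r ring \<Rightarrow> ('r, 'u) module set \<Rightarrow> ('r, 'u) module set" where
  "summands U R \<X> = {M \<in> LMod U R. \<exists>N\<in>LMod U R. in_class R \<X> (direct_sum M N)}"


definition restrict_scalars :: "('r \<Rightarrow> 'a) \<Rightarrow> ('a, 'm) module \<Rightarrow> ('r, 'm) module" where
  "restrict_scalars \<phi> M = \<lparr>carrier = carrier M, mult = mult M, one = one M,
     zero = zero M, add = add M, smult = (\<lambda>r x. \<phi> r \<odot>\<^bsub>M\<^esub> x)\<rparr>"

definition regular_module :: "'a ring \<Rightarrow> ('a, 'a) module" where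
  "regular_module A = \<lparr>carrier = carrier A, mult = mult A, one = one A,
     zero = zero A, add = add A, smult = mult A\<rparr>"

text \<open>\<open>Hom\<^sub>R(A, M)\<close>; functions are extensional so that each homomorphism is represented once.\<close>

definition coinduced ::
  "'r ring \<Rightarrow> 'a ring \<Rightarrow> ('r \<Rightarrow> 'a) \<Rightarrow> ('r, 'm) module \<Rightarrow> ('a, 'a \<Rightarrow> 'm) module" where
  "coinduced R A \<phi> M =
     \<lparr>carrier = mod_hom R (restrict_scalars \<phi> (regular_module A)) M \<inter> extensional (carrier A),
      mult = undefined, one = undefined,
      zero = (\<lambda>x\<in>carrier A. \<zero>\<^bsub>M\<^esub>),
      add = (\<lambda>f g. \<lambda>x\<in>carrier A. f x \<oplus>\<^bsub>M\<^esub> g x),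
      smult = (\<lambda>a f. \<lambda>x\<in>carrier A. f (x \<otimes>\<^bsub>A\<^esub> a))\<rparr>"

definition coinduced_class ::
  "'u set set \<Rightarrow> 'r ring \<Rightarrow> 'a ring \<Rightarrow> ('r \<Rightarrow> 'a) \<Rightarrow> ('r, 'u) module set \<Rightarrow> ('a, 'u) module set" where
  "coinduced_class U R A \<phi> \<T> = {N \<in> LMod U A. \<exists>T\<in>\<T>. mod_iso A N (coinduced R A \<phi> T)}"

definition underlying_in ::
  "'u set set \<Rightarrow> 'a ring \<Rightarrow> ('r \<Rightarrow> 'a) \<Rightarrow> ('r, 'u) module set \<Rightarrow> ('a, 'u) module set" where
  "underlying_in U A \<phi> \<F> = {M \<in> LMod U A. restrict_scalars \<phi> M \<in> \<F>}"


text \<open>An ordinal \<open>\<alpha>\<close> is represented by an element \<open>\<alpha>\<close> of a well-ordered type such that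
  \<open>{..<\<alpha>}\<close> has order type \<open>\<alpha>\<close>.\<close>

definition osucc :: "'o::wellorder \<Rightarrow> 'o" where
  "osucc i = (LEAST j. i < j)"

definition limit_ordinal :: "'o::wellorder \<Rightarrow> bool" where
  "limit_ordinal i \<longleftrightarrow> (\<exists>j. j < i) \<and> (\<forall>j<i. \<exists>l. j < l \<and> l < i)"

text \<open>The underlying set of the inverse limit of \<open>G j\<close>, \<open>j < i\<close>, as compatible families.\<close>

definition inverse_limit ::
  "('o::wellorder \<Rightarrow> ('r, 'u) module) \<Rightarrow> ('o \<Rightarrow> 'o \<Rightarrow> 'u \<Rightarrow> 'u) \<Rightarrow> 'o \<Rightarrow> ('o \<Rightarrow> 'u) set" where
  "inverse_limit G p i =
     {x \<in> (\<Pi>\<^sub>E j\<in>{..<i}. carrier (G j)). \<forall>j<i. \<forall>l<j. p j l (x j) = x l}"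

text \<open>\<open>p i j\<close> is the map \<open>G i \<rightarrow> G j\<close> for \<open>j < i\<close>.\<close>

definition cofiltration ::
  "'u set set \<Rightarrow> 'r ring \<Rightarrow> 'o::wellorder \<Rightarrow> ('r, 'u) module \<Rightarrow>
   ('o \<Rightarrow> ('r, 'u) module) \<Rightarrow> ('o \<Rightarrow> 'o \<Rightarrow> 'u \<Rightarrow> 'u) \<Rightarrow> bool" where
  "cofiltration U R \<alpha> N G p \<longleftrightarrow>
     (\<forall>i\<le>\<alpha>. G i \<in> LMod U R) \<and>
     (\<forall>i\<le>\<alpha>. \<forall>j<i. p i j \<in> mod_hom R (G i) (G j)) \<and>
     (\<forall>i\<le>\<alpha>. \<forall>j<i. \<forall>l<j. \<forall>x\<in>carrier (G i). p j l (p i j x) = p i l x) \<and>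
     (let i0 = (LEAST i. True) in carrier (G i0) = {\<zero>\<^bsub>G i0\<^esub>}) \<and>
     G \<alpha> = N \<and>
     (\<forall>i\<le>\<alpha>. limit_ordinal i \<longrightarrow>
        bij_betw (\<lambda>x. \<lambda>j\<in>{..<i}. p i j x) (carrier (G i)) (inverse_limit G p i)) \<and>
     (\<forall>i<\<alpha>. p (osucc i) i ` carrier (G (osucc i)) = carrier (G i))"

definition kernel_module ::
  "('r, 'm) module \<Rightarrow> ('r, 'n) module \<Rightarrow> ('m \<Rightarrow> 'n) \<Rightarrow> ('r, 'm) module" where
  "kernel_module M N h = M\<lparr>carrier := a_kernel M N h\<rparr>"

definition Cof ::
  "'u set set \<Rightarrow> 'r ring \<Rightarrow> 'o::wellorder \<Rightarrow> ('r, 'u) module set \<Rightarrow> ('r, 'u) module set" where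
  "Cof U R \<alpha> \<T> = {N \<in> LMod U R. \<exists>G p. cofiltration U R \<alpha> N G p \<and>
     (\<forall>i<\<alpha>. in_class R \<T> (kernel_module (G (osucc i)) (G i) (p (osucc i) i)))}"

text \<open>The ordinals below \<open>\<omega> + \<omega>\<close>: \<open>Fin n\<close> is \<open>n\<close> and \<open>Omega_plus n\<close> is \<open>\<omega> + n\<close>.\<close>

datatype ord_2omega = Fin nat | Omega_plus nat

instantiation ord_2omega :: wellorder
begin

fun less_eq_ord_2omega :: "ord_2omega \<Rightarrow> ord_2omega \<Rightarrow> bool" where
  "Fin m \<le> Fin n \<longleftrightarrow> m \<le> n"
| "Fin m \<le> Omega_plus n \<longleftrightarrow> True"
| "Omega_plus m \<le> Fin n \<longleftrightarrow> False"
| "Omega_plus m \<le> Omega_plus n \<longleftrightarrow> m \<le> n"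

definition less_ord_2omega :: "ord_2omega \<Rightarrow> ord_2omega \<Rightarrow> bool" where
  "x < y \<longleftrightarrow> x \<le> y \<and> \<not> y \<le> (x :: ord_2omega)"

instance
proof
  fix x y z :: ord_2omega
  show "x < y \<longleftrightarrow> x \<le> y \<and> \<not> y \<le> x" by (fact less_ord_2omega_def)
  show "x \<le> x" by (cases x) auto
  show "x \<le> y \<Longrightarrow> y \<le> z \<Longrightarrow> x \<le> z" by (cases x; cases y; cases z) auto
  show "x \<le> y \<Longrightarrow> y \<le> x \<Longrightarrow> x = y" by (cases x; cases y) auto
  show "x \<le> y \<or> y \<le> x" by (cases x; cases y) auto
next
  fix P :: "ord_2omega \<Rightarrow> bool" and a
  assume step: "\<And>x. (\<And>y. y < x \<Longrightarrow> P y) \<Longrightarrow> P x"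
  have fin: "P (Fin n)" for n
  proof (induction n rule: less_induct)
    case (less n)
    show ?case
    proof (rule step)
      fix y assume "y < Fin n"
      then show "P y" using less by (cases y) (auto simp: less_ord_2omega_def)
    qed
  qed
  have "P (Omega_plus n)" for n
  proof (induction n rule: less_induct)
    case (less n)
    show ?case
    proof (rule step)
      fix y assume "y < Omega_plus n"
      then show "P y" using less fin by (cases y) (auto simp: less_ord_2omega_def)
    qed
  qed
  with fin show "P a" by (cases a) auto
qed

end

end

theory Submission
  imports Defs
begin

text \<open>
  Write \<open>H(M)\<close> for the coinduced module \<open>Hom\<^sub>R(A, M)\<close>. Throughout, \<open>Ext\<^sup>1(X, Y) = 0\<close> is used in the
  following form, called \<open>ext_orth\<close>: for every epimorphism \<open>M \<rightarrow> X\<close>, each homomorphism from its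
  kernel to \<open>Y\<close> extends to \<open>M\<close>. This refers neither to resolutions nor to pushouts, and higher
  \<open>Ext\<close> groups enter only through syzygies.

  \<^emph>\<open>Orthogonality.\<close> By the adjunction between restriction and coinduction, an \<open>A\<close>-linear map into
  \<open>H(C)\<close> is an \<open>R\<close>-linear map into \<open>C\<close>, so an extension problem for the former is one for the latter.
  Hence \<open>H(C)\<close>, for \<open>C\<close> in \<open>\<C>\<close>, is orthogonal to all \<open>A\<close>-modules that lie in \<open>\<F>\<close> over \<open>R\<close>
  (\<open>ext_orth_coinduced\<close>). The dual Eklof lemma \<open>ext_orth_Cof\<close> passes from \<open>H(\<C>)\<close> to modules
  cofiltered by \<open>H(\<C>)\<close>.

  \<^emph>\<open>One step of the approximation.\<close> Given an \<open>A\<close>-module \<open>N\<close>, take an \<open>R\<close>-linear special precover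
  \<open>F \<rightarrow> N\<close> with kernel \<open>C'\<close> in \<open>\<C>\<close>. Since \<open>A\<close> is in \<open>\<F>\<close>, the map \<open>H(F) \<rightarrow> H(N)\<close> is surjective with
  kernel \<open>H(C')\<close>; its pullback along the unit \<open>N \<rightarrow> H(N)\<close> is an epimorphism \<open>Q \<rightarrow> N\<close> with kernel
  \<open>H(C')\<close>. It factors \<open>R\<close>-linearly through \<open>F\<close>. Moreover evaluation at \<open>1\<close> splits the unit over \<open>R\<close>,
  say \<open>H(N) = N \<oplus> T\<close>, and then \<open>Q\<close> is the kernel of the epimorphism \<open>H(F) \<rightarrow> T\<close>. As \<open>H\<close> does not
  raise the \<open>\<F>\<close>-resolution dimension, \<open>Q\<close> has dimension at most \<open>d\<close> if \<open>N\<close> has dimension at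
  most \<open>d + 1\<close> (\<open>coinduced_step_exists\<close>).

  \<^emph>\<open>The tower.\<close> Iteration yields a tower \<open>\<dots> \<rightarrow> Q\<^sub>2 \<rightarrow> Q\<^sub>1 \<rightarrow> Q\<^sub>0 = N\<close> whose maps factor over \<open>R\<close> through
  modules \<open>F\<^sub>n\<close> of \<open>\<F>\<close>. Interleaving shows that its limit \<open>L\<close> is also the limit of the \<open>F\<^sub>n\<close>, that is, the
  kernel of a map \<open>1 - w\<close> from \<open>\<Prod> F\<^sub>n\<close> to itself, where \<open>w\<close> shifts a sequence along the maps of
  the tower. That map is surjective by a Mittag-Leffler argument. So \<open>L\<close> has dimension at most
  \<open>k\<close> (\<open>coinduced_tower_limit\<close>), and \<open>k\<close> further steps lead to a module that lies in \<open>\<F>\<close> over \<open>R\<close>.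
  These are \<open>\<omega> + k\<close> steps.

  \<^emph>\<open>Completeness.\<close> For a map \<open>X \<rightarrow> N\<close> from a coinduced module, the pullback of the whole tower
  is an \<open>(\<omega> + k)\<close>-cofiltration of the fibre product, with \<open>X\<close> as its first factor
  (\<open>special_cover_exists\<close>). For \<open>X = 0\<close> this is a special precover of \<open>N\<close>. For \<open>X = H(C)\<close>, with \<open>M\<close>
  embedded in \<open>H(C)\<close> and \<open>N = H(C)/M\<close>, it is a special preenvelope of \<open>M\<close>. Orthogonality
  and the splitting of these sequences identify the two classes as each other's orthogonals.
\<close>

section \<open>Left modules and their homomorphisms\<close>

lemma left_moduleI:
  fixes R (structure) and M (structure)
  assumes "ring R"
    and "\<zero>\<^bsub>M\<^esub> \<in> carrier M"
    and "\<And>x y. \<lbrakk>x \<in> carrier M; y \<in> carrier M\<rbrakk> \<Longrightarrow> x \<oplus>\<^bsub>M\<^esub> y \<in> carrier M"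
    and "\<And>a x. \<lbrakk>a \<in> carrier R; x \<in> carrier M\<rbrakk> \<Longrightarrow> a \<odot>\<^bsub>M\<^esub> x \<in> carrier M"
    and "\<And>x y z. \<lbrakk>x \<in> carrier M; y \<in> carrier M; z \<in> carrier M\<rbrakk> \<Longrightarrow>
           (x \<oplus>\<^bsub>M\<^esub> y) \<oplus>\<^bsub>M\<^esub> z = x \<oplus>\<^bsub>M\<^esub> (y \<oplus>\<^bsub>M\<^esub> z)"
    and "\<And>x y. \<lbrakk>x \<in> carrier M; y \<in> carrier M\<rbrakk> \<Longrightarrow> x \<oplus>\<^bsub>M\<^esub> y = y \<oplus>\<^bsub>M\<^esub> x"
    and "\<And>x. x \<in> carrier M \<Longrightarrow> \<zero>\<^bsub>M\<^esub> \<oplus>\<^bsub>M\<^esub> x = x"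
    and "\<And>x. x \<in> carrier M \<Longrightarrow> \<exists>y \<in> carrier M. y \<oplus>\<^bsub>M\<^esub> x = \<zero>\<^bsub>M\<^esub>"
    and "\<And>a b x. \<lbrakk>a \<in> carrier R; b \<in> carrier R; x \<in> carrier M\<rbrakk> \<Longrightarrow>
           (a \<oplus> b) \<odot>\<^bsub>M\<^esub> x = a \<odot>\<^bsub>M\<^esub> x \<oplus>\<^bsub>M\<^esub> b \<odot>\<^bsub>M\<^esub> x"
    and "\<And>a x y. \<lbrakk>a \<in> carrier R; x \<in> carrier M; y \<in> carrier M\<rbrakk> \<Longrightarrow>
           a \<odot>\<^bsub>M\<^esub> (x \<oplus>\<^bsub>M\<^esub> y) = a \<odot>\<^bsub>M\<^esub> x \<oplus>\<^bsub>M\<^esub> a \<odot>\<^bsub>M\<^esub> y"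
    and "\<And>a b x. \<lbrakk>a \<in> carrier R; b \<in> carrier R; x \<in> carrier M\<rbrakk> \<Longrightarrow>
           (a \<otimes> b) \<odot>\<^bsub>M\<^esub> x = a \<odot>\<^bsub>M\<^esub> (b \<odot>\<^bsub>M\<^esub> x)"
    and "\<And>x. x \<in> carrier M \<Longrightarrow> \<one> \<odot>\<^bsub>M\<^esub> x = x"
  shows "left_module R M"
proof -
  have "abelian_group M" by (rule abelian_groupI) (fact assms)+
  then show ?thesis
    by (intro left_module.intro left_module_axioms.intro) (auto simp: assms)
qed

lemma LModD: "M \<in> LMod U R \<Longrightarrow> left_module R M" "M \<in> LMod U R \<Longrightarrow> carrier M \<in> U"
  by (simp_all add: LMod_def)

lemma left_module_zero_closed: "left_module R M \<Longrightarrow> \<zero>\<^bsub>M\<^esub> \<in> carrier M"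
  by (simp add: left_module.axioms abelian_group.axioms abelian_monoid.zero_closed)

context left_module
begin

lemma smult_zero [simp]: "a \<in> carrier R \<Longrightarrow> a \<odot>\<^bsub>M\<^esub> \<zero>\<^bsub>M\<^esub> = \<zero>\<^bsub>M\<^esub>"
  by (metis M.add.l_cancel_one' M.zero_closed M.r_zero smult_closed smult_r_distr)

lemma zero_smult [simp]: "x \<in> carrier M \<Longrightarrow> \<zero> \<odot>\<^bsub>M\<^esub> x = \<zero>\<^bsub>M\<^esub>"
  by (metis M.add.l_cancel_one' R.zero_closed R.r_zero smult_closed smult_l_distr)

lemma smult_neg: "a \<in> carrier R \<Longrightarrow> x \<in> carrier M \<Longrightarrow> a \<odot>\<^bsub>M\<^esub> (\<ominus>\<^bsub>M\<^esub> x) = \<ominus>\<^bsub>M\<^esub> (a \<odot>\<^bsub>M\<^esub> x)"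
  by (metis M.a_inv_closed M.minus_equality M.l_neg smult_closed smult_r_distr smult_zero)

lemma neg_one_smult: "x \<in> carrier M \<Longrightarrow> (\<ominus> \<one>) \<odot>\<^bsub>M\<^esub> x = \<ominus>\<^bsub>M\<^esub> x"
  by (metis M.minus_equality R.a_inv_closed R.l_neg R.one_closed smult_closed smult_l_distr smult_one
      zero_smult)

lemma smult_minus: "\<lbrakk>a \<in> carrier R; x \<in> carrier M; y \<in> carrier M\<rbrakk> \<Longrightarrow>
    a \<odot>\<^bsub>M\<^esub> (x \<ominus>\<^bsub>M\<^esub> y) = a \<odot>\<^bsub>M\<^esub> x \<ominus>\<^bsub>M\<^esub> a \<odot>\<^bsub>M\<^esub> y"
  by (simp add: M.minus_eq smult_neg smult_r_distr)

lemma minus_eq_zero_iff: "\<lbrakk>x \<in> carrier M; y \<in> carrier M\<rbrakk> \<Longrightarrow> x \<ominus>\<^bsub>M\<^esub> y = \<zero>\<^bsub>M\<^esub> \<longleftrightarrow> x = y"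
  by (metis M.a_inv_closed M.minus_eq M.minus_equality M.minus_minus M.r_neg)

lemma minus_add_minus: "\<lbrakk>x \<in> carrier M; y \<in> carrier M; u \<in> carrier M; v \<in> carrier M\<rbrakk> \<Longrightarrow>
    (x \<oplus>\<^bsub>M\<^esub> y) \<ominus>\<^bsub>M\<^esub> (u \<oplus>\<^bsub>M\<^esub> v) = (x \<ominus>\<^bsub>M\<^esub> u) \<oplus>\<^bsub>M\<^esub> (y \<ominus>\<^bsub>M\<^esub> v)"
  by (simp add: M.minus_eq M.minus_add M.a_ac)

lemma add_minus_cancel: "\<lbrakk>x \<in> carrier M; y \<in> carrier M\<rbrakk> \<Longrightarrow> y \<oplus>\<^bsub>M\<^esub> (x \<ominus>\<^bsub>M\<^esub> y) = x"
  by (simp add: M.minus_eq M.a_lcomm M.r_neg)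

lemma minus_minus_cancel: "\<lbrakk>x \<in> carrier M; y \<in> carrier M\<rbrakk> \<Longrightarrow> x \<ominus>\<^bsub>M\<^esub> (x \<ominus>\<^bsub>M\<^esub> y) = y"
  by (simp add: M.minus_eq M.minus_add M.r_neg1 M.r_neg2)

lemma minus_zero [simp]: "x \<in> carrier M \<Longrightarrow> x \<ominus>\<^bsub>M\<^esub> \<zero>\<^bsub>M\<^esub> = x"
  by (simp add: M.minus_eq)

lemma minus_self [simp]: "x \<in> carrier M \<Longrightarrow> x \<ominus>\<^bsub>M\<^esub> x = \<zero>\<^bsub>M\<^esub>"
  by (simp add: minus_eq_zero_iff)

lemma left_module_subset:
  assumes "S \<subseteq> carrier M" and "\<zero>\<^bsub>M\<^esub> \<in> S"
    and "\<And>x y. \<lbrakk>x \<in> S; y \<in> S\<rbrakk> \<Longrightarrow> x \<oplus>\<^bsub>M\<^esub> y \<in> S"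
    and "\<And>a x. \<lbrakk>a \<in> carrier R; x \<in> S\<rbrakk> \<Longrightarrow> a \<odot>\<^bsub>M\<^esub> x \<in> S"
  shows "left_module R (M\<lparr>carrier := S\<rparr>)"
proof (rule left_moduleI)
  note S = subsetD[OF assms(1)]
  fix x assume x: "x \<in> carrier (M\<lparr>carrier := S\<rparr>)"
  then have "(\<ominus> \<one>) \<odot>\<^bsub>M\<^esub> x \<in> S" using assms(4) by simp
  then have "\<ominus>\<^bsub>M\<^esub> x \<in> S" using x S neg_one_smult by simp
  then show "\<exists>y\<in>carrier (M\<lparr>carrier := S\<rparr>). y \<oplus>\<^bsub>M\<lparr>carrier := S\<rparr>\<^esub> x = \<zero>\<^bsub>M\<lparr>carrier := S\<rparr>\<^esub>"
    using x S by (intro bexI[of _ "\<ominus>\<^bsub>M\<^esub> x"]) (auto simp: M.l_neg)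
qed (use assms subsetD[OF assms(1)] in
    \<open>auto simp: R.ring_axioms smult_l_distr smult_r_distr smult_assoc1 smult_one M.a_ac\<close>)

end

lemma a_kernel_eq: "a_kernel M N h = {x \<in> carrier M. h x = \<zero>\<^bsub>N\<^esub>}"
  by (simp add: a_kernel_def kernel_def)

lemma kernel_module_simps [simp]:
  "carrier (kernel_module M N h) = {x \<in> carrier M. h x = \<zero>\<^bsub>N\<^esub>}"
  "add (kernel_module M N h) = add M"
  "zero (kernel_module M N h) = zero M"
  "smult (kernel_module M N h) = smult M"
  by (simp_all add: kernel_module_def a_kernel_eq)

lemma mod_homI:
  assumes "\<And>x. x \<in> carrier M \<Longrightarrow> h x \<in> carrier N"
    and "\<And>x y. \<lbrakk>x \<in> carrier M; y \<in> carrier M\<rbrakk> \<Longrightarrow> h (x \<oplus>\<^bsub>M\<^esub> y) = h x \<oplus>\<^bsub>N\<^esub> h y"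
    and "\<And>r x. \<lbrakk>r \<in> carrier R; x \<in> carrier M\<rbrakk> \<Longrightarrow> h (r \<odot>\<^bsub>M\<^esub> x) = r \<odot>\<^bsub>N\<^esub> h x"
  shows "h \<in> mod_hom R M N"
  using assms by (auto simp: mod_hom_def)

lemma mod_hom_closed: "\<lbrakk>h \<in> mod_hom R M N; x \<in> carrier M\<rbrakk> \<Longrightarrow> h x \<in> carrier N"
  and mod_hom_add: "\<lbrakk>h \<in> mod_hom R M N; x \<in> carrier M; y \<in> carrier M\<rbrakk> \<Longrightarrow>
        h (x \<oplus>\<^bsub>M\<^esub> y) = h x \<oplus>\<^bsub>N\<^esub> h y"
  and mod_hom_smult: "\<lbrakk>h \<in> mod_hom R M N; r \<in> carrier R; x \<in> carrier M\<rbrakk> \<Longrightarrow>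
        h (r \<odot>\<^bsub>M\<^esub> x) = r \<odot>\<^bsub>N\<^esub> h x"
  by (auto simp: mod_hom_def)

lemma mod_hom_zero:
  assumes "left_module R M" "left_module R N" "h \<in> mod_hom R M N"
  shows "h \<zero>\<^bsub>M\<^esub> = \<zero>\<^bsub>N\<^esub>"
proof -
  interpret M: left_module R M by fact
  interpret N: left_module R N by fact
  have "h \<zero>\<^bsub>M\<^esub> \<oplus>\<^bsub>N\<^esub> h \<zero>\<^bsub>M\<^esub> = h \<zero>\<^bsub>M\<^esub>"
    using mod_hom_add[OF assms(3), of "\<zero>\<^bsub>M\<^esub>" "\<zero>\<^bsub>M\<^esub>"] by simp
  then show ?thesis using mod_hom_closed[OF assms(3)] by simp
qed

lemma mod_hom_neg:
  assumes "left_module R M" "left_module R N" "h \<in> mod_hom R M N" "x \<in> carrier M"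
  shows "h (\<ominus>\<^bsub>M\<^esub> x) = \<ominus>\<^bsub>N\<^esub> h x"
proof -
  interpret M: left_module R M by fact
  interpret N: left_module R N by fact
  have "h (\<ominus>\<^bsub>M\<^esub> x) \<oplus>\<^bsub>N\<^esub> h x = \<zero>\<^bsub>N\<^esub>"
    using mod_hom_add[OF assms(3), of "\<ominus>\<^bsub>M\<^esub> x" x] mod_hom_zero[OF assms(1-3)] assms(4)
    by (simp add: M.l_neg)
  then show ?thesis using mod_hom_closed[OF assms(3)] assms(4) by (metis M.a_inv_closed N.minus_equality)
qed

lemma mod_hom_minus:
  assumes "left_module R M" "left_module R N" "h \<in> mod_hom R M N" "x \<in> carrier M" "y \<in> carrier M"
  shows "h (x \<ominus>\<^bsub>M\<^esub> y) = h x \<ominus>\<^bsub>N\<^esub> h y"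
proof -
  interpret M: left_module R M by fact
  show ?thesis using assms
    by (simp add: a_minus_def mod_hom_add[OF assms(3)] mod_hom_neg[OF assms(1-3)])
qed

lemma mod_hom_comp: "\<lbrakk>f \<in> mod_hom R L M; g \<in> mod_hom R M N\<rbrakk> \<Longrightarrow> (\<lambda>x. g (f x)) \<in> mod_hom R L N"
  by (auto simp: mod_hom_def Pi_iff)

lemma mod_hom_id: "(\<lambda>x. x) \<in> mod_hom R M M"
  by (auto simp: mod_hom_def)

lemma mod_hom_zero_map:
  assumes "left_module R N" shows "(\<lambda>x. \<zero>\<^bsub>N\<^esub>) \<in> mod_hom R M N"
proof -
  interpret N: left_module R N by fact
  show ?thesis by (rule mod_homI) auto
qed

lemma mod_hom_sum:
  assumes "left_module R N" "f \<in> mod_hom R M N" "g \<in> mod_hom R M N"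
  shows "(\<lambda>x. f x \<oplus>\<^bsub>N\<^esub> g x) \<in> mod_hom R M N"
proof -
  interpret N: left_module R N by fact
  note c = mod_hom_closed[OF assms(2)] mod_hom_closed[OF assms(3)]
  show ?thesis
    by (rule mod_homI)
      (auto simp: c mod_hom_add[OF assms(2)] mod_hom_add[OF assms(3)] mod_hom_smult[OF assms(2)]
        mod_hom_smult[OF assms(3)] N.smult_r_distr N.a_ac)
qed

lemma mod_hom_diff:
  assumes "left_module R N" "f \<in> mod_hom R M N" "g \<in> mod_hom R M N"
  shows "(\<lambda>x. f x \<ominus>\<^bsub>N\<^esub> g x) \<in> mod_hom R M N"
proof -
  interpret N: left_module R N by fact
  note c = mod_hom_closed[OF assms(2)] mod_hom_closed[OF assms(3)]
  show ?thesis
    by (rule mod_homI)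
      (auto simp: c mod_hom_add[OF assms(2)] mod_hom_add[OF assms(3)] mod_hom_smult[OF assms(2)]
        mod_hom_smult[OF assms(3)] N.smult_minus N.minus_add_minus)
qed

lemma left_module_kernel:
  assumes "left_module R M" "left_module R N" "h \<in> mod_hom R M N"
  shows "left_module R (kernel_module M N h)"
proof -
  interpret M: left_module R M by fact
  interpret N: left_module R N by fact
  show ?thesis unfolding kernel_module_def
    by (rule M.left_module_subset)
      (auto simp: a_kernel_eq mod_hom_zero[OF assms] mod_hom_add[OF assms(3)] mod_hom_smult[OF assms(3)]
        M.smult_closed)
qed

lemma mod_hom_into_kernel:
  assumes "f \<in> mod_hom R L M" "\<And>x. x \<in> carrier L \<Longrightarrow> h (f x) = \<zero>\<^bsub>N\<^esub>"
  shows "f \<in> mod_hom R L (kernel_module M N h)"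
  using assms by (auto simp: mod_hom_def)

lemma mod_hom_from_kernel: "f \<in> mod_hom R L (kernel_module M N h) \<Longrightarrow> f \<in> mod_hom R L M"
  by (auto simp: mod_hom_def)

lemma mod_hom_on_kernel: "f \<in> mod_hom R M L \<Longrightarrow> f \<in> mod_hom R (kernel_module M N h) L"
  by (auto simp: mod_hom_def)

definition mod_epi :: "'r ring \<Rightarrow> ('r, 'm) module \<Rightarrow> ('m \<Rightarrow> 'n) \<Rightarrow> ('r, 'n) module \<Rightarrow> bool" where
  "mod_epi R M g N \<longleftrightarrow> g \<in> mod_hom R M N \<and> g ` carrier M = carrier N"

lemma mod_epiI: "\<lbrakk>g \<in> mod_hom R M N; \<And>y. y \<in> carrier N \<Longrightarrow> \<exists>x\<in>carrier M. g x = y\<rbrakk> \<Longrightarrow> mod_epi R M g N"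
  unfolding mod_epi_def by (blast dest: mod_hom_closed)

lemma mod_epi_hom: "mod_epi R M g N \<Longrightarrow> g \<in> mod_hom R M N"
  by (simp add: mod_epi_def)

lemma mod_epiE:
  assumes "mod_epi R M g N" "y \<in> carrier N"
  obtains x where "x \<in> carrier M" "g x = y"
proof -
  have "y \<in> g ` carrier M" using assms by (simp add: mod_epi_def)
  then show thesis by (rule imageE) (rule that, simp_all)
qed

lemma mod_epi_comp: "\<lbrakk>mod_epi R L f M; mod_epi R M g N\<rbrakk> \<Longrightarrow> mod_epi R L (\<lambda>x. g (f x)) N"
  using mod_hom_comp[of f R L M g N] by (simp add: mod_epi_def flip: image_image[of g f])

text \<open>A homomorphism that kills the kernel of an epimorphism descends to its target; this takes the place of
  working with quotients by elements of the kernel.\<close>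

lemma factor_through_epi:
  assumes "left_module R E" "left_module R M" "left_module R Y"
    and s: "mod_epi R E s M" and t: "t \<in> mod_hom R E Y"
    and ker: "\<And>x. \<lbrakk>x \<in> carrier E; s x = \<zero>\<^bsub>M\<^esub>\<rbrakk> \<Longrightarrow> t x = \<zero>\<^bsub>Y\<^esub>"
  obtains h where "h \<in> mod_hom R M Y" "\<forall>x\<in>carrier E. h (s x) = t x"
proof -
  interpret E: left_module R E by fact
  interpret M: left_module R M by fact
  interpret Y: left_module R Y by fact
  note s' = mod_epi_hom[OF s]
  define h where "h m = t (SOME x. x \<in> carrier E \<and> s x = m)" for m
  have eq: "t x = t x'" if "x \<in> carrier E" "x' \<in> carrier E" "s x = s x'" for x x'
  proof -
    have "s (x \<ominus>\<^bsub>E\<^esub> x') = \<zero>\<^bsub>M\<^esub>"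
      using that mod_hom_closed[OF s'] by (simp add: mod_hom_minus[OF assms(1,2) s'])
    then have "t (x \<ominus>\<^bsub>E\<^esub> x') = \<zero>\<^bsub>Y\<^esub>" using that by (intro ker) auto
    then show ?thesis
      using that mod_hom_closed[OF t] by (simp add: mod_hom_minus[OF assms(1,3) t] Y.minus_eq_zero_iff)
  qed
  have h: "h (s x) = t x" if "x \<in> carrier E" for x
  proof -
    have "(SOME x'. x' \<in> carrier E \<and> s x' = s x) \<in> carrier E \<and> s (SOME x'. x' \<in> carrier E \<and> s x' = s x) = s x"
      by (rule someI[of _ x]) (use that in auto)
    then show ?thesis unfolding h_def using eq that by blast
  qed
  have "h \<in> mod_hom R M Y"
  proof (rule mod_homI)
    fix x assume x: "x \<in> carrier M"
    obtain x' where "x' \<in> carrier E" "s x' = x" using s x by (rule mod_epiE)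
    then show "h x \<in> carrier Y" using h[of x'] mod_hom_closed[OF t] by auto
  next
    fix x y assume xy: "x \<in> carrier M" "y \<in> carrier M"
    obtain x' where x': "x' \<in> carrier E" "s x' = x" using s xy(1) by (rule mod_epiE)
    obtain y' where y': "y' \<in> carrier E" "s y' = y" using s xy(2) by (rule mod_epiE)
    show "h (x \<oplus>\<^bsub>M\<^esub> y) = h x \<oplus>\<^bsub>Y\<^esub> h y"
      using h[of "x' \<oplus>\<^bsub>E\<^esub> y'"] h[of x'] h[of y'] x' y' by (simp add: mod_hom_add[OF s'] mod_hom_add[OF t])
  next
    fix r x assume r: "r \<in> carrier R" "x \<in> carrier M"
    obtain x' where x': "x' \<in> carrier E" "s x' = x" using s r(2) by (rule mod_epiE)
    show "h (r \<odot>\<^bsub>M\<^esub> x) = r \<odot>\<^bsub>Y\<^esub> h x"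
      using h[of "r \<odot>\<^bsub>E\<^esub> x'"] h[of x'] x' r
      by (simp add: mod_hom_smult[OF s'] mod_hom_smult[OF t] E.smult_closed)
  qed
  then show thesis using h by (intro that) auto
qed

lemma mod_iso_inverse:
  assumes h: "h \<in> mod_hom R M N" "bij_betw h (carrier M) (carrier N)" and M: "left_module R M"
  obtains h' where "h' \<in> mod_hom R N M" "\<forall>x\<in>carrier M. h' (h x) = x" "\<forall>y\<in>carrier N. h (h' y) = y"
proof -
  interpret M: left_module R M by fact
  let ?h' = "inv_into (carrier M) h"
  have 1: "?h' (h x) = x" if "x \<in> carrier M" for x using h(2) that by (rule bij_betw_inv_into_left)
  have 2: "h (?h' y) = y" if "y \<in> carrier N" for y using h(2) that by (rule bij_betw_inv_into_right)
  have 3: "?h' y \<in> carrier M" if "y \<in> carrier N" for y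
    using h(2) that by (metis bij_betw_imp_surj_on inv_into_into)
  have "?h' \<in> mod_hom R N M"
  proof (rule mod_homI)
    fix x y assume xy: "x \<in> carrier N" "y \<in> carrier N"
    then have "h (?h' x \<oplus>\<^bsub>M\<^esub> ?h' y) = x \<oplus>\<^bsub>N\<^esub> y" by (simp add: mod_hom_add[OF h(1)] 2 3)
    then show "?h' (x \<oplus>\<^bsub>N\<^esub> y) = ?h' x \<oplus>\<^bsub>M\<^esub> ?h' y" using xy 1[of "?h' x \<oplus>\<^bsub>M\<^esub> ?h' y"] 3 by simp
  next
    fix r x assume r: "r \<in> carrier R" "x \<in> carrier N"
    then have "h (r \<odot>\<^bsub>M\<^esub> ?h' x) = r \<odot>\<^bsub>N\<^esub> x" by (simp add: mod_hom_smult[OF h(1)] 2 3)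
    then show "?h' (r \<odot>\<^bsub>N\<^esub> x) = r \<odot>\<^bsub>M\<^esub> ?h' x"
      using r 1[of "r \<odot>\<^bsub>M\<^esub> ?h' x"] 3 by (simp add: M.smult_closed)
  qed (fact 3)
  then show thesis using 1 2 by (intro that) auto
qed

lemma mod_isoI:
  assumes "h \<in> mod_hom R M N" "h' \<in> mod_hom R N M" "\<And>x. x \<in> carrier M \<Longrightarrow> h' (h x) = x"
    "\<And>y. y \<in> carrier N \<Longrightarrow> h (h' y) = y"
  shows "mod_iso R M N"
  unfolding mod_iso_def using assms
  by (intro bexI[of _ h] bij_betw_byWitness[where f' = h']) (auto simp: mod_hom_closed)

lemma mod_isoE:
  assumes "mod_iso R M N" "left_module R M"
  obtains h h' where "h \<in> mod_hom R M N" "h' \<in> mod_hom R N M" "\<forall>x\<in>carrier M. h' (h x) = x"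
    "\<forall>y\<in>carrier N. h (h' y) = y"
proof -
  obtain h where h: "h \<in> mod_hom R M N" "bij_betw h (carrier M) (carrier N)"
    using assms(1) by (auto simp: mod_iso_def)
  show thesis by (rule mod_iso_inverse[OF h assms(2)]) (rule that[OF h(1)])
qed

lemma mod_iso_refl: "mod_iso R M M"
  by (rule mod_isoI) (auto intro: mod_hom_id)

lemma mod_iso_sym: "\<lbrakk>mod_iso R M N; left_module R M\<rbrakk> \<Longrightarrow> mod_iso R N M"
  by (erule mod_isoE) (auto intro: mod_isoI)

lemma mod_iso_trans:
  assumes "mod_iso R L M" "mod_iso R M N" shows "mod_iso R L N"
proof -
  obtain f g where f: "f \<in> mod_hom R L M" "bij_betw f (carrier L) (carrier M)"
    and g: "g \<in> mod_hom R M N" "bij_betw g (carrier M) (carrier N)"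
    using assms by (auto simp: mod_iso_def)
  then show ?thesis unfolding mod_iso_def using mod_hom_comp[OF f(1) g(1)] bij_betw_trans[OF f(2) g(2)]
    by (auto simp: comp_def)
qed

lemma mod_isoI_inj:
  assumes "mod_epi R M h N" "left_module R M" "left_module R N"
    and "\<And>x. \<lbrakk>x \<in> carrier M; h x = \<zero>\<^bsub>N\<^esub>\<rbrakk> \<Longrightarrow> x = \<zero>\<^bsub>M\<^esub>"
  shows "mod_iso R M N"
proof -
  interpret M: left_module R M by fact
  interpret N: left_module R N by fact
  note h = mod_epi_hom[OF assms(1)]
  have "inj_on h (carrier M)"
  proof (rule inj_onI)
    fix x y assume xy: "x \<in> carrier M" "y \<in> carrier M" "h x = h y"
    then have "h (x \<ominus>\<^bsub>M\<^esub> y) = \<zero>\<^bsub>N\<^esub>"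
      using mod_hom_closed[OF h] by (simp add: mod_hom_minus[OF assms(2,3) h])
    then show "x = y" using assms(4)[of "x \<ominus>\<^bsub>M\<^esub> y"] xy by (simp add: M.minus_eq_zero_iff)
  qed
  then show ?thesis using assms(1) unfolding mod_iso_def mod_epi_def bij_betw_def by blast
qed

lemma mod_iso_kernel:
  assumes "h \<in> mod_hom R M M'" "h' \<in> mod_hom R M' M" "\<forall>x\<in>carrier M. h' (h x) = x"
    "\<forall>y\<in>carrier M'. h (h' y) = y"
    and g: "\<And>x. x \<in> carrier M \<Longrightarrow> g' (h x) = \<zero>\<^bsub>N'\<^esub> \<longleftrightarrow> g x = \<zero>\<^bsub>N\<^esub>"
  shows "mod_iso R (kernel_module M N g) (kernel_module M' N' g')"
proof (rule mod_isoI)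
  show "h \<in> mod_hom R (kernel_module M N g) (kernel_module M' N' g')"
    using g by (intro mod_hom_into_kernel mod_hom_on_kernel assms(1)) auto
  show "h' \<in> mod_hom R (kernel_module M' N' g') (kernel_module M N g)"
  proof (intro mod_hom_into_kernel mod_hom_on_kernel assms(2))
    fix y assume "y \<in> carrier (kernel_module M' N' g')"
    then show "g (h' y) = \<zero>\<^bsub>N\<^esub>" using g[of "h' y"] assms(4) mod_hom_closed[OF assms(2)] by auto
  qed
qed (use assms(3,4) in auto)

lemma mod_epi_iso:
  "\<lbrakk>h \<in> mod_hom R M N; h' \<in> mod_hom R N M; \<forall>y\<in>carrier N. h (h' y) = y\<rbrakk> \<Longrightarrow> mod_epi R M h N"
  by (rule mod_epiI) (auto intro: mod_hom_closed)

text \<open>The module structure on the image of a map \<open>e\<close> whose fibres are the classes of a congruence.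
  For injective \<open>e\<close> it is a copy of \<open>M\<close>; when \<open>e\<close> picks representatives of cosets, a quotient.
  Thus both constructions stay within a given type of elements.\<close>

definition image_module :: "('x \<Rightarrow> 'y) \<Rightarrow> ('r, 'x) module \<Rightarrow> ('r, 'y) module" where
  "image_module e M = \<lparr>carrier = e ` carrier M, mult = undefined, one = undefined,
     zero = e \<zero>\<^bsub>M\<^esub>,
     add = (\<lambda>x y. e (inv_into (carrier M) e x \<oplus>\<^bsub>M\<^esub> inv_into (carrier M) e y)),
     smult = (\<lambda>r x. e (r \<odot>\<^bsub>M\<^esub> inv_into (carrier M) e x))\<rparr>"

lemma image_module:
  assumes "left_module R M"
    and add: "\<And>x y x' y'. \<lbrakk>x \<in> carrier M; y \<in> carrier M; x' \<in> carrier M; y' \<in> carrier M;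
        e x = e x'; e y = e y'\<rbrakk> \<Longrightarrow> e (x \<oplus>\<^bsub>M\<^esub> y) = e (x' \<oplus>\<^bsub>M\<^esub> y')"
    and smult: "\<And>r x x'. \<lbrakk>r \<in> carrier R; x \<in> carrier M; x' \<in> carrier M; e x = e x'\<rbrakk> \<Longrightarrow>
        e (r \<odot>\<^bsub>M\<^esub> x) = e (r \<odot>\<^bsub>M\<^esub> x')"
  shows "left_module R (image_module e M)" and "mod_epi R M e (image_module e M)"
proof -
  interpret M: left_module R M by fact
  let ?N = "image_module e M"
  have inv: "inv_into (carrier M) e (e x) \<in> carrier M" "e (inv_into (carrier M) e (e x)) = e x"
    if "x \<in> carrier M" for x using that by (auto intro: inv_into_into f_inv_into_f)
  have c: "carrier ?N = e ` carrier M" and z: "\<zero>\<^bsub>?N\<^esub> = e \<zero>\<^bsub>M\<^esub>" by (simp_all add: image_module_def)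
  have a: "e x \<oplus>\<^bsub>?N\<^esub> e y = e (x \<oplus>\<^bsub>M\<^esub> y)" if "x \<in> carrier M" "y \<in> carrier M" for x y
    unfolding image_module_def by (simp, rule add) (use that inv in auto)
  have s: "r \<odot>\<^bsub>?N\<^esub> e x = e (r \<odot>\<^bsub>M\<^esub> x)" if "r \<in> carrier R" "x \<in> carrier M" for r x
    unfolding image_module_def by (simp, rule smult) (use that inv in auto)
  show "left_module R ?N"
  proof (rule left_moduleI)
    fix x assume "x \<in> carrier ?N"
    then obtain x' where "x = e x'" "x' \<in> carrier M" by (auto simp: c)
    then have "e (\<ominus>\<^bsub>M\<^esub> x') \<in> carrier ?N" "e (\<ominus>\<^bsub>M\<^esub> x') \<oplus>\<^bsub>?N\<^esub> x = \<zero>\<^bsub>?N\<^esub>"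
      by (auto simp: a c z M.l_neg)
    then show "\<exists>y\<in>carrier ?N. y \<oplus>\<^bsub>?N\<^esub> x = \<zero>\<^bsub>?N\<^esub>" by blast
  qed (auto simp: c z a s M.R.ring_axioms M.smult_closed M.smult_l_distr M.smult_r_distr M.smult_assoc1
      M.smult_one M.a_ac)
  show "mod_epi R M e ?N" unfolding mod_epi_def by (auto simp: mod_hom_def c a s)
qed

lemma prod_module_simps [simp]:
  "carrier (prod_module I M) = (\<Pi>\<^sub>E i\<in>I. carrier (M i))"
  "zero (prod_module I M) = (\<lambda>i\<in>I. \<zero>\<^bsub>M i\<^esub>)"
  "add (prod_module I M) = (\<lambda>x y. \<lambda>i\<in>I. x i \<oplus>\<^bsub>M i\<^esub> y i)"
  "smult (prod_module I M) = (\<lambda>r x. \<lambda>i\<in>I. r \<odot>\<^bsub>M i\<^esub> x i)"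
  by (simp_all add: prod_module_def)

lemma left_module_prod:
  assumes "ring R" "\<And>i. i \<in> I \<Longrightarrow> left_module R (M i)"
  shows "left_module R (prod_module I M)"
proof -
  have ag: "abelian_group (M i)" "abelian_monoid (M i)" if "i \<in> I" for i
    using assms(2)[OF that] by (simp_all add: left_module.axioms abelian_group.axioms)
  have sm: "a \<odot>\<^bsub>M i\<^esub> x \<in> carrier (M i)"
    "y \<in> carrier (M i) \<Longrightarrow> a \<odot>\<^bsub>M i\<^esub> (x \<oplus>\<^bsub>M i\<^esub> y) = a \<odot>\<^bsub>M i\<^esub> x \<oplus>\<^bsub>M i\<^esub> a \<odot>\<^bsub>M i\<^esub> y"
    if "i \<in> I" "a \<in> carrier R" "x \<in> carrier (M i)" for i a x y
    using left_module.smult_closed[OF assms(2)] left_module.smult_r_distr[OF assms(2)] that by auto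
  show ?thesis
  proof (rule left_moduleI)
    fix x assume x: "x \<in> carrier (prod_module I M)"
    then show "\<exists>y\<in>carrier (prod_module I M). y \<oplus>\<^bsub>prod_module I M\<^esub> x = \<zero>\<^bsub>prod_module I M\<^esub>"
      by (intro bexI[of _ "\<lambda>i\<in>I. \<ominus>\<^bsub>M i\<^esub> x i"])
        (auto simp: PiE_iff abelian_group.l_neg ag abelian_group.a_inv_closed intro!: restrict_ext)
    show "\<zero>\<^bsub>prod_module I M\<^esub> \<oplus>\<^bsub>prod_module I M\<^esub> x = x" "\<one>\<^bsub>R\<^esub> \<odot>\<^bsub>prod_module I M\<^esub> x = x"
      using x by (auto simp: PiE_iff assms(2) fun_eq_iff extensional_def left_module.smult_one
         ag abelian_monoid.l_zero)
  next
    fix x y assume "x \<in> carrier (prod_module I M)" "y \<in> carrier (prod_module I M)"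
    then show "x \<oplus>\<^bsub>prod_module I M\<^esub> y = y \<oplus>\<^bsub>prod_module I M\<^esub> x"
      by (auto simp: PiE_iff ag abelian_monoid.a_comm intro!: restrict_ext)
  qed (use assms in \<open>auto simp: PiE_iff sm ag
      abelian_monoid.a_assoc abelian_monoid.zero_closed abelian_monoid.a_closed
      left_module.smult_l_distr left_module.smult_assoc1 intro!: restrict_ext\<close>)
qed

lemma direct_sum_simps [simp]:
  "carrier (direct_sum M N) = carrier M \<times> carrier N"
  "zero (direct_sum M N) = (\<zero>\<^bsub>M\<^esub>, \<zero>\<^bsub>N\<^esub>)"
  "add (direct_sum M N) = (\<lambda>(x, y) (x', y'). (x \<oplus>\<^bsub>M\<^esub> x', y \<oplus>\<^bsub>N\<^esub> y'))"
  "smult (direct_sum M N) = (\<lambda>r (x, y). (r \<odot>\<^bsub>M\<^esub> x, r \<odot>\<^bsub>N\<^esub> y))"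
  by (simp_all add: direct_sum_def)

lemma left_module_direct_sum:
  assumes "left_module R M" "left_module R N"
  shows "left_module R (direct_sum M N)"
proof -
  interpret M: left_module R M by fact
  interpret N: left_module R N by fact
  show ?thesis
  proof (rule left_moduleI)
    fix x assume "x \<in> carrier (direct_sum M N)"
    then show "\<exists>y\<in>carrier (direct_sum M N). y \<oplus>\<^bsub>direct_sum M N\<^esub> x = \<zero>\<^bsub>direct_sum M N\<^esub>"
      by (intro bexI[of _ "(\<ominus>\<^bsub>M\<^esub> fst x, \<ominus>\<^bsub>N\<^esub> snd x)"]) (auto simp: M.l_neg N.l_neg)
  qed (auto simp: M.R.ring_axioms M.smult_closed N.smult_closed M.smult_l_distr N.smult_l_distr
      M.smult_r_distr N.smult_r_distr M.smult_assoc1 N.smult_assoc1 M.smult_one N.smult_one M.a_ac N.a_ac)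
qed

section \<open>Small modules\<close>

lemma small_lepoll: "\<lbrakk>small U Y; X \<lesssim> Y\<rbrakk> \<Longrightarrow> small U X"
  unfolding small_def by (meson lepoll_trans)

lemma small_subset: "\<lbrakk>small U Y; X \<subseteq> Y\<rbrakk> \<Longrightarrow> small U X"
  by (meson small_lepoll subset_imp_lepoll)

lemma small_inj: "\<lbrakk>small U Y; inj_on f X; \<And>x. x \<in> X \<Longrightarrow> f x \<in> Y\<rbrakk> \<Longrightarrow> small U X"
  by (rule small_lepoll) (auto simp: lepoll_def)

lemma small_image: "small U X \<Longrightarrow> small U (f ` X)"
  by (meson small_lepoll image_lepoll)

locale small_modules =
  fixes U :: "'u set set" and R :: "'r ring"
  assumes universe: "universe U" and ring: "ring R" and small_ring: "small U (carrier R)"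
begin

lemma small_in: "small U X \<Longrightarrow> X \<in> U" for X :: "'u set"
  using universe by (auto simp: universe_def)

lemma small_mem: "X \<in> U \<Longrightarrow> small U X"
  by (auto simp: small_def)

lemma small_times: "\<lbrakk>small U X; small U Y\<rbrakk> \<Longrightarrow> small U (X \<times> Y)"
proof -
  assume "small U X" "small U Y"
  then obtain X' Y' where "X' \<in> U" "Y' \<in> U" "X \<lesssim> X'" "Y \<lesssim> Y'" by (auto simp: small_def)
  moreover from this have "small U (X' \<times> Y')" using universe by (auto simp: universe_def)
  ultimately show "small U (X \<times> Y)" by (metis small_lepoll[OF _ times_lepoll_mono])
qed

lemma LModI: "left_module R M \<Longrightarrow> small U (carrier M) \<Longrightarrow> M \<in> LMod U R"
  by (simp add: LMod_def small_in)

lemma LMod_small: "M \<in> LMod U R \<Longrightarrow> small U (carrier M)"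
  by (simp add: LMod_def small_mem)

text \<open>Pullbacks, limits, free and coinduced modules are first built on pairs or functions; this moves
  them back into the universe.\<close>

lemma small_copy:
  assumes "left_module R M" "small U (carrier M)"
  obtains N h h' where "N \<in> LMod U R" "h \<in> mod_hom R M N" "h' \<in> mod_hom R N M"
    "\<forall>x\<in>carrier M. h' (h x) = x" "\<forall>y\<in>carrier N. h (h' y) = y"
proof -
  obtain Z e where e: "Z \<in> U" "inj_on e (carrier M)" "e ` carrier M \<subseteq> Z"
    using assms(2) by (auto simp: small_def lepoll_def)
  let ?N = "image_module e M"
  have 1: "left_module R ?N" "mod_epi R M e ?N"
    by (rule image_module[OF assms(1)]; use inj_onD[OF e(2)] in metis)+
  have "carrier ?N = e ` carrier M" by (simp add: image_module_def)
  then have N: "?N \<in> LMod U R" using 1(1) small_image[OF assms(2), of e] by (intro LModI) auto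
  have "bij_betw e (carrier M) (carrier ?N)" using e(2) by (simp add: bij_betw_def image_module_def)
  then show thesis
    by (rule mod_iso_inverse[OF mod_epi_hom[OF 1(2)] _ assms(1)]) (rule that[OF N mod_epi_hom[OF 1(2)]])
qed

lemma kernel_LMod:
  "\<lbrakk>M \<in> LMod U R; left_module R N; h \<in> mod_hom R M N\<rbrakk> \<Longrightarrow> kernel_module M N h \<in> LMod U R"
  by (intro LModI left_module_kernel) (auto simp: LMod_def intro: small_subset[OF small_mem])

text \<open>The quotient of \<open>M\<close> by the image of \<open>f\<close>. Its elements are chosen representatives of the cosets, so
  that they are again elements of the universe.\<close>

lemma quotient_exists:
  assumes L: "L \<in> LMod U R" and M: "M \<in> LMod U R" and f: "f \<in> mod_hom R L M"
  obtains N g where "N \<in> LMod U R" "mod_epi R M g N" "a_kernel M N g = f ` carrier L"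
proof -
  interpret L: left_module R L using L by (rule LModD)
  interpret M: left_module R M using M by (rule LModD)
  note lm = L.left_module_axioms M.left_module_axioms
  let ?S = "f ` carrier L"
  have S: "?S \<subseteq> carrier M" using mod_hom_closed[OF f] by auto
  have S0: "\<zero>\<^bsub>M\<^esub> \<in> ?S" using mod_hom_zero[OF lm f] by (metis L.zero_closed imageI)
  have Sadd: "x \<oplus>\<^bsub>M\<^esub> y \<in> ?S" if "x \<in> ?S" "y \<in> ?S" for x y
    using that by (auto simp flip: mod_hom_add[OF f])
  have Ssm: "r \<odot>\<^bsub>M\<^esub> x \<in> ?S" if "r \<in> carrier R" "x \<in> ?S" for r x
    using that by (auto simp: L.smult_closed simp flip: mod_hom_smult[OF f])
  have Sneg: "\<ominus>\<^bsub>M\<^esub> x \<in> ?S" if "x \<in> ?S" for x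
    using that by (auto simp flip: mod_hom_neg[OF lm f])
  have minus_neg: "\<ominus>\<^bsub>M\<^esub> (x \<ominus>\<^bsub>M\<^esub> y) = y \<ominus>\<^bsub>M\<^esub> x" if "x \<in> carrier M" "y \<in> carrier M" for x y
    using that by (simp add: M.minus_eq M.minus_add M.a_comm)
  have minus_trans: "(x \<ominus>\<^bsub>M\<^esub> y) \<oplus>\<^bsub>M\<^esub> (y \<ominus>\<^bsub>M\<^esub> z) = x \<ominus>\<^bsub>M\<^esub> z"
    if "x \<in> carrier M" "y \<in> carrier M" "z \<in> carrier M" for x y z
    using that by (simp add: M.minus_eq M.a_assoc M.r_neg1)
  define e where "e x = (SOME y. y \<in> carrier M \<and> x \<ominus>\<^bsub>M\<^esub> y \<in> ?S)" for x
  have e1: "e x \<in> carrier M \<and> x \<ominus>\<^bsub>M\<^esub> e x \<in> ?S" if "x \<in> carrier M" for x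
    unfolding e_def by (rule someI[of _ x]) (use that S0 in auto)
  have e2: "e x = e y \<longleftrightarrow> x \<ominus>\<^bsub>M\<^esub> y \<in> ?S" if "x \<in> carrier M" "y \<in> carrier M" for x y
  proof
    assume "e x = e y"
    then have "x \<ominus>\<^bsub>M\<^esub> e y \<in> ?S" "\<ominus>\<^bsub>M\<^esub> (y \<ominus>\<^bsub>M\<^esub> e y) \<in> ?S"
      using e1[OF that(1)] e1[OF that(2)] Sneg by auto
    then show "x \<ominus>\<^bsub>M\<^esub> y \<in> ?S"
      using Sadd minus_trans[of x "e y" y] minus_neg that e1 by metis
  next
    assume *: "x \<ominus>\<^bsub>M\<^esub> y \<in> ?S"
    then have *: "x \<ominus>\<^bsub>M\<^esub> y \<in> ?S" "y \<ominus>\<^bsub>M\<^esub> x \<in> ?S" using Sneg[OF *] minus_neg that by auto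
    have "x \<ominus>\<^bsub>M\<^esub> z \<in> ?S \<longleftrightarrow> y \<ominus>\<^bsub>M\<^esub> z \<in> ?S" if z: "z \<in> carrier M" for z
      using Sadd[OF *(1), of "y \<ominus>\<^bsub>M\<^esub> z"] Sadd[OF *(2), of "x \<ominus>\<^bsub>M\<^esub> z"]
        minus_trans[of x y z] minus_trans[of y x z] z that \<open>x \<in> carrier M\<close> \<open>y \<in> carrier M\<close> by auto
    then show "e x = e y" unfolding e_def by metis
  qed
  let ?N = "image_module e M"
  have N: "left_module R ?N" "mod_epi R M e ?N"
  proof -
    have a: "e (x \<oplus>\<^bsub>M\<^esub> y) = e (x' \<oplus>\<^bsub>M\<^esub> y')" if "x \<in> carrier M" "y \<in> carrier M" "x' \<in> carrier M"
      "y' \<in> carrier M" "e x = e x'" "e y = e y'" for x y x' y'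
      using that Sadd[of "x \<ominus>\<^bsub>M\<^esub> x'" "y \<ominus>\<^bsub>M\<^esub> y'"] by (simp add: e2 M.minus_add_minus)
    have b: "e (r \<odot>\<^bsub>M\<^esub> x) = e (r \<odot>\<^bsub>M\<^esub> x')" if "r \<in> carrier R" "x \<in> carrier M" "x' \<in> carrier M"
      "e x = e x'" for r x x'
      using that Ssm[of r "x \<ominus>\<^bsub>M\<^esub> x'"] by (simp add: e2 M.smult_minus M.smult_closed)
    show "left_module R ?N" "mod_epi R M e ?N"
      by (rule image_module[OF lm(2) a b]; assumption)+
  qed
  have "carrier ?N = e ` carrier M" by (simp add: image_module_def)
  then have "?N \<in> LMod U R" using N(1) small_image[OF LMod_small[OF M], of e] by (intro LModI) auto
  moreover have "a_kernel M ?N e = ?S"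
    using e2[of _ "\<zero>\<^bsub>M\<^esub>"] S by (auto simp: a_kernel_eq image_module_def)
  ultimately show thesis using N(2) that by blast
qed

definition is_pullback ::
  "('r, 'e) module \<Rightarrow> ('e \<Rightarrow> 'm) \<Rightarrow> ('e \<Rightarrow> 'n) \<Rightarrow> ('r, 'm) module \<Rightarrow> ('m \<Rightarrow> 'x) \<Rightarrow> ('r, 'n) module \<Rightarrow>
   ('n \<Rightarrow> 'x) \<Rightarrow> bool" where
  "is_pullback E p q M f N g \<longleftrightarrow> p \<in> mod_hom R E M \<and> q \<in> mod_hom R E N \<and>
     bij_betw (\<lambda>x. (p x, q x)) (carrier E) {(m, n). m \<in> carrier M \<and> n \<in> carrier N \<and> f m = g n}"

lemma pullback_homs: "is_pullback E p q M f N g \<Longrightarrow> p \<in> mod_hom R E M"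
  "is_pullback E p q M f N g \<Longrightarrow> q \<in> mod_hom R E N"
  by (simp_all add: is_pullback_def)

lemma pullback_comm: "\<lbrakk>is_pullback E p q M f N g; x \<in> carrier E\<rbrakk> \<Longrightarrow> f (p x) = g (q x)"
  by (auto simp: is_pullback_def bij_betw_def)

lemma pullback_eqI: "\<lbrakk>is_pullback E p q M f N g; x \<in> carrier E; y \<in> carrier E; p x = p y; q x = q y\<rbrakk> \<Longrightarrow> x = y"
  by (auto simp: is_pullback_def bij_betw_def inj_on_def)

lemma pullback_ex:
  assumes "is_pullback E p q M f N g" "m \<in> carrier M" "n \<in> carrier N" "f m = g n"
  obtains x where "x \<in> carrier E" "p x = m" "q x = n"
proof -
  have "(m, n) \<in> (\<lambda>x. (p x, q x)) ` carrier E" using assms by (auto simp: is_pullback_def bij_betw_def)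
  then show thesis using that by auto
qed

lemma pullback_exists:
  assumes M: "left_module R M" "small U (carrier M)" and N: "left_module R N" "small U (carrier N)"
    and X: "left_module R X" and f: "f \<in> mod_hom R M X" and g: "g \<in> mod_hom R N X"
  obtains E p q where "E \<in> LMod U R" "is_pullback E p q M f N g"
proof -
  interpret M: left_module R M by fact
  interpret N: left_module R N by fact
  interpret X: left_module R X by fact
  let ?D = "direct_sum M N"
  let ?S = "{(m, n). m \<in> carrier M \<and> n \<in> carrier N \<and> f m = g n}"
  let ?P = "?D\<lparr>carrier := ?S\<rparr>"
  interpret D: left_module R ?D by (rule left_module_direct_sum) fact+
  have P: "left_module R ?P"
    by (rule D.left_module_subset)
      (auto simp: mod_hom_zero[OF M(1) X f] mod_hom_zero[OF N(1) X g] mod_hom_add[OF f] mod_hom_add[OF g]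
        mod_hom_smult[OF f] mod_hom_smult[OF g] M.smult_closed N.smult_closed)
  have "small U (carrier ?P)" by (rule small_subset[OF small_times[OF M(2) N(2)]]) auto
  from small_copy[OF P this] obtain E h h' where E: "E \<in> LMod U R" and h: "h \<in> mod_hom R ?P E" and
    h': "h' \<in> mod_hom R E ?P" "\<forall>x\<in>carrier ?P. h' (h x) = x" "\<forall>y\<in>carrier E. h (h' y) = y" .
  have "h ` ?S \<subseteq> carrier E" "h' ` carrier E \<subseteq> ?S"
    using mod_hom_closed[OF h] mod_hom_closed[OF h'(1)] by (simp_all add: image_subset_iff)
  then have "bij_betw h' (carrier E) ?S"
    by (intro bij_betw_byWitness[where f' = h]) (use h'(2,3) in auto)
  moreover have "fst \<in> mod_hom R ?P M" "snd \<in> mod_hom R ?P N" by (auto simp: mod_hom_def)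
  ultimately have "is_pullback E (\<lambda>x. fst (h' x)) (\<lambda>x. snd (h' x)) M f N g"
    using h'(1) by (auto simp: is_pullback_def intro: mod_hom_comp)
  with E show thesis by (rule that)
qed

lemma pullback_universal:
  assumes pb: "is_pullback E p q M f N g" and E: "left_module R E" and T: "left_module R T"
    and h: "h \<in> mod_hom R T M" "k \<in> mod_hom R T N" "\<And>x. x \<in> carrier T \<Longrightarrow> f (h x) = g (k x)"
  obtains u where "u \<in> mod_hom R T E" "\<forall>x\<in>carrier T. p (u x) = h x" "\<forall>x\<in>carrier T. q (u x) = k x"
proof -
  interpret E: left_module R E by fact
  interpret T: left_module R T by fact
  have "\<forall>x\<in>carrier T. \<exists>y\<in>carrier E. p y = h x \<and> q y = k x"
    using h by (metis pullback_ex[OF pb] mod_hom_closed)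
  then obtain u where u: "\<And>x. x \<in> carrier T \<Longrightarrow> u x \<in> carrier E" "\<And>x. x \<in> carrier T \<Longrightarrow> p (u x) = h x"
     "\<And>x. x \<in> carrier T \<Longrightarrow> q (u x) = k x" by metis
  note pq = pullback_homs[OF pb]
  have "u \<in> mod_hom R T E"
    by (rule mod_homI; (rule pullback_eqI[OF pb])?)
      (auto simp: u E.smult_closed T.smult_closed mod_hom_add[OF pq(1)] mod_hom_add[OF pq(2)]
        mod_hom_smult[OF pq(1)] mod_hom_smult[OF pq(2)] mod_hom_add[OF h(1)] mod_hom_add[OF h(2)]
        mod_hom_smult[OF h(1)] mod_hom_smult[OF h(2)])
  then show thesis using u by (intro that) auto
qed

lemma pullback_epi:
  assumes pb: "is_pullback E p q M f N g" and "f \<in> mod_hom R M X" "mod_epi R N g X"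
  shows "mod_epi R E p M"
proof (rule mod_epiI)
  fix m assume m: "m \<in> carrier M"
  obtain n where "n \<in> carrier N" "g n = f m"
    using assms(3) mod_hom_closed[OF assms(2) m] by (rule mod_epiE)
  with m show "\<exists>x\<in>carrier E. p x = m" by (metis pullback_ex[OF pb])
qed (rule pullback_homs[OF pb])

lemma pullback_flip: "is_pullback E p q M f N g \<Longrightarrow> is_pullback E q p N g M f"
proof -
  assume pb: "is_pullback E p q M f N g"
  have "bij_betw (\<lambda>x. (q x, p x)) (carrier E) {(n, m). n \<in> carrier N \<and> m \<in> carrier M \<and> g n = f m}"
    unfolding bij_betw_def
    using pullback_eqI[OF pb] pullback_comm[OF pb] pullback_ex[OF pb] mod_hom_closed[OF pullback_homs(1)[OF pb]]
     mod_hom_closed[OF pullback_homs(2)[OF pb]]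
    by (auto simp: inj_on_def image_iff) metis
  then show "is_pullback E q p N g M f" using pb by (simp add: is_pullback_def)
qed

text \<open>Opposite maps of a pullback square have the same kernel: an element \<open>n\<close> of the kernel of \<open>g\<close>
  corresponds to the pair \<open>(0, n)\<close>.\<close>

lemma pullback_kernel_iso:
  assumes pb: "is_pullback E p q M f N g" and E: "left_module R E" and M: "left_module R M"
    and N: "left_module R N" and X: "left_module R X"
    and f: "f \<in> mod_hom R M X" and g: "g \<in> mod_hom R N X"
  shows "mod_iso R (kernel_module E M p) (kernel_module N X g)"
proof (rule mod_isoI_inj)
  interpret M: left_module R M by fact
  interpret N: left_module R N by fact
  interpret E: left_module R E by fact
  note pq = pullback_homs[OF pb]
  show "left_module R (kernel_module E M p)" by (rule left_module_kernel[OF E M pq(1)])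
  show "left_module R (kernel_module N X g)" by (rule left_module_kernel[OF N X g])
  show "mod_epi R (kernel_module E M p) q (kernel_module N X g)"
  proof (rule mod_epiI)
    show "q \<in> mod_hom R (kernel_module E M p) (kernel_module N X g)"
      using mod_hom_zero[OF M X f]
      by (intro mod_hom_into_kernel mod_hom_on_kernel pq(2)) (auto simp flip: pullback_comm[OF pb])
    fix n assume "n \<in> carrier (kernel_module N X g)"
    then have "n \<in> carrier N" "f \<zero>\<^bsub>M\<^esub> = g n" using mod_hom_zero[OF M X f] by auto
    then obtain x where "x \<in> carrier E" "p x = \<zero>\<^bsub>M\<^esub>" "q x = n" using pullback_ex[OF pb] by blast
    then show "\<exists>x\<in>carrier (kernel_module E M p). q x = n" by auto
  qed
  fix x assume "x \<in> carrier (kernel_module E M p)" "q x = \<zero>\<^bsub>kernel_module N X g\<^esub>"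
  then show "x = \<zero>\<^bsub>kernel_module E M p\<^esub>"
    using pullback_eqI[OF pb, of x "\<zero>\<^bsub>E\<^esub>"] mod_hom_zero[OF E M pq(1)] mod_hom_zero[OF E N pq(2)] by simp
qed

end

section \<open>Orthogonality\<close>

text \<open>A form of \<open>Ext\<^sup>1(X, Y) = 0\<close>: if \<open>0 \<rightarrow> K \<rightarrow> M \<rightarrow> X \<rightarrow> 0\<close> is exact, then homomorphisms \<open>K \<rightarrow> Y\<close>
  extend to \<open>M\<close>. The types of the elements of \<open>X\<close> and \<open>Y\<close> are arbitrary, so that it can be used for
  coinduced modules as they are; only \<open>M\<close> ranges over the universe.\<close>

definition ext_orth ::
  "'u set set \<Rightarrow> 'r ring \<Rightarrow> ('r, 'x) module \<Rightarrow> ('r, 'y) module \<Rightarrow> bool" where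
  "ext_orth U R X Y \<longleftrightarrow> (\<forall>M\<in>LMod U R. \<forall>g. mod_epi R M g X \<longrightarrow>
     (\<forall>h\<in>mod_hom R (kernel_module M X g) Y.
        \<exists>h'\<in>mod_hom R M Y. \<forall>x\<in>carrier M. g x = \<zero>\<^bsub>X\<^esub> \<longrightarrow> h' x = h x))"

lemma ext_orthD:
  assumes "ext_orth U R X Y" "M \<in> LMod U R" "mod_epi R M g X" "h \<in> mod_hom R (kernel_module M X g) Y"
  obtains h' where "h' \<in> mod_hom R M Y" "\<forall>x\<in>carrier M. g x = \<zero>\<^bsub>X\<^esub> \<longrightarrow> h' x = h x"
  using assms unfolding ext_orth_def by blast

lemma ext_orth_retract_right:
  assumes "ext_orth U R X Y'" "s \<in> mod_hom R Y Y'" "r \<in> mod_hom R Y' Y" "\<And>y. y \<in> carrier Y \<Longrightarrow> r (s y) = y"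
  shows "ext_orth U R X Y"
  unfolding ext_orth_def
proof (intro ballI allI impI)
  fix M g h assume M: "M \<in> LMod U R" "mod_epi R M g X" and h: "h \<in> mod_hom R (kernel_module M X g) Y"
  obtain h' where "h' \<in> mod_hom R M Y'" "\<forall>x\<in>carrier M. g x = \<zero>\<^bsub>X\<^esub> \<longrightarrow> h' x = s (h x)"
    using ext_orthD[OF assms(1) M mod_hom_comp[OF h assms(2)]] .
  then show "\<exists>h'\<in>mod_hom R M Y. \<forall>x\<in>carrier M. g x = \<zero>\<^bsub>X\<^esub> \<longrightarrow> h' x = h x"
    using assms(4) mod_hom_closed[OF h]
    by (intro bexI[of _ "\<lambda>x. r (h' x)"]) (auto intro: mod_hom_comp assms(3))
qed

lemma ext_orth_iso_right:
  "\<lbrakk>ext_orth U R X Y'; mod_iso R Y Y'; left_module R Y\<rbrakk> \<Longrightarrow> ext_orth U R X Y"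
  by (erule mod_isoE) (auto intro: ext_orth_retract_right)

context small_modules
begin

text \<open>The extension problem for \<open>M \<rightarrow> X\<close> is pulled back along the retraction \<open>r\<close> to one for \<open>X'\<close>, solved
  there, and restricted along the map \<open>M \<rightarrow> M \<times>\<^sub>X X'\<close> induced by the section \<open>s\<close>.\<close>

lemma ext_orth_retract_left:
  assumes X: "left_module R X" and X': "left_module R X'" "small U (carrier X')" and Y: "left_module R Y"
    and orth: "ext_orth U R X' Y"
    and s: "s \<in> mod_hom R X X'" and r: "r \<in> mod_hom R X' X" and rs: "\<And>x. x \<in> carrier X \<Longrightarrow> r (s x) = x"
  shows "ext_orth U R X Y"
  unfolding ext_orth_def
proof (intro ballI allI impI)
  fix M g h assume M: "M \<in> LMod U R" "mod_epi R M g X" and h: "h \<in> mod_hom R (kernel_module M X g) Y"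
  note lM = LModD(1)[OF M(1)] and g = mod_epi_hom[OF M(2)]
  obtain E p q where E: "E \<in> LMod U R" and pb: "is_pullback E p q M g X' r"
    by (rule pullback_exists[OF lM LMod_small[OF M(1)] X' X g r])
  note lE = LModD(1)[OF E] and pq = pullback_homs[OF pb]
  have q: "mod_epi R E q X'" by (rule pullback_epi[OF pullback_flip[OF pb] r M(2)])
  have "(\<lambda>x. h (p x)) \<in> mod_hom R (kernel_module E X' q) Y"
    using pullback_comm[OF pb] mod_hom_zero[OF X'(1) X r]
    by (intro mod_hom_comp[OF _ h] mod_hom_into_kernel mod_hom_on_kernel[OF pq(1)]) auto
  then obtain k where k: "k \<in> mod_hom R E Y" "\<forall>x\<in>carrier E. q x = \<zero>\<^bsub>X'\<^esub> \<longrightarrow> k x = h (p x)"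
    using ext_orthD[OF orth E q] by blast
  obtain u where u: "u \<in> mod_hom R M E" "\<forall>x\<in>carrier M. p (u x) = x" "\<forall>x\<in>carrier M. q (u x) = s (g x)"
    by (rule pullback_universal[OF pb lE lM mod_hom_id mod_hom_comp[OF g s]])
      (use rs mod_hom_closed[OF g] in auto)
  show "\<exists>h'\<in>mod_hom R M Y. \<forall>x\<in>carrier M. g x = \<zero>\<^bsub>X\<^esub> \<longrightarrow> h' x = h x"
    using u k(2) mod_hom_closed[OF u(1)] mod_hom_zero[OF X X'(1) s]
    by (intro bexI[of _ "\<lambda>x. k (u x)"]) (auto intro: mod_hom_comp k(1))
qed

text \<open>The preimage of the kernel of \<open>g\<close> under an epimorphism \<open>p\<close> is mapped onto that kernel, with unchanged
  kernel. The second part is an equality of modules, so that facts about one kernel can be rewritten to the other.\<close>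

lemma kernel_restrict:
  assumes E: "left_module R E" and B: "left_module R B" and p: "mod_epi R P p E" and g: "g \<in> mod_hom R E B"
  shows "mod_epi R (kernel_module P B (\<lambda>x. g (p x))) p (kernel_module E B g)"
    and "kernel_module (kernel_module P B (\<lambda>x. g (p x))) (kernel_module E B g) p = kernel_module P E p"
proof -
  show "mod_epi R (kernel_module P B (\<lambda>x. g (p x))) p (kernel_module E B g)"
  proof (rule mod_epiI)
    show "p \<in> mod_hom R (kernel_module P B (\<lambda>x. g (p x))) (kernel_module E B g)"
      by (intro mod_hom_into_kernel mod_hom_on_kernel mod_epi_hom[OF p]) auto
    fix y assume "y \<in> carrier (kernel_module E B g)"
    then have y: "y \<in> carrier E" "g y = \<zero>\<^bsub>B\<^esub>" by auto
    obtain x where "x \<in> carrier P" "p x = y" by (rule mod_epiE[OF p y(1)])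
    then show "\<exists>x\<in>carrier (kernel_module P B (\<lambda>x. g (p x))). p x = y" using y(2) by auto
  qed
  have "{x \<in> carrier P. g (p x) = \<zero>\<^bsub>B\<^esub> \<and> p x = \<zero>\<^bsub>E\<^esub>} = {x \<in> carrier P. p x = \<zero>\<^bsub>E\<^esub>}"
    using mod_hom_zero[OF E B g] by auto
  then show "kernel_module (kernel_module P B (\<lambda>x. g (p x))) (kernel_module E B g) p = kernel_module P E p"
    by (simp add: kernel_module_def a_kernel_eq)
qed

text \<open>For \<open>M \<rightarrow> X\<close>, a homomorphism is extended in two stages: first to the preimage of the submodule of
  \<open>X\<close>, then to all of \<open>M\<close>.\<close>

lemma ext_orth_extension:
  assumes X: "X \<in> LMod U R" and B: "left_module R B" and q: "mod_epi R X q B"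
    and orth: "ext_orth U R (kernel_module X B q) Y" "ext_orth U R B Y"
  shows "ext_orth U R X Y"
  unfolding ext_orth_def
proof (intro ballI allI impI)
  fix M g h assume M: "M \<in> LMod U R" "mod_epi R M g X" and h: "h \<in> mod_hom R (kernel_module M X g) Y"
  note qh = mod_epi_hom[OF q] and lX = LModD(1)[OF X]
  let ?M = "kernel_module M B (\<lambda>x. q (g x))"
  have qg: "mod_epi R M (\<lambda>x. q (g x)) B" by (rule mod_epi_comp[OF M(2) q])
  have M': "?M \<in> LMod U R" by (rule kernel_LMod[OF M(1) B mod_epi_hom[OF qg]])
  note kr = kernel_restrict[OF lX B M(2) qh]
  obtain h1 where h1: "h1 \<in> mod_hom R ?M Y" "\<forall>x\<in>carrier ?M. g x = \<zero>\<^bsub>X\<^esub> \<longrightarrow> h1 x = h x"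
    by (rule ext_orthD[OF orth(1) M' kr(1)]) (use h kr(2) in auto)
  obtain h2 where h2: "h2 \<in> mod_hom R M Y" "\<forall>x\<in>carrier M. q (g x) = \<zero>\<^bsub>B\<^esub> \<longrightarrow> h2 x = h1 x"
    by (rule ext_orthD[OF orth(2) M(1) qg h1(1)]) auto
  show "\<exists>h'\<in>mod_hom R M Y. \<forall>x\<in>carrier M. g x = \<zero>\<^bsub>X\<^esub> \<longrightarrow> h' x = h x"
    using h2 h1(2) mod_hom_zero[OF lX B qh] by (intro bexI[OF _ h2(1)]) auto
qed

text \<open>Orthogonality to the kernel of an epimorphism \<open>p\<close> is a lifting property: in a commutative square with
  the inclusion of the kernel of \<open>g\<close> on the left and \<open>p\<close> on the right, there is a diagonal. On the
  fibre product of \<open>M\<close> and \<open>G'\<close> over \<open>G\<close>, the difference of the two partial solutions takes values in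
  the kernel of \<open>p\<close> and can be extended; subtracting the extension gives a map that descends to \<open>M\<close>.\<close>

lemma lifting:
  assumes X: "left_module R X" and G': "G' \<in> LMod U R" and G: "left_module R G"
    and p: "mod_epi R G' p G" and orth: "ext_orth U R X (kernel_module G' G p)"
    and M: "M \<in> LMod U R" and g: "mod_epi R M g X"
    and h: "h \<in> mod_hom R (kernel_module M X g) G'" and t: "t \<in> mod_hom R M G"
    and comm: "\<And>x. \<lbrakk>x \<in> carrier M; g x = \<zero>\<^bsub>X\<^esub>\<rbrakk> \<Longrightarrow> p (h x) = t x"
  obtains t' where "t' \<in> mod_hom R M G'" "\<forall>x\<in>carrier M. p (t' x) = t x"
    "\<forall>x\<in>carrier M. g x = \<zero>\<^bsub>X\<^esub> \<longrightarrow> t' x = h x"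
proof -
  note lM = LModD(1)[OF M] and lG' = LModD(1)[OF G'] and ph = mod_epi_hom[OF p] and gh = mod_epi_hom[OF g]
  interpret G': left_module R G' by fact
  interpret G: left_module R G by fact
  obtain E a b where E: "E \<in> LMod U R" and pb: "is_pullback E a b M t G' p"
    by (rule pullback_exists[OF lM LMod_small[OF M] lG' LMod_small[OF G'] G t ph])
  note lE = LModD(1)[OF E] and ab = pullback_homs[OF pb]
  have a: "mod_epi R E a M" by (rule pullback_epi[OF pb t p])
  have ga: "mod_epi R E (\<lambda>x. g (a x)) X" by (rule mod_epi_comp[OF a g])
  let ?K = "kernel_module E X (\<lambda>x. g (a x))"
  have ha: "(\<lambda>x. h (a x)) \<in> mod_hom R ?K G'"
    by (intro mod_hom_comp[OF _ h] mod_hom_into_kernel mod_hom_on_kernel[OF ab(1)]) auto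
  have "(\<lambda>x. b x \<ominus>\<^bsub>G'\<^esub> h (a x)) \<in> mod_hom R ?K (kernel_module G' G p)"
  proof (intro mod_hom_into_kernel mod_hom_diff[OF lG' mod_hom_on_kernel[OF ab(2)] ha])
    fix x assume x: "x \<in> carrier ?K"
    then have "p (b x) = t (a x)" "p (h (a x)) = t (a x)"
      using pullback_comm[OF pb] comm mod_hom_closed[OF ab(1)] by auto
    then show "p (b x \<ominus>\<^bsub>G'\<^esub> h (a x)) = \<zero>\<^bsub>G\<^esub>"
      using x mod_hom_closed[OF ab(2)] mod_hom_closed[OF ha x] mod_hom_closed[OF t] mod_hom_closed[OF ab(1)]
      by (simp add: mod_hom_minus[OF lG' G ph])
  qed
  from ext_orthD[OF orth E ga this] obtain r where r: "r \<in> mod_hom R E (kernel_module G' G p)"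
    and r': "\<forall>x\<in>carrier E. g (a x) = \<zero>\<^bsub>X\<^esub> \<longrightarrow> r x = b x \<ominus>\<^bsub>G'\<^esub> h (a x)" .
  note rG = mod_hom_from_kernel[OF r]
  note cl = mod_hom_closed[OF ab(1)] mod_hom_closed[OF ab(2)] mod_hom_closed[OF rG]
  let ?t = "\<lambda>x. b x \<ominus>\<^bsub>G'\<^esub> r x"
  have h0: "h \<zero>\<^bsub>M\<^esub> = \<zero>\<^bsub>G'\<^esub>"
    using mod_hom_zero[OF left_module_kernel[OF lM X gh] lG' h] by simp
  have "?t x = \<zero>\<^bsub>G'\<^esub>" if "x \<in> carrier E" "a x = \<zero>\<^bsub>M\<^esub>" for x
    using r' that h0 cl mod_hom_zero[OF lM X gh] by simp
  then obtain t' where t': "t' \<in> mod_hom R M G'" "\<forall>x\<in>carrier E. t' (a x) = ?t x"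
    using factor_through_epi[OF lE lM lG' a mod_hom_diff[OF lG' ab(2) rG]] by metis
  have "p (t' m) = t m \<and> (g m = \<zero>\<^bsub>X\<^esub> \<longrightarrow> t' m = h m)" if m: "m \<in> carrier M" for m
  proof -
    obtain x where x: "x \<in> carrier E" "a x = m" using mod_epiE[OF a m] by blast
    have "p (r x) = \<zero>\<^bsub>G\<^esub>" using mod_hom_closed[OF r x(1)] by simp
    then have "p (t' m) = t m"
      using x t'(2) cl pullback_comm[OF pb x(1)] mod_hom_closed[OF t m]
      by (auto simp: mod_hom_minus[OF lG' G ph])
    moreover have "t' m = h m" if "g m = \<zero>\<^bsub>X\<^esub>"
    proof -
      have "h m \<in> carrier G'" using mod_hom_closed[OF h] m that by simp
      then show ?thesis using x t'(2) r' cl that by (auto simp: G'.minus_minus_cancel)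
    qed
    ultimately show ?thesis by blast
  qed
  then show thesis using t'(1) by (intro that) auto
qed

end

section \<open>Free modules and projective resolutions\<close>

lemma regular_module_simps [simp]:
  "carrier (regular_module S) = carrier S" "zero (regular_module S) = zero S"
  "add (regular_module S) = add S" "smult (regular_module S) = mult S"
  by (simp_all add: regular_module_def)

lemma left_module_regular:
  assumes "ring S" shows "left_module S (regular_module S)"
proof -
  interpret ring S by fact
  show ?thesis
    by (rule left_moduleI) (auto simp: ring_axioms a_ac m_assoc l_distr r_distr intro: bexI[of _ "\<ominus>\<^bsub>S\<^esub> _"] l_neg)
qed

definition free_module :: "'r ring \<Rightarrow> 'x set \<Rightarrow> ('r, 'x \<Rightarrow> 'r) module" where
  "free_module R X = (prod_module X (\<lambda>_. regular_module R))\<lparr>carrier :=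
     {f \<in> X \<rightarrow>\<^sub>E carrier R. finite {x \<in> X. f x \<noteq> \<zero>\<^bsub>R\<^esub>}}\<rparr>"

definition free_generator :: "'r ring \<Rightarrow> 'x set \<Rightarrow> 'x \<Rightarrow> 'x \<Rightarrow> 'r" where
  "free_generator R X x = (\<lambda>y\<in>X. if y = x then \<one>\<^bsub>R\<^esub> else \<zero>\<^bsub>R\<^esub>)"

lemma free_module_simps [simp]:
  "carrier (free_module R X) = {f \<in> X \<rightarrow>\<^sub>E carrier R. finite {x \<in> X. f x \<noteq> \<zero>\<^bsub>R\<^esub>}}"
  "zero (free_module R X) = (\<lambda>x\<in>X. \<zero>\<^bsub>R\<^esub>)"
  "add (free_module R X) = (\<lambda>f g. \<lambda>x\<in>X. f x \<oplus>\<^bsub>R\<^esub> g x)"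
  "smult (free_module R X) = (\<lambda>r f. \<lambda>x\<in>X. r \<otimes>\<^bsub>R\<^esub> f x)"
  by (simp_all add: free_module_def)

context
  fixes R :: "'r ring" (structure)
  assumes ring: "ring R"
begin

interpretation ring R by (rule ring)

lemma left_module_free: "left_module R (free_module R X)"
proof -
  interpret P: left_module R "prod_module X (\<lambda>_. regular_module R)"
    by (intro left_module_prod left_module_regular ring_axioms)
  have fin: "finite {x \<in> X. (\<lambda>x\<in>X. f x \<oplus> g x) x \<noteq> \<zero>}"
    if "finite {x \<in> X. f x \<noteq> \<zero>}" "finite {x \<in> X. g x \<noteq> \<zero>}" for f g
    by (rule finite_subset[OF _ finite_UnI[OF that]]) auto
  have fin': "finite {x \<in> X. (\<lambda>x\<in>X. r \<otimes> f x) x \<noteq> \<zero>}"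
    if "r \<in> carrier R" "finite {x \<in> X. f x \<noteq> \<zero>}" for f r
    by (rule finite_subset[OF _ that(2)]) (use that(1) in auto)
  show ?thesis unfolding free_module_def
    by (rule P.left_module_subset) (use fin fin' in \<open>auto simp: PiE_iff extensional_def\<close>)
qed

lemma free_generator_closed: "x \<in> X \<Longrightarrow> free_generator R X x \<in> carrier (free_module R X)"
proof -
  have "finite {y \<in> X. free_generator R X x y \<noteq> \<zero>}"
    by (rule finite_subset[of _ "{x}"]) (auto simp: free_generator_def)
  then show ?thesis by (auto simp: free_generator_def)
qed

lemma free_module_hom_exists:
  assumes "left_module R N" and n: "\<And>x. x \<in> X \<Longrightarrow> n x \<in> carrier N"
  obtains \<Phi> where "\<Phi> \<in> mod_hom R (free_module R X) N" "\<forall>x\<in>X. \<Phi> (free_generator R X x) = n x"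
proof -
  interpret N: left_module R N by fact
  define \<Phi> where "\<Phi> f = (\<Oplus>\<^bsub>N\<^esub>x\<in>{x \<in> X. f x \<noteq> \<zero>}. f x \<odot>\<^bsub>N\<^esub> n x)" for f
  have cl: "(\<lambda>x. f x \<odot>\<^bsub>N\<^esub> n x) \<in> B \<rightarrow> carrier N" if "f \<in> X \<rightarrow>\<^sub>E carrier R" "B \<subseteq> X" for f B
    using that n by (auto intro!: N.smult_closed)
  have \<Phi>: "\<Phi> f = (\<Oplus>\<^bsub>N\<^esub>x\<in>B. f x \<odot>\<^bsub>N\<^esub> n x)"
    if "f \<in> X \<rightarrow>\<^sub>E carrier R" "finite B" "B \<subseteq> X" "{x \<in> X. f x \<noteq> \<zero>} \<subseteq> B" for f B
    unfolding \<Phi>_def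
    by (rule N.add.finprod_mono_neutral_cong_left) (use that n cl in auto)
  have sm: "r \<odot>\<^bsub>N\<^esub> (\<Oplus>\<^bsub>N\<^esub>x\<in>B. k x) = (\<Oplus>\<^bsub>N\<^esub>x\<in>B. r \<odot>\<^bsub>N\<^esub> k x)"
    if "finite B" "r \<in> carrier R" "k \<in> B \<rightarrow> carrier N" for r k B
    using that
    by (induction B) (auto simp: N.smult_r_distr N.finsum_closed N.smult_closed Pi_iff N.finsum_insert)
  have "\<Phi> \<in> mod_hom R (free_module R X) N"
  proof (rule mod_homI)
    fix f assume f: "f \<in> carrier (free_module R X)"
    then show "\<Phi> f \<in> carrier N" unfolding \<Phi>_def by (intro N.finsum_closed cl) auto
    fix g assume g: "g \<in> carrier (free_module R X)"
    let ?B = "{x \<in> X. f x \<noteq> \<zero>} \<union> {x \<in> X. g x \<noteq> \<zero>}"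
    have B: "finite ?B" "?B \<subseteq> X" using f g by auto
    have "\<Phi> (f \<oplus>\<^bsub>free_module R X\<^esub> g) = (\<Oplus>\<^bsub>N\<^esub>x\<in>?B. (\<lambda>x\<in>X. f x \<oplus> g x) x \<odot>\<^bsub>N\<^esub> n x)"
      unfolding free_module_simps by (rule \<Phi>) (use f g B in auto)
    also have "\<dots> = (\<Oplus>\<^bsub>N\<^esub>x\<in>?B. f x \<odot>\<^bsub>N\<^esub> n x \<oplus>\<^bsub>N\<^esub> g x \<odot>\<^bsub>N\<^esub> n x)"
      by (rule N.finsum_cong') (use f g n in \<open>auto simp: PiE_iff N.smult_l_distr N.smult_closed\<close>)
    also have "\<dots> = \<Phi> f \<oplus>\<^bsub>N\<^esub> \<Phi> g"
    proof (subst N.finsum_addf)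
      show "(\<lambda>x. f x \<odot>\<^bsub>N\<^esub> n x) \<in> ?B \<rightarrow> carrier N" by (rule cl) (use f in auto)
      show "(\<lambda>x. g x \<odot>\<^bsub>N\<^esub> n x) \<in> ?B \<rightarrow> carrier N" by (rule cl) (use g in auto)
      have "\<Phi> f = (\<Oplus>\<^bsub>N\<^esub>x\<in>?B. f x \<odot>\<^bsub>N\<^esub> n x)" "\<Phi> g = (\<Oplus>\<^bsub>N\<^esub>x\<in>?B. g x \<odot>\<^bsub>N\<^esub> n x)"
        by (rule \<Phi>; use f g in auto)+
      then show "(\<Oplus>\<^bsub>N\<^esub>x\<in>?B. f x \<odot>\<^bsub>N\<^esub> n x) \<oplus>\<^bsub>N\<^esub> (\<Oplus>\<^bsub>N\<^esub>x\<in>?B. g x \<odot>\<^bsub>N\<^esub> n x) = \<Phi> f \<oplus>\<^bsub>N\<^esub> \<Phi> g"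
        by simp
    qed
    finally show "\<Phi> (f \<oplus>\<^bsub>free_module R X\<^esub> g) = \<Phi> f \<oplus>\<^bsub>N\<^esub> \<Phi> g" .
  next
    fix r f assume r: "r \<in> carrier R" and f: "f \<in> carrier (free_module R X)"
    let ?B = "{x \<in> X. f x \<noteq> \<zero>}"
    have "\<Phi> (r \<odot>\<^bsub>free_module R X\<^esub> f) = (\<Oplus>\<^bsub>N\<^esub>x\<in>?B. (\<lambda>x\<in>X. r \<otimes> f x) x \<odot>\<^bsub>N\<^esub> n x)"
      unfolding free_module_simps by (rule \<Phi>) (use f r in auto)
    also have "\<dots> = (\<Oplus>\<^bsub>N\<^esub>x\<in>?B. r \<odot>\<^bsub>N\<^esub> (f x \<odot>\<^bsub>N\<^esub> n x))"
      by (rule N.finsum_cong') (use f r n in \<open>auto simp: PiE_iff N.smult_assoc1 N.smult_closed\<close>)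
    also have "\<dots> = r \<odot>\<^bsub>N\<^esub> \<Phi> f"
      unfolding \<Phi>_def by (rule sm[symmetric]) (use r f cl in auto)
    finally show "\<Phi> (r \<odot>\<^bsub>free_module R X\<^esub> f) = r \<odot>\<^bsub>N\<^esub> \<Phi> f" .
  qed
  moreover have "\<Phi> (free_generator R X x) = n x" if x: "x \<in> X" for x
  proof -
    have "\<Phi> (free_generator R X x) = (\<Oplus>\<^bsub>N\<^esub>y\<in>{x}. free_generator R X x y \<odot>\<^bsub>N\<^esub> n y)"
      using free_generator_closed[OF x] x by (intro \<Phi>) (auto simp: free_generator_def)
    also have "\<dots> = n x" using x n by (simp add: free_generator_def N.smult_one N.finsum_insert)
    finally show ?thesis .
  qed
  ultimately show thesis by (intro that) auto
qed

text \<open>Induction on a finite set that contains the support, splitting off one multiple of a generator.\<close>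

lemma free_module_hom_unique:
  assumes "left_module R N" and h: "h \<in> mod_hom R (free_module R X) N"
    and k: "k \<in> mod_hom R (free_module R X) N"
    and eq: "\<And>x. x \<in> X \<Longrightarrow> h (free_generator R X x) = k (free_generator R X x)"
    and f: "f \<in> carrier (free_module R X)"
  shows "h f = k f"
proof -
  interpret F: left_module R "free_module R X" by (rule left_module_free)
  have "h f = k f" if "finite B" "B \<subseteq> X" "f \<in> carrier (free_module R X)" "{x \<in> X. f x \<noteq> \<zero>} \<subseteq> B" for B f
    using that
  proof (induction B arbitrary: f)
    case empty
    then have "f = \<zero>\<^bsub>free_module R X\<^esub>" by (auto simp: PiE_iff fun_eq_iff extensional_def)
    then show ?case
      using mod_hom_zero[OF left_module_free assms(1)] h k by metis
  next
    case (insert x B)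
    let ?g = "free_generator R X x"
    define f' where "f' = (\<lambda>y\<in>X. if y = x then \<zero> else f y)"
    have x: "x \<in> X" "f x \<in> carrier R" using insert.prems by auto
    have fin: "finite {y \<in> X. f' y \<noteq> \<zero>}"
      by (rule finite_subset[of _ "{y \<in> X. f y \<noteq> \<zero>}"]) (use insert.prems in \<open>auto simp: f'_def\<close>)
    have f': "f' \<in> carrier (free_module R X)" "{y \<in> X. f' y \<noteq> \<zero>} \<subseteq> B"
      using insert.prems fin by (auto simp: f'_def)
    have eqf: "f = (f x \<odot>\<^bsub>free_module R X\<^esub> ?g) \<oplus>\<^bsub>free_module R X\<^esub> f'"
      using insert.prems x by (auto simp: f'_def free_generator_def fun_eq_iff extensional_def PiE_iff)
    have c: "f x \<odot>\<^bsub>free_module R X\<^esub> ?g \<in> carrier (free_module R X)"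
      by (rule F.smult_closed[OF x(2) free_generator_closed[OF x(1)]])
    have "h f' = k f'" by (rule insert.IH) (use insert.prems f' in auto)
    then show ?case
      using eq[OF x(1)] free_generator_closed[OF x(1)] f'(1) c x(2)
      by (subst (1 2) eqf) (simp only: mod_hom_add[OF h c f'(1)] mod_hom_add[OF k c f'(1)]
          mod_hom_smult[OF h x(2) free_generator_closed[OF x(1)]]
          mod_hom_smult[OF k x(2) free_generator_closed[OF x(1)]])
  qed
  then show ?thesis using f by (auto dest!: meta_spec[of _ "{x \<in> X. f x \<noteq> \<zero>}"])
qed

end

context small_modules
begin

text \<open>A function of finite support is determined by its graph over the support, a countable set, and hence
  by a sequence of pairs. The point \<open>x0\<close> is added to make this set nonempty, so that it can be
  enumerated. Sequences form a small set by the closure of \<open>U\<close> under countable powers.\<close>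

lemma small_free:
  assumes X: "small U X" and ne: "x0 \<in> X"
  shows "small U (carrier (free_module R X))"
proof -
  define G where "G f = (\<lambda>x. (x, f x)) ` insert x0 {x \<in> X. f x \<noteq> \<zero>\<^bsub>R\<^esub>}" for f
  have G: "range (from_nat_into (G f)) = G f" if "f \<in> carrier (free_module R X)" for f
    using that by (intro range_from_nat_into) (auto simp: G_def intro: countable_finite)
  have "small U (X \<times> carrier R)" by (rule small_times[OF X small_ring])
  then obtain Z where Z: "Z \<in> U" "X \<times> carrier R \<lesssim> Z" by (auto simp: small_def)
  have "small U ((UNIV :: nat set) \<rightarrow>\<^sub>E Z)" using universe Z(1) by (auto simp: universe_def powers_small_def)
  then have "small U ((UNIV :: nat set) \<rightarrow>\<^sub>E X \<times> carrier R)"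
    by (rule small_lepoll) (rule lepoll_funcset_right[OF Z(2)])
  then show ?thesis
  proof (rule small_inj)
    show "inj_on (\<lambda>f. from_nat_into (G f)) (carrier (free_module R X))"
    proof (rule inj_onI)
      fix f g assume f: "f \<in> carrier (free_module R X)" and g: "g \<in> carrier (free_module R X)"
        and "from_nat_into (G f) = from_nat_into (G g)"
      then have eq: "G f = G g" using G by metis
      show "f = g"
      proof (rule PiE_ext)
        show "f \<in> X \<rightarrow>\<^sub>E carrier R" "g \<in> X \<rightarrow>\<^sub>E carrier R" using f g by auto
        fix x assume x: "x \<in> X"
        have "(x, f x) \<in> G f" if "f x \<noteq> \<zero>\<^bsub>R\<^esub>" using that x by (auto simp: G_def)
        then have "f x = g x" if "f x \<noteq> \<zero>\<^bsub>R\<^esub>" unfolding eq using that by (auto simp: G_def)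
        moreover have "(x, g x) \<in> G g" if "g x \<noteq> \<zero>\<^bsub>R\<^esub>" using that x by (auto simp: G_def)
        then have "g x = f x" if "g x \<noteq> \<zero>\<^bsub>R\<^esub>" unfolding eq[symmetric] using that by (auto simp: G_def)
        ultimately show "f x = g x" by metis
      qed
    qed
    fix f assume "f \<in> carrier (free_module R X)"
    moreover from this have "G f \<subseteq> X \<times> carrier R" using ne by (auto simp: G_def)
    ultimately show "from_nat_into (G f) \<in> (UNIV :: nat set) \<rightarrow>\<^sub>E X \<times> carrier R"
      using G[of f] by (auto simp: PiE_UNIV_domain)
  qed
qed

lemma projective_cover_exists:
  assumes X: "X \<in> LMod U R"
  obtains P g where "projective U R P" "mod_epi R P g X"
proof -
  interpret X: left_module R X using X by (rule LModD)
  let ?F = "free_module R (carrier X)"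
  have F: "left_module R ?F" by (rule left_module_free[OF ring])
  have "small U (carrier ?F)" by (rule small_free[OF LMod_small[OF X] X.zero_closed])
  from small_copy[OF F this] obtain P i j where P: "P \<in> LMod U R" and i: "i \<in> mod_hom R ?F P"
    and j: "j \<in> mod_hom R P ?F" "\<forall>x\<in>carrier ?F. j (i x) = x" "\<forall>y\<in>carrier P. i (j y) = y" .
  obtain \<Phi> where \<Phi>: "\<Phi> \<in> mod_hom R ?F X" "\<forall>x\<in>carrier X. \<Phi> (free_generator R (carrier X) x) = x"
    by (rule free_module_hom_exists[OF ring X.left_module_axioms, where X = "carrier X" and n = "\<lambda>x. x"]) auto
  have "mod_epi R P (\<lambda>x. \<Phi> (j x)) X"
  proof (rule mod_epiI[OF mod_hom_comp[OF j(1) \<Phi>(1)]])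
    fix x assume x: "x \<in> carrier X"
    note c = free_generator_closed[OF ring x]
    show "\<exists>y\<in>carrier P. \<Phi> (j y) = x"
      using \<Phi>(2) j(2) c x mod_hom_closed[OF i c]
      by (intro bexI[of _ "i (free_generator R (carrier X) x)"]) auto
  qed
  moreover have "projective U R P"
    unfolding projective_def
  proof (intro conjI ballI impI P)
    fix M N g h assume M: "M \<in> LMod U R" and N: "N \<in> LMod U R" and g: "g \<in> mod_hom R M N"
      and h: "h \<in> mod_hom R P N" and "g ` carrier M = carrier N"
    then have epi: "mod_epi R M g N" by (simp add: mod_epi_def)
    have hi: "(\<lambda>x. h (i x)) \<in> mod_hom R ?F N" by (rule mod_hom_comp[OF i h])
    have "\<forall>x\<in>carrier X. \<exists>m\<in>carrier M. g m = h (i (free_generator R (carrier X) x))"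
      using mod_epiE[OF epi mod_hom_closed[OF hi free_generator_closed[OF ring]]] by metis
    then obtain m where m: "\<And>x. x \<in> carrier X \<Longrightarrow> m x \<in> carrier M"
      "\<And>x. x \<in> carrier X \<Longrightarrow> g (m x) = h (i (free_generator R (carrier X) x))" by metis
    obtain \<Psi> where \<Psi>: "\<Psi> \<in> mod_hom R ?F M"
      "\<forall>x\<in>carrier X. \<Psi> (free_generator R (carrier X) x) = m x"
      by (rule free_module_hom_exists[OF ring LModD(1)[OF M], where X = "carrier X" and n = m]) (use m in auto)
    have "g (\<Psi> f) = h (i f)" if "f \<in> carrier ?F" for f
      by (rule free_module_hom_unique[OF ring LModD(1)[OF N] mod_hom_comp[OF \<Psi>(1) g] hi _ that])
        (use \<Psi>(2) m(2) in auto)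
    then have "\<forall>x\<in>carrier P. g (\<Psi> (j x)) = h x"
      using j(3) mod_hom_closed[OF j(1)] by auto
    then show "\<exists>h'\<in>mod_hom R P M. \<forall>x\<in>carrier P. g (h' x) = h x"
      by (intro bexI[OF _ mod_hom_comp[OF j(1) \<Psi>(1)]])
  qed
  ultimately show thesis using that by blast
qed

lemma projective_LMod: "projective U R P \<Longrightarrow> P \<in> LMod U R"
  by (simp add: projective_def)

lemma projective_lift:
  assumes "projective U R P" "M \<in> LMod U R" "N \<in> LMod U R" "mod_epi R M g N" "h \<in> mod_hom R P N"
  obtains h' where "h' \<in> mod_hom R P M" "\<forall>x\<in>carrier P. g (h' x) = h x"
  using assms unfolding projective_def mod_epi_def by metis

text \<open>Subtracting a section of \<open>M \<rightarrow> P\<close> is a retraction of \<open>M\<close> onto the kernel.\<close>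

lemma ext_orth_projective:
  assumes P: "projective U R P" and Y: "left_module R Y"
  shows "ext_orth U R P Y"
  unfolding ext_orth_def
proof (intro ballI allI impI)
  fix M g h assume M: "M \<in> LMod U R" "mod_epi R M g P" and h: "h \<in> mod_hom R (kernel_module M P g) Y"
  note PL = projective_LMod[OF P] and gh = mod_epi_hom[OF M(2)]
  note lP = LModD(1)[OF PL] and lM = LModD(1)[OF M(1)]
  interpret M: left_module R M by (rule lM)
  interpret P: left_module R P by (rule lP)
  obtain s where s: "s \<in> mod_hom R P M" "\<forall>x\<in>carrier P. g (s x) = x"
    by (rule projective_lift[OF P M(1) PL M(2) mod_hom_id])
  note sg = mod_hom_comp[OF gh s(1)]
  have "(\<lambda>x. x \<ominus>\<^bsub>M\<^esub> s (g x)) \<in> mod_hom R M (kernel_module M P g)"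
    by (rule mod_hom_into_kernel[OF mod_hom_diff[OF lM mod_hom_id sg]])
      (use s(2) mod_hom_closed[OF gh] mod_hom_closed[OF sg] in \<open>simp add: mod_hom_minus[OF lM lP gh]\<close>)
  then have "(\<lambda>x. h (x \<ominus>\<^bsub>M\<^esub> s (g x))) \<in> mod_hom R M Y" by (rule mod_hom_comp[OF _ h])
  then show "\<exists>h'\<in>mod_hom R M Y. \<forall>x\<in>carrier M. g x = \<zero>\<^bsub>P\<^esub> \<longrightarrow> h' x = h x"
    by (rule bexI[rotated]) (simp add: mod_hom_zero[OF lP lM s(1)])
qed

text \<open>It suffices to test one epimorphism from a projective module. A lift \<open>u : P \<rightarrow> M\<close> carries the given map
  to the kernel of \<open>\<pi>\<close>, where it extends to \<open>w\<close>. Since \<open>M\<close> is spanned by the image of \<open>u\<close> and the kernel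
  of \<open>g\<close>, the desired extension is \<open>u p + y \<mapsto> w p + h y\<close>; it is defined on the fibre product of
  \<open>P\<close> and \<open>M\<close> and descends to \<open>M\<close>.\<close>

lemma ext_orth_from_projective:
  assumes P: "projective U R P" and X: "X \<in> LMod U R" and Y: "left_module R Y" and \<pi>: "mod_epi R P \<pi> X"
    and ext: "\<And>h. h \<in> mod_hom R (kernel_module P X \<pi>) Y \<Longrightarrow>
        \<exists>w\<in>mod_hom R P Y. \<forall>x\<in>carrier P. \<pi> x = \<zero>\<^bsub>X\<^esub> \<longrightarrow> w x = h x"
  shows "ext_orth U R X Y"
  unfolding ext_orth_def
proof (intro ballI allI impI)
  fix M g h assume M: "M \<in> LMod U R" "mod_epi R M g X" and h: "h \<in> mod_hom R (kernel_module M X g) Y"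
  note g = mod_epi_hom[OF M(2)] and \<pi>h = mod_epi_hom[OF \<pi>] and P' = projective_LMod[OF P]
  note lM = LModD(1)[OF M(1)] and lX = LModD(1)[OF X] and lP = LModD(1)[OF P']
  interpret M: left_module R M by fact
  interpret X: left_module R X by fact
  interpret P: left_module R P by fact
  interpret Y: left_module R Y by fact
  have lK: "left_module R (kernel_module M X g)" by (rule left_module_kernel[OF lM lX g])
  obtain u where u: "u \<in> mod_hom R P M" "\<forall>x\<in>carrier P. g (u x) = \<pi> x"
    by (rule projective_lift[OF P M(1) X M(2) \<pi>h])
  have "(\<lambda>x. h (u x)) \<in> mod_hom R (kernel_module P X \<pi>) Y"
    by (rule mod_hom_comp[OF _ h], rule mod_hom_into_kernel[OF mod_hom_on_kernel[OF u(1)]]) (use u(2) in auto)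
  from ext[OF this] obtain w where w: "w \<in> mod_hom R P Y" "\<forall>x\<in>carrier P. \<pi> x = \<zero>\<^bsub>X\<^esub> \<longrightarrow> w x = h (u x)"
    by blast
  obtain E a b where E: "E \<in> LMod U R" and pb: "is_pullback E a b P \<pi> M g"
    by (rule pullback_exists[OF lP LMod_small[OF P'] lM LMod_small[OF M(1)] lX \<pi>h g])
  note ab = pullback_homs[OF pb]
  note cl = mod_hom_closed[OF ab(1)] mod_hom_closed[OF ab(2)] mod_hom_closed[OF u(1)]
     mod_hom_closed[OF w(1)] mod_hom_closed[OF g]
  have b: "mod_epi R E b M" by (rule pullback_epi[OF pullback_flip[OF pb] g \<pi>])
  have d: "(\<lambda>x. b x \<ominus>\<^bsub>M\<^esub> u (a x)) \<in> mod_hom R E (kernel_module M X g)"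
  proof (rule mod_hom_into_kernel[OF mod_hom_diff[OF lM ab(2) mod_hom_comp[OF ab(1) u(1)]]])
    fix x assume "x \<in> carrier E"
    then show "g (b x \<ominus>\<^bsub>M\<^esub> u (a x)) = \<zero>\<^bsub>X\<^esub>"
      using u(2) pullback_comm[OF pb] cl by (simp add: mod_hom_minus[OF lM lX g])
  qed
  let ?t = "\<lambda>x. w (a x) \<oplus>\<^bsub>Y\<^esub> h (b x \<ominus>\<^bsub>M\<^esub> u (a x))"
  have t: "?t \<in> mod_hom R E Y"
    by (rule mod_hom_sum[OF Y mod_hom_comp[OF ab(1) w(1)] mod_hom_comp[OF d h]])
  have t': "?t x = h (b x)" if x: "x \<in> carrier E" "g (b x) = \<zero>\<^bsub>X\<^esub>" for x
  proof -
    have \<pi>x: "\<pi> (a x) = \<zero>\<^bsub>X\<^esub>" using pullback_comm[OF pb x(1)] x(2) by simp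
    then have "?t x = h (u (a x)) \<oplus>\<^bsub>Y\<^esub> h (b x \<ominus>\<^bsub>M\<^esub> u (a x))" using w(2) x cl by simp
    also have "\<dots> = h (u (a x) \<oplus>\<^bsub>M\<^esub> (b x \<ominus>\<^bsub>M\<^esub> u (a x)))"
      using mod_hom_add[OF h, of "u (a x)" "b x \<ominus>\<^bsub>M\<^esub> u (a x)"] mod_hom_closed[OF d x(1)] cl x(1) u(2) \<pi>x
      by simp
    also have "\<dots> = h (b x)" using x(1) cl by (simp add: M.add_minus_cancel)
    finally show ?thesis .
  qed
  have "?t x = \<zero>\<^bsub>Y\<^esub>" if "x \<in> carrier E" "b x = \<zero>\<^bsub>M\<^esub>" for x
    using t'[OF that(1)] that(2) mod_hom_zero[OF lM lX g] mod_hom_zero[OF lK Y h] by simp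
  then obtain h' where h': "h' \<in> mod_hom R M Y" "\<forall>x\<in>carrier E. h' (b x) = ?t x"
    using factor_through_epi[OF LModD(1)[OF E] lM Y b t] by metis
  have "h' m = h m" if m: "m \<in> carrier M" "g m = \<zero>\<^bsub>X\<^esub>" for m
  proof -
    obtain x where x: "x \<in> carrier E" "b x = m" by (rule mod_epiE[OF b m(1)])
    then show ?thesis using h'(2) t'[OF x(1)] m(2) by metis
  qed
  then show "\<exists>h'\<in>mod_hom R M Y. \<forall>x\<in>carrier M. g x = \<zero>\<^bsub>X\<^esub> \<longrightarrow> h' x = h x"
    using h'(1) by blast
qed

end

text \<open>The image of \<open>d n\<close>, as a submodule of \<open>P n\<close>; by exactness a kernel, of \<open>e\<close> for \<open>n = 0\<close> and of the
  preceding differential otherwise.\<close>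

definition syzygy :: "(nat \<Rightarrow> ('r, 'u) module) \<Rightarrow> (nat \<Rightarrow> 'u \<Rightarrow> 'u) \<Rightarrow> nat \<Rightarrow> ('r, 'u) module" where
  "syzygy P d n = P n\<lparr>carrier := d n ` carrier (P (Suc n))\<rparr>"

lemma syzygy_zero: "resolution R P d e X \<Longrightarrow> syzygy P d 0 = kernel_module (P 0) X e"
  by (simp add: resolution_def syzygy_def kernel_module_def)

lemma syzygy_Suc: "resolution R P d e X \<Longrightarrow> syzygy P d (Suc n) = kernel_module (P (Suc n)) (P n) (d n)"
  by (simp add: resolution_def syzygy_def kernel_module_def)

lemma syzygy_Suc_as_kernel: "resolution R P d e X \<Longrightarrow>
    syzygy P d (Suc n) = kernel_module (P (Suc n)) (syzygy P d n) (d n)"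
  by (simp add: resolution_def syzygy_def kernel_module_def a_kernel_eq)

lemma syzygy_epi: "resolution R P d e X \<Longrightarrow> mod_epi R (P (Suc n)) (d n) (syzygy P d n)"
  by (auto simp: resolution_def syzygy_def mod_epi_def mod_hom_def)

lemma left_module_syzygy:
  assumes "resolution R P d e X" "left_module R X" shows "left_module R (syzygy P d n)"
  using assms left_module_kernel[of R "P 0" X e] left_module_kernel[of R "P n" "P (n - 1)" "d (n - 1)"]
  by (cases n) (auto simp: syzygy_zero syzygy_Suc resolution_def)

text \<open>A cocycle of degree \<open>n + 1\<close> factors through the \<open>n\<close>-th syzygy, and it is a coboundary if and only if
  the induced map on the syzygy extends to \<open>P n\<close>.\<close>

lemma cocycles_eq_coboundaries_iff:
  assumes res: "resolution R P d e X" and X: "left_module R X" and Y: "left_module R Y"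
  shows "cocycles R P d Y (Suc n) = coboundaries R P d Y (Suc n) \<longleftrightarrow>
    (\<forall>h\<in>mod_hom R (syzygy P d n) Y. \<exists>w\<in>mod_hom R (P n) Y. \<forall>x\<in>carrier (syzygy P d n). w x = h x)"
    (is "?L \<longleftrightarrow> ?E")
proof
  have epi: "mod_epi R (P (Suc n)) (d n) (syzygy P d n)" by (rule syzygy_epi[OF res])
  have lP: "left_module R (P m)" for m using res by (simp add: resolution_def)
  have lS: "left_module R (syzygy P d n)" by (rule left_module_syzygy[OF res X])
  have c: "carrier (syzygy P d n) = d n ` carrier (P (Suc n))" and z: "\<zero>\<^bsub>syzygy P d n\<^esub> = \<zero>\<^bsub>P n\<^esub>"
    by (simp_all add: syzygy_def)
  have ker: "d (Suc n) ` carrier (P (Suc (Suc n))) = {x \<in> carrier (P (Suc n)). d n x = \<zero>\<^bsub>P n\<^esub>}"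
    using res by (simp add: resolution_def a_kernel_eq)
  have dd: "d n (d (Suc n) x) = \<zero>\<^bsub>P n\<^esub>" if "x \<in> carrier (P (Suc (Suc n)))" for x
    using ker that by blast
  {
    assume ?L
    show ?E
    proof
      fix h assume h: "h \<in> mod_hom R (syzygy P d n) Y"
      have "h \<zero>\<^bsub>P n\<^esub> = \<zero>\<^bsub>Y\<^esub>" using mod_hom_zero[OF lS Y h] z by simp
      then have "(\<lambda>x. h (d n x)) \<in> cocycles R P d Y (Suc n)"
        using mod_hom_comp[OF mod_epi_hom[OF epi] h] dd by (auto simp: cocycles_def)
      then have "(\<lambda>x. h (d n x)) \<in> coboundaries R P d Y (Suc n)" using \<open>?L\<close> by simp
      then show "\<exists>w\<in>mod_hom R (P n) Y. \<forall>x\<in>carrier (syzygy P d n). w x = h x"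
        by (auto simp: coboundaries_def c)
    qed
  next
    assume ?E
    have "f \<in> coboundaries R P d Y (Suc n)" if f: "f \<in> cocycles R P d Y (Suc n)" for f
    proof -
      have f': "f \<in> mod_hom R (P (Suc n)) Y" "\<forall>x\<in>carrier (P (Suc (Suc n))). f (d (Suc n) x) = \<zero>\<^bsub>Y\<^esub>"
        using f by (auto simp: cocycles_def)
      have "f x = \<zero>\<^bsub>Y\<^esub>" if x: "x \<in> carrier (P (Suc n))" "d n x = \<zero>\<^bsub>syzygy P d n\<^esub>" for x
      proof -
        have "x \<in> d (Suc n) ` carrier (P (Suc (Suc n)))" using x ker z by simp
        then show ?thesis using f'(2) by auto
      qed
      then obtain h where h: "h \<in> mod_hom R (syzygy P d n) Y" "\<forall>x\<in>carrier (P (Suc n)). h (d n x) = f x"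
        using factor_through_epi[OF lP lS Y epi f'(1)] by metis
      obtain w where "w \<in> mod_hom R (P n) Y" "\<forall>x\<in>carrier (syzygy P d n). w x = h x"
        using \<open>?E\<close> h(1) by blast
      then show ?thesis using f'(1) h(2) c by (auto simp: coboundaries_def intro!: bexI[of _ w])
    qed
    moreover have "f \<in> cocycles R P d Y (Suc n)" if f: "f \<in> coboundaries R P d Y (Suc n)" for f
    proof -
      obtain g where g: "f \<in> mod_hom R (P (Suc n)) Y" "g \<in> mod_hom R (P n) Y"
        "\<forall>x\<in>carrier (P (Suc n)). f x = g (d n x)"
        using f by (auto simp: coboundaries_def)
      have "f (d (Suc n) x) = \<zero>\<^bsub>Y\<^esub>" if "x \<in> carrier (P (Suc (Suc n)))" for x
      proof -
        have "d (Suc n) x \<in> carrier (P (Suc n))" using that ker by blast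
        with dd[OF that] show ?thesis using g(3) mod_hom_zero[OF lP Y g(2)] by simp
      qed
      then show ?thesis using g(1) by (simp add: cocycles_def)
    qed
    ultimately show ?L by blast
  }
qed

context small_modules
begin

lemma resolution_exists:
  assumes X: "X \<in> LMod U R"
  obtains P d e where "resolution R P d e X" "\<forall>i. projective U R (P i)"
proof -
  have "\<forall>X\<in>LMod U R. \<exists>P g. projective U R P \<and> mod_epi R P g X"
    using projective_cover_exists by metis
  then obtain C \<pi> where C: "\<And>X. X \<in> LMod U R \<Longrightarrow> projective U R (C X)"
    and \<pi>: "\<And>X. X \<in> LMod U R \<Longrightarrow> mod_epi R (C X) (\<pi> X) X" by metis
  define Z where "Z = rec_nat X (\<lambda>n Z. kernel_module (C Z) Z (\<pi> Z))"
  have Z_simps: "Z 0 = X" "\<And>n. Z (Suc n) = kernel_module (C (Z n)) (Z n) (\<pi> (Z n))"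
    by (simp_all add: Z_def)
  have Z: "Z n \<in> LMod U R" for n
  proof (induction n)
    case (Suc n)
    show ?case unfolding Z_simps(2)
      by (rule kernel_LMod[OF projective_LMod[OF C[OF Suc]] LModD(1)[OF Suc] mod_epi_hom[OF \<pi>[OF Suc]]])
  qed (simp add: Z_simps X)
  have d: "\<pi> (Z (Suc n)) \<in> mod_hom R (C (Z (Suc n))) (C (Z n))" for n
    using mod_epi_hom[OF \<pi>[OF Z[of "Suc n"]]]
    by (subst (asm) (3) Z_simps(2)) (rule mod_hom_from_kernel)
  have im: "\<pi> (Z (Suc n)) ` carrier (C (Z (Suc n))) = a_kernel (C (Z n)) (Z n) (\<pi> (Z n))" for n
    using \<pi>[OF Z[of "Suc n"]] unfolding mod_epi_def by (simp add: Z_simps(2)[of n] kernel_module_def)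
  have ker: "a_kernel (C (Z (Suc n))) (Z (Suc n)) (\<pi> (Z (Suc n))) = a_kernel (C (Z (Suc n))) (C (Z n)) (\<pi> (Z (Suc n)))" for n
    by (simp add: a_kernel_eq Z_simps(2)[of n])
  have "resolution R (\<lambda>n. C (Z n)) (\<lambda>n. \<pi> (Z (Suc n))) (\<pi> X) X"
    unfolding resolution_def
    using \<pi>[OF X] d im[of 0] im[of "Suc _"] ker LModD(1)[OF projective_LMod[OF C[OF Z]]]
    by (auto simp: mod_epi_def Z_simps(1))
  then show thesis using C Z by (intro that) auto
qed

lemma Ext1_vanishes_iff_ext_orth:
  assumes X: "X \<in> LMod U R" and Y: "left_module R Y"
  shows "Ext_vanishes U R 1 X Y \<longleftrightarrow> ext_orth U R X Y"
proof
  note lX = LModD(1)[OF X]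
  assume "Ext_vanishes U R 1 X Y"
  then obtain P d e where res: "resolution R P d e X" and P: "\<And>i. projective U R (P i)"
    and eq: "cocycles R P d Y (Suc 0) = coboundaries R P d Y (Suc 0)" unfolding Ext_vanishes_def by auto
  have e: "mod_epi R (P 0) e X" using res by (simp add: resolution_def mod_epi_def)
  show "ext_orth U R X Y"
  proof (rule ext_orth_from_projective[OF P X Y e])
    fix h assume "h \<in> mod_hom R (kernel_module (P 0) X e) Y"
    then obtain w where "w \<in> mod_hom R (P 0) Y" "\<forall>x\<in>carrier (kernel_module (P 0) X e). w x = h x"
      using eq unfolding cocycles_eq_coboundaries_iff[OF res lX Y] syzygy_zero[OF res] by blast
    then show "\<exists>w\<in>mod_hom R (P 0) Y. \<forall>x\<in>carrier (P 0). e x = \<zero>\<^bsub>X\<^esub> \<longrightarrow> w x = h x"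
      by (intro bexI[of _ w]) auto
  qed
next
  note lX = LModD(1)[OF X]
  assume orth: "ext_orth U R X Y"
  obtain P d e where res: "resolution R P d e X" and P: "\<forall>i. projective U R (P i)"
    by (rule resolution_exists[OF X])
  have e: "mod_epi R (P 0) e X" using res by (simp add: resolution_def mod_epi_def)
  have "cocycles R P d Y (Suc 0) = coboundaries R P d Y (Suc 0)"
    unfolding cocycles_eq_coboundaries_iff[OF res lX Y] syzygy_zero[OF res]
  proof
    fix h assume h: "h \<in> mod_hom R (kernel_module (P 0) X e) Y"
    have "P 0 \<in> LMod U R" using P by (simp add: projective_LMod)
    from ext_orthD[OF orth this e h]
    obtain w where "w \<in> mod_hom R (P 0) Y" "\<forall>x\<in>carrier (P 0). e x = \<zero>\<^bsub>X\<^esub> \<longrightarrow> w x = h x" .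
    then show "\<exists>w\<in>mod_hom R (P 0) Y. \<forall>x\<in>carrier (kernel_module (P 0) X e). w x = h x"
      by (intro bexI[of _ w]) auto
  qed
  then show "Ext_vanishes U R 1 X Y" unfolding Ext_vanishes_def using res P by auto
qed

text \<open>Dimension shifting: \<open>Ext\<^sup>2(X, Y)\<close> is \<open>Ext\<^sup>1\<close> of the first syzygy. The projective cover depends on the
  resolution that witnesses the vanishing, so it cannot be prescribed.\<close>

lemma Ext2_vanishes_syzygy:
  assumes X: "X \<in> LMod U R" and Y: "left_module R Y" and ext: "Ext_vanishes U R 2 X Y"
  obtains P g where "projective U R P" "mod_epi R P g X" "ext_orth U R (kernel_module P X g) Y"
proof -
  note lX = LModD(1)[OF X]
  obtain P d e where res: "resolution R P d e X" and P: "\<And>i. projective U R (P i)"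
    and eq: "cocycles R P d Y (Suc 1) = coboundaries R P d Y (Suc 1)"
    using ext unfolding Ext_vanishes_def by (auto simp: numeral_2_eq_2)
  have e: "mod_epi R (P 0) e X" using res by (simp add: resolution_def mod_epi_def)
  have K: "kernel_module (P 0) X e \<in> LMod U R"
    by (rule kernel_LMod[OF projective_LMod[OF P] lX mod_epi_hom[OF e]])
  have d: "mod_epi R (P 1) (d 0) (kernel_module (P 0) X e)"
    using syzygy_epi[OF res, of 0] syzygy_zero[OF res] by simp
  have syz: "syzygy P d 1 = kernel_module (P 1) (kernel_module (P 0) X e) (d 0)"
    using syzygy_Suc_as_kernel[OF res, of 0] syzygy_zero[OF res] by simp
  have "ext_orth U R (kernel_module (P 0) X e) Y"
  proof (rule ext_orth_from_projective[OF P K Y d])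
    fix h assume "h \<in> mod_hom R (kernel_module (P 1) (kernel_module (P 0) X e) (d 0)) Y"
    then obtain w where "w \<in> mod_hom R (P 1) Y"
      "\<forall>x\<in>carrier (kernel_module (P 1) (kernel_module (P 0) X e) (d 0)). w x = h x"
      using eq unfolding cocycles_eq_coboundaries_iff[OF res lX Y] syz by blast
    then show "\<exists>w\<in>mod_hom R (P 1) Y. \<forall>x\<in>carrier (P 1). d 0 x = \<zero>\<^bsub>kernel_module (P 0) X e\<^esub> \<longrightarrow> w x = h x"
      by (intro bexI[of _ w]) auto
  qed
  then show thesis using P e that by blast
qed

text \<open>Dimension shifting in the other direction: all syzygies stay in the class, so all obstructions are
  of degree one.\<close>

lemma Ext_vanishes_if_closed_under_syzygies:
  assumes sub: "\<X> \<subseteq> LMod U R"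
    and ker: "\<And>P X g. \<lbrakk>projective U R P; X \<in> \<X>; mod_epi R P g X\<rbrakk> \<Longrightarrow> kernel_module P X g \<in> \<X>"
    and orth: "\<And>X. X \<in> \<X> \<Longrightarrow> ext_orth U R X Y"
    and X: "X \<in> \<X>" and Y: "left_module R Y" and n: "n \<ge> 1"
  shows "Ext_vanishes U R n X Y"
proof -
  have X': "X \<in> LMod U R" and lX: "left_module R X" using X sub LModD(1) by blast+
  obtain P d e where res: "resolution R P d e X" and P: "\<forall>i. projective U R (P i)"
    by (rule resolution_exists[OF X'])
  have e: "mod_epi R (P 0) e X" using res by (simp add: resolution_def mod_epi_def)
  have syz: "syzygy P d m \<in> \<X>" for m
  proof (induction m)
    case 0
    then show ?case unfolding syzygy_zero[OF res] using P X e by (intro ker) auto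
  next
    case (Suc m)
    then show ?case unfolding syzygy_Suc_as_kernel[OF res] using P syzygy_epi[OF res] by (intro ker) auto
  qed
  obtain m where m: "n = Suc m" using n by (cases n) auto
  have "\<exists>(Z :: ('r, 'u) module) g. ext_orth U R Z Y \<and> mod_epi R (P m) g Z \<and> syzygy P d m = kernel_module (P m) Z g"
  proof (cases m)
    case 0
    then show ?thesis using orth[OF X] e syzygy_zero[OF res] by (intro exI[of _ X] exI[of _ e]) simp
  next
    case (Suc l)
    then show ?thesis using orth[OF syz] syzygy_epi[OF res] syzygy_Suc_as_kernel[OF res]
      by (intro exI[of _ "syzygy P d l"] exI[of _ "d l"]) simp
  qed
  then obtain Z :: "('r, 'u) module" and g where Z: "ext_orth U R Z Y" "mod_epi R (P m) g Z" "syzygy P d m = kernel_module (P m) Z g"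
    by blast
  have "cocycles R P d Y n = coboundaries R P d Y n"
    unfolding m cocycles_eq_coboundaries_iff[OF res lX Y] Z(3)
  proof
    fix h assume h: "h \<in> mod_hom R (kernel_module (P m) Z g) Y"
    have "P m \<in> LMod U R" using P by (simp add: projective_LMod)
    from ext_orthD[OF Z(1) this Z(2) h]
    obtain w where "w \<in> mod_hom R (P m) Y" "\<forall>x\<in>carrier (P m). g x = \<zero>\<^bsub>Z\<^esub> \<longrightarrow> w x = h x" .
    then show "\<exists>w\<in>mod_hom R (P m) Y. \<forall>x\<in>carrier (kernel_module (P m) Z g). w x = h x"
      by (intro bexI[of _ w]) auto
  qed
  then show ?thesis unfolding Ext_vanishes_def using res P by blast
qed

end

section \<open>Cofiltrations and orthogonality\<close>

context small_modules
begin

text \<open>The dual Eklof (or Lukas) lemma. A homomorphism on the kernel of \<open>M \<rightarrow> X\<close> is extended to \<open>M\<close> by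
  transfinite recursion, as a compatible family of maps into the stages \<open>G i\<close>: at successors by the
  lifting property, at limits because \<open>G i\<close> is the inverse limit of the earlier stages.\<close>

lemma ext_orth_Cof:
  fixes \<alpha> :: "'o::wellorder"
  assumes X: "X \<in> LMod U R" and N: "N \<in> Cof U R \<alpha> \<T>" and \<T>: "\<And>T. T \<in> \<T> \<Longrightarrow> ext_orth U R X T"
  shows "ext_orth U R X N"
  unfolding ext_orth_def
proof (intro ballI allI impI)
  fix M g h assume M: "M \<in> LMod U R" "mod_epi R M g X" and h: "h \<in> mod_hom R (kernel_module M X g) N"
  obtain G p where cof: "cofiltration U R \<alpha> N G p"
    and ker: "\<forall>i<\<alpha>. in_class R \<T> (kernel_module (G (osucc i)) (G i) (p (osucc i) i))"
    using N by (auto simp: Cof_def)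
  have G: "\<And>i. i \<le> \<alpha> \<Longrightarrow> G i \<in> LMod U R"
    and p: "\<And>i j. \<lbrakk>i \<le> \<alpha>; j < i\<rbrakk> \<Longrightarrow> p i j \<in> mod_hom R (G i) (G j)"
    and pp: "\<And>i j l x. \<lbrakk>i \<le> \<alpha>; j < i; l < j; x \<in> carrier (G i)\<rbrakk> \<Longrightarrow> p j l (p i j x) = p i l x"
    and G0: "carrier (G (LEAST i. True)) = {\<zero>\<^bsub>G (LEAST i. True)\<^esub>}"
    and G\<alpha>: "G \<alpha> = N"
    and lim: "\<And>i. \<lbrakk>i \<le> \<alpha>; limit_ordinal i\<rbrakk> \<Longrightarrow>
        bij_betw (\<lambda>x. \<lambda>j\<in>{..<i}. p i j x) (carrier (G i)) (inverse_limit G p i)"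
    and surj: "\<And>i. i < \<alpha> \<Longrightarrow> p (osucc i) i ` carrier (G (osucc i)) = carrier (G i)"
    using cof by (simp_all add: cofiltration_def Let_def)
  note lG = LModD(1)[OF G] and lM = LModD(1)[OF M(1)] and lX = LModD(1)[OF X]
  interpret M: left_module R M by fact
  let ?K = "kernel_module M X g"
  \<comment> \<open>The maps \<open>p i j\<close> exist for \<open>j < i\<close> only, so the identity at \<open>i = \<alpha>\<close> is a separate case.\<close>
  define k where "k i = (if i = \<alpha> then h else (\<lambda>x. p \<alpha> i (h x)))" for i
  have k: "k i \<in> mod_hom R ?K (G i)" if "i \<le> \<alpha>" for i
    using that h mod_hom_comp[OF h[folded G\<alpha>] p[of \<alpha> i]] by (auto simp: k_def G\<alpha>)
  have pk: "p i j (k i x) = k j x" if "i \<le> \<alpha>" "j < i" "x \<in> carrier ?K" for i j x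
    using that pp[of \<alpha> i j "h x"] mod_hom_closed[OF h] by (auto simp: k_def G\<alpha>)
  define ext where "ext f i r \<longleftrightarrow> i \<le> \<alpha> \<longrightarrow> r \<in> mod_hom R M (G i) \<and>
      (\<forall>x\<in>carrier M. g x = \<zero>\<^bsub>X\<^esub> \<longrightarrow> r x = k i x) \<and>
      (\<forall>j<i. \<forall>x\<in>carrier M. p i j (r x) = f j x)" for f i r
  have "\<exists>f. \<forall>i. ext f i (f i)"
  proof (rule dependent_wf_choice[OF wf])
    fix f f' :: "'o \<Rightarrow> 'u \<Rightarrow> 'u" and i r assume "\<And>j. (j, i) \<in> {(x, y). x < y} \<Longrightarrow> f j = f' j"
    then show "ext f i r = ext f' i r" unfolding ext_def by auto
  next
    fix i and f :: "'o \<Rightarrow> 'u \<Rightarrow> 'u" assume "\<And>j. (j, i) \<in> {(x, y). x < y} \<Longrightarrow> ext f j (f j)"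
    then have IH: "\<And>j. j < i \<Longrightarrow> ext f j (f j)" by simp
    show "\<exists>r. ext f i r"
    proof (cases "i \<le> \<alpha>")
      case i: True
      have f: "f j \<in> mod_hom R M (G j)" "\<And>x. \<lbrakk>x \<in> carrier M; g x = \<zero>\<^bsub>X\<^esub>\<rbrakk> \<Longrightarrow> f j x = k j x"
        "\<And>l x. \<lbrakk>l < j; x \<in> carrier M\<rbrakk> \<Longrightarrow> p j l (f j x) = f l x" if "j < i" for j
        using IH[OF that] that i unfolding ext_def by auto
      consider (zero) "\<forall>j. \<not> j < i" | (succ) j where "j < i" "\<And>l. l < i \<Longrightarrow> l \<le> j"
        | (limit) "limit_ordinal i"
        unfolding limit_ordinal_def by (metis not_less)
      then show ?thesis
      proof cases
        case zero
        then have "i = (LEAST i. True)" by (intro Least_equality[symmetric]) (auto simp: not_less)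
        then have "k i x = \<zero>\<^bsub>G i\<^esub>" if "x \<in> carrier ?K" for x
          using G0 mod_hom_closed[OF k[OF i] that] by auto
        then have "ext f i (\<lambda>x. \<zero>\<^bsub>G i\<^esub>)"
          unfolding ext_def using zero mod_hom_zero_map[OF lG[OF i]] by auto
        then show ?thesis by blast
      next
        case succ
        have j: "j < \<alpha>" "j \<le> \<alpha>" using succ(1) i by auto
        have "osucc j = i" unfolding osucc_def
          by (rule Least_equality) (use succ in \<open>auto simp flip: not_less\<close>)
        then have kj: "in_class R \<T> (kernel_module (G i) (G j) (p i j))" and sj: "p i j ` carrier (G i) = carrier (G j)"
          using ker j(1) surj[OF j(1)] by auto
        have epi: "mod_epi R (G i) (p i j) (G j)" using p[OF i succ(1)] sj by (simp add: mod_epi_def)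
        obtain T where T: "T \<in> \<T>" "mod_iso R (kernel_module (G i) (G j) (p i j)) T"
          using kj unfolding in_class_def by blast
        have orth: "ext_orth U R X (kernel_module (G i) (G j) (p i j))"
          by (rule ext_orth_iso_right[OF \<T>[OF T(1)] T(2) left_module_kernel[OF lG[OF i] lG[OF j(2)] p[OF i succ(1)]]])
        obtain r where r: "r \<in> mod_hom R M (G i)" "\<forall>x\<in>carrier M. p i j (r x) = f j x"
          "\<forall>x\<in>carrier M. g x = \<zero>\<^bsub>X\<^esub> \<longrightarrow> r x = k i x"
          by (rule lifting[OF lX G[OF i] lG[OF j(2)] epi orth M k[OF i] f(1)[OF succ(1)]])
            (use pk[OF i succ(1)] f(2)[OF succ(1)] in auto)
        have "p i l (r x) = f l x" if l: "l < i" and x: "x \<in> carrier M" for l x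
        proof (cases "l = j")
          case False
          with succ(2)[OF l] have "l < j" by simp
          then show ?thesis
            using pp[OF i succ(1), of l "r x"] f(3)[OF succ(1)] r(2) x mod_hom_closed[OF r(1) x] by auto
        qed (use r(2) x in simp)
        then have "ext f i r" unfolding ext_def using r by auto
        then show ?thesis by blast
      next
        case limit
        note bij = lim[OF i limit]
        have "\<exists>y\<in>carrier (G i). \<forall>j<i. p i j y = f j x" if x: "x \<in> carrier M" for x
        proof -
          have "(\<lambda>j\<in>{..<i}. f j x) \<in> inverse_limit G p i"
            unfolding inverse_limit_def using f x mod_hom_closed[OF f(1)]
            by auto
          then have "(\<lambda>j\<in>{..<i}. f j x) \<in> (\<lambda>x. \<lambda>j\<in>{..<i}. p i j x) ` carrier (G i)"
            using bij_betw_imp_surj_on[OF bij] by simp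
          then obtain y where y: "(\<lambda>j\<in>{..<i}. f j x) = (\<lambda>j\<in>{..<i}. p i j y)" "y \<in> carrier (G i)"
            by (rule imageE)
          have "p i j y = f j x" if "j < i" for j using fun_cong[OF y(1), of j] that by simp
          with y(2) show ?thesis by blast
        qed
        then obtain r where r: "\<And>x. x \<in> carrier M \<Longrightarrow> r x \<in> carrier (G i)"
          "\<And>x j. \<lbrakk>x \<in> carrier M; j < i\<rbrakk> \<Longrightarrow> p i j (r x) = f j x" by metis
        have eqI: "y = z" if "y \<in> carrier (G i)" "z \<in> carrier (G i)" "\<And>j. j < i \<Longrightarrow> p i j y = p i j z" for y z
          by (rule inj_onD[OF bij_betw_imp_inj_on[OF bij]]) (use that in \<open>auto intro!: restrict_ext\<close>)
        interpret Gi: left_module R "G i" by (rule lG[OF i])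
        have "r \<in> mod_hom R M (G i)"
        proof (rule mod_homI)
          fix x y assume xy: "x \<in> carrier M" "y \<in> carrier M"
          show "r (x \<oplus>\<^bsub>M\<^esub> y) = r x \<oplus>\<^bsub>G i\<^esub> r y"
            by (rule eqI) (use xy r in \<open>auto simp: mod_hom_add[OF p[OF i]] mod_hom_add[OF f(1)]\<close>)
        next
          fix a x assume ax: "a \<in> carrier R" "x \<in> carrier M"
          show "r (a \<odot>\<^bsub>M\<^esub> x) = a \<odot>\<^bsub>G i\<^esub> r x"
            by (rule eqI) (use ax r in \<open>auto simp: mod_hom_smult[OF p[OF i]] mod_hom_smult[OF f(1)]
              M.smult_closed Gi.smult_closed\<close>)
        qed (fact r(1))
        moreover have "r x = k i x" if "x \<in> carrier M" "g x = \<zero>\<^bsub>X\<^esub>" for x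
          by (rule eqI) (use that r f(2) pk[OF i] mod_hom_closed[OF k[OF i]] in auto)
        ultimately have "ext f i r" unfolding ext_def using r(2) by auto
        then show ?thesis by blast
      qed
    qed (simp add: ext_def)
  qed
  then obtain f where "\<And>i. ext f i (f i)" by blast
  from this[of \<alpha>] show "\<exists>h'\<in>mod_hom R M N. \<forall>x\<in>carrier M. g x = \<zero>\<^bsub>X\<^esub> \<longrightarrow> h' x = h x"
    unfolding ext_def by (auto simp: k_def G\<alpha>)
qed

end

section \<open>Hereditary complete cotorsion pairs\<close>

locale hereditary_complete_pair = small_modules U R
  for U :: "'u set set" and R :: "'r ring" +
  fixes \<F> \<C> :: "('r, 'u) module set"
  assumes pair: "hereditary_complete_cotorsion_pair U R \<F> \<C>"
begin

text \<open>From here on, the vanishing of \<open>Ext\<^sup>1\<close> in the definition of a cotorsion pair is replaced by orthogonality.\<close>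

lemma C_iff: "Y \<in> \<C> \<longleftrightarrow> Y \<in> LMod U R \<and> (\<forall>X\<in>\<F>. ext_orth U R X Y)"
  and F_iff: "X \<in> \<F> \<longleftrightarrow> X \<in> LMod U R \<and> (\<forall>Y\<in>\<C>. ext_orth U R X Y)"
proof -
  have C: "\<C> = right_perp U R \<F>" and F: "\<F> = left_perp U R \<C>"
    using pair unfolding hereditary_complete_cotorsion_pair_def cotorsion_pair_def by blast+
  have CL: "\<C> \<subseteq> LMod U R" by (subst C) (auto simp: right_perp_def)
  have FL: "\<F> \<subseteq> LMod U R" by (subst F) (auto simp: left_perp_def)
  have Ext: "Ext_vanishes U R 1 X Y \<longleftrightarrow> ext_orth U R X Y" if "X \<in> LMod U R" "Y \<in> LMod U R" for X Y
    by (rule Ext1_vanishes_iff_ext_orth[OF that(1) LModD(1)[OF that(2)]])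
  have "Y \<in> \<C> \<longleftrightarrow> Y \<in> LMod U R \<and> (\<forall>X\<in>\<F>. Ext_vanishes U R 1 X Y)"
    by (subst C) (simp add: right_perp_def)
  then show "Y \<in> \<C> \<longleftrightarrow> Y \<in> LMod U R \<and> (\<forall>X\<in>\<F>. ext_orth U R X Y)"
    using FL Ext by (auto simp: subset_iff)
  have "X \<in> \<F> \<longleftrightarrow> X \<in> LMod U R \<and> (\<forall>Y\<in>\<C>. Ext_vanishes U R 1 X Y)"
    by (subst F) (simp add: left_perp_def)
  then show "X \<in> \<F> \<longleftrightarrow> X \<in> LMod U R \<and> (\<forall>Y\<in>\<C>. ext_orth U R X Y)"
    using CL Ext by (auto simp: subset_iff)
qed

lemma F_LMod: "X \<in> \<F> \<Longrightarrow> X \<in> LMod U R" and C_LMod: "Y \<in> \<C> \<Longrightarrow> Y \<in> LMod U R"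
  using F_iff C_iff by blast+

lemma F_C_orth: "\<lbrakk>X \<in> \<F>; Y \<in> \<C>\<rbrakk> \<Longrightarrow> ext_orth U R X Y"
  by (simp add: F_iff)

lemma F_retract:
  assumes X: "X \<in> LMod U R" and X': "X' \<in> \<F>"
    and sr: "s \<in> mod_hom R X X'" "r \<in> mod_hom R X' X" "\<And>x. x \<in> carrier X \<Longrightarrow> r (s x) = x"
  shows "X \<in> \<F>"
  unfolding F_iff
proof (intro conjI ballI X)
  fix Y assume Y: "Y \<in> \<C>"
  note X'L = F_LMod[OF X']
  show "ext_orth U R X Y"
    by (rule ext_orth_retract_left[OF LModD(1)[OF X] LModD(1)[OF X'L] LMod_small[OF X'L]
        LModD(1)[OF C_LMod[OF Y]] F_C_orth[OF X' Y] sr])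
qed

lemma F_iso: "\<lbrakk>X \<in> LMod U R; mod_iso R X X'; X' \<in> \<F>\<rbrakk> \<Longrightarrow> X \<in> \<F>"
  by (rule mod_isoE[OF _ LModD(1)]) (auto intro: F_retract)

lemma C_iso: "\<lbrakk>Y \<in> LMod U R; mod_iso R Y Y'; Y' \<in> \<C>\<rbrakk> \<Longrightarrow> Y \<in> \<C>"
  unfolding C_iff[of Y] by (auto intro: ext_orth_iso_right[OF F_C_orth] LModD(1))

lemma special_precover:
  assumes M: "M \<in> LMod U R"
  obtains F g where "F \<in> \<F>" "mod_epi R F g M" "kernel_module F M g \<in> \<C>"
proof -
  obtain C' F f g where C': "C' \<in> \<C>" and F: "F \<in> \<F>" and se: "short_exact R C' f F g M"
    using pair M unfolding hereditary_complete_cotorsion_pair_def complete_pair_def by meson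
  have g: "mod_epi R F g M" using se by (simp add: short_exact_def mod_epi_def)
  let ?K = "kernel_module F M g"
  have K: "?K \<in> LMod U R" by (rule kernel_LMod[OF F_LMod[OF F] LModD(1)[OF M] mod_epi_hom[OF g]])
  have im: "f ` carrier C' = carrier ?K" and f: "f \<in> mod_hom R C' F" and inj: "inj_on f (carrier C')"
    using se by (simp_all add: short_exact_def a_kernel_eq)
  have "f \<in> mod_hom R C' ?K" by (rule mod_hom_into_kernel[OF f]) (use im in auto)
  then have "mod_iso R C' ?K" unfolding mod_iso_def bij_betw_def using im inj by blast
  then have "?K \<in> \<C>" using C_iso[OF K mod_iso_sym C'] LModD(1)[OF C_LMod[OF C']] by blast
  then show thesis using F g that by blast
qed

lemma embedding_into_C:
  assumes M: "M \<in> LMod U R"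
  obtains C f where "C \<in> \<C>" "f \<in> mod_hom R M C" "inj_on f (carrier M)"
  using pair M unfolding hereditary_complete_cotorsion_pair_def complete_pair_def short_exact_def by meson

lemma F_extension:
  assumes X: "X \<in> LMod U R" and g: "mod_epi R X g B" and B: "B \<in> \<F>" and K: "kernel_module X B g \<in> \<F>"
  shows "X \<in> \<F>"
  unfolding F_iff
  using ext_orth_extension[OF X LModD(1)[OF F_LMod[OF B]] g F_C_orth[OF K] F_C_orth[OF B]] X by blast

text \<open>Here the pair has to be hereditary. The first syzygy of \<open>Y\<close> is orthogonal to \<open>C\<close>, hence so is the fibre
  product \<open>E\<close> of a projective cover \<open>P \<rightarrow> Y\<close> with \<open>X \<rightarrow> Y\<close>, as an extension of \<open>X\<close> by that syzygy. But
  \<open>E \<rightarrow> P\<close> splits, so its kernel, which is the kernel of \<open>X \<rightarrow> Y\<close>, is a direct summand of \<open>E\<close>.\<close>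

lemma F_kernel:
  assumes X: "X \<in> \<F>" and Y: "Y \<in> \<F>" and g: "mod_epi R X g Y"
  shows "kernel_module X Y g \<in> \<F>"
  unfolding F_iff
proof (intro conjI ballI)
  note XL = F_LMod[OF X] and YL = F_LMod[OF Y] and gh = mod_epi_hom[OF g]
  note lX = LModD(1)[OF XL] and lY = LModD(1)[OF YL]
  let ?K = "kernel_module X Y g"
  show K: "?K \<in> LMod U R" by (rule kernel_LMod[OF XL lY gh])
  fix C assume C: "C \<in> \<C>"
  note lC = LModD(1)[OF C_LMod[OF C]]
  have "Ext_vanishes U R 2 Y C"
    using pair Y C by (simp add: hereditary_complete_cotorsion_pair_def hereditary_pair_def)
  then obtain P \<pi> where P: "projective U R P" and \<pi>: "mod_epi R P \<pi> Y"
    and orth: "ext_orth U R (kernel_module P Y \<pi>) C"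
    by (rule Ext2_vanishes_syzygy[OF YL lC])
  note PL = projective_LMod[OF P] and \<pi>h = mod_epi_hom[OF \<pi>]
  note lP = LModD(1)[OF PL]
  obtain E a b where E: "E \<in> LMod U R" and pb: "is_pullback E a b P \<pi> X g"
    by (rule pullback_exists[OF lP LMod_small[OF PL] lX LMod_small[OF XL] lY \<pi>h gh])
  note ab = pullback_homs[OF pb] and lE = LModD(1)[OF E]
  have a: "mod_epi R E a P" by (rule pullback_epi[OF pb \<pi>h g])
  have b: "mod_epi R E b X" by (rule pullback_epi[OF pullback_flip[OF pb] gh \<pi>])
  have "mod_iso R (kernel_module E X b) (kernel_module P Y \<pi>)"
    by (rule pullback_kernel_iso[OF pullback_flip[OF pb] lE lX lP lY gh \<pi>h])
  moreover have "left_module R (kernel_module E X b)" by (rule left_module_kernel[OF lE lX ab(2)])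
  moreover have "left_module R (kernel_module P Y \<pi>)" "small U (carrier (kernel_module P Y \<pi>))"
    using LMod_small[OF kernel_LMod[OF PL lY \<pi>h]] left_module_kernel[OF lP lY \<pi>h] by auto
  ultimately have "ext_orth U R (kernel_module E X b) C"
    using orth lC by (auto elim!: mod_isoE intro: ext_orth_retract_left)
  then have orthE: "ext_orth U R E C"
    by (rule ext_orth_extension[OF E lX b _ F_C_orth[OF X C]])
  obtain s where s: "s \<in> mod_hom R P E" "\<forall>x\<in>carrier P. a (s x) = x"
    by (rule projective_lift[OF P E PL a mod_hom_id])
  interpret E: left_module R E by fact
  interpret P: left_module R P by fact
  interpret X: left_module R X by fact
  have lK: "left_module R ?K" by (rule LModD(1)[OF K])
  obtain u where u: "u \<in> mod_hom R ?K E" "\<forall>x\<in>carrier ?K. a (u x) = \<zero>\<^bsub>P\<^esub>" "\<forall>x\<in>carrier ?K. b (u x) = x"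
    by (rule pullback_universal[OF pb lE lK mod_hom_zero_map[OF lP] mod_hom_from_kernel[OF mod_hom_id]])
      (use mod_hom_zero[OF lP lY \<pi>h] in auto)
  let ?r = "\<lambda>x. b (x \<ominus>\<^bsub>E\<^esub> s (a x))"
  have r: "?r \<in> mod_hom R E ?K"
  proof (rule mod_hom_into_kernel)
    show "?r \<in> mod_hom R E X"
      by (rule mod_hom_comp[OF mod_hom_diff[OF lE mod_hom_id mod_hom_comp[OF ab(1) s(1)]] ab(2)])
    fix x assume x: "x \<in> carrier E"
    have "g (?r x) = \<pi> (a (x \<ominus>\<^bsub>E\<^esub> s (a x)))"
      using pullback_comm[OF pb] x mod_hom_closed[OF s(1)] mod_hom_closed[OF ab(1)] by simp
    also have "\<dots> = \<zero>\<^bsub>Y\<^esub>"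
      using x s(2) mod_hom_closed[OF s(1)] mod_hom_closed[OF ab(1)] mod_hom_zero[OF lP lY \<pi>h]
      by (simp add: mod_hom_minus[OF lE lP ab(1)])
    finally show "g (?r x) = \<zero>\<^bsub>Y\<^esub>" .
  qed
  have ru: "?r (u x) = x" if x: "x \<in> carrier ?K" for x
    using u(2,3) x mod_hom_closed[OF u(1) x] mod_hom_zero[OF lP lE s(1)] by simp
  show "ext_orth U R ?K C"
    by (rule ext_orth_retract_left[OF lK lE LMod_small[OF E] lC orthE u(1) r ru])
qed

section \<open>Resolution dimension\<close>

text \<open>Resolution dimension with respect to \<open>\<F>\<close>, by recursion on the length: a resolution is built from one
  cover by a member of \<open>\<F>\<close> and a shorter resolution of the kernel. The dimension behaves as for
  projective resolutions because \<open>\<F>\<close> is closed under extensions and under kernels of epimorphisms. The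
  behaviour in short exact sequences is proved without long exact sequences, by a simultaneous induction
  whose engine is closure under extensions.\<close>

primrec resdim_le :: "nat \<Rightarrow> ('r, 'u) module \<Rightarrow> bool" where
  "resdim_le 0 X \<longleftrightarrow> X \<in> \<F>"
| "resdim_le (Suc n) X \<longleftrightarrow> X \<in> LMod U R \<and>
     (\<exists>P\<in>\<F>. \<exists>g. mod_epi R P g X \<and> resdim_le n (kernel_module P X g))"

lemma resdim_LMod: "resdim_le n X \<Longrightarrow> X \<in> LMod U R"
  by (cases n) (auto simp: F_LMod)

lemma resdim_F: "X \<in> \<F> \<Longrightarrow> resdim_le n X"
proof (induction n arbitrary: X)
  case (Suc n)
  have e: "mod_epi R X (\<lambda>x. x) X" by (simp add: mod_epi_def mod_hom_id)
  show ?case using Suc.IH[OF F_kernel[OF Suc.prems Suc.prems e]] Suc.prems e F_LMod by auto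
qed simp

lemma resdim_Suc: "resdim_le n X \<Longrightarrow> resdim_le (Suc n) X"
proof (induction n arbitrary: X)
  case 0
  then show ?case using resdim_F[of X 1] by simp
next
  case (Suc n)
  then show ?case by (subst resdim_le.simps(2)) (auto simp: simp del: resdim_le.simps(2)
    dest!: resdim_le.simps(2)[THEN iffD1])
qed

lemma resdim_iso:
  assumes "resdim_le n X" "mod_iso R X X'" "X' \<in> LMod U R"
  shows "resdim_le n X'"
proof (cases n)
  case 0
  then show ?thesis using assms F_iso mod_iso_sym LModD(1) by (metis resdim_LMod resdim_le.simps(1))
next
  case (Suc m)
  then obtain P g where P: "P \<in> \<F>" "mod_epi R P g X" "resdim_le m (kernel_module P X g)"
    using assms(1) by auto
  note lX = LModD(1)[OF resdim_LMod[OF assms(1)]] and lX' = LModD(1)[OF assms(3)]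
  obtain h h' where h: "h \<in> mod_hom R X X'" "h' \<in> mod_hom R X' X" "\<forall>x\<in>carrier X. h' (h x) = x"
    "\<forall>y\<in>carrier X'. h (h' y) = y" by (rule mod_isoE[OF assms(2) lX])
  have "mod_epi R X h X'" by (rule mod_epiI[OF h(1)]) (use h(4) mod_hom_closed[OF h(2)] in auto)
  then have "mod_epi R P (\<lambda>x. h (g x)) X'" by (rule mod_epi_comp[OF P(2)])
  moreover have "h (g x) = \<zero>\<^bsub>X'\<^esub> \<longleftrightarrow> g x = \<zero>\<^bsub>X\<^esub>" if "x \<in> carrier P" for x
    using h(3) mod_hom_closed[OF mod_epi_hom[OF P(2)] that] mod_hom_zero[OF lX lX' h(1)]
      mod_hom_zero[OF lX' lX h(2)] by metis
  then have "kernel_module P X' (\<lambda>x. h (g x)) = kernel_module P X g"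
    by (simp add: kernel_module_def a_kernel_eq cong: conj_cong)
  ultimately show ?thesis using Suc P assms(3)
    by (auto intro!: bexI[of _ P] exI[of _ "\<lambda>x. h (g x)"])
qed

lemma resdim_kernel_of_epi_to_F:
  assumes "resdim_le n E" "B \<in> \<F>" "mod_epi R E g B"
  shows "resdim_le n (kernel_module E B g)"
proof (cases n)
  case 0
  then show ?thesis using assms F_kernel by simp
next
  case (Suc m)
  then obtain P q where P: "P \<in> \<F>" "mod_epi R P q E" "resdim_le m (kernel_module P E q)"
    using assms(1) by auto
  note EL = resdim_LMod[OF assms(1)] and lB = LModD(1)[OF F_LMod[OF assms(2)]] and gh = mod_epi_hom[OF assms(3)]
  note kr = kernel_restrict[OF LModD(1)[OF EL] lB P(2) gh]
  have "kernel_module P B (\<lambda>x. g (q x)) \<in> \<F>" by (rule F_kernel[OF P(1) assms(2) mod_epi_comp[OF P(2) assms(3)]])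
  then show ?thesis
    unfolding Suc resdim_le.simps using kr P(3) kernel_LMod[OF EL lB gh] by metis
qed

definition extension_closed :: "nat \<Rightarrow> bool" where
  "extension_closed n \<longleftrightarrow> (\<forall>E B g. E \<in> LMod U R \<longrightarrow> mod_epi R E g B \<longrightarrow> resdim_le n B \<longrightarrow>
     resdim_le n (kernel_module E B g) \<longrightarrow> resdim_le n E)"

text \<open>Any cover can be used to compute the dimension, a form of Schanuel's lemma: the fibre product of two
  covers is an extension of either cover by the kernel of the other one.\<close>

lemma resdim_kernel_of_cover_if_extension_closed:
  assumes ext: "extension_closed n" and X: "resdim_le (Suc n) X" and P: "P \<in> \<F>" "mod_epi R P g X"
  shows "resdim_le n (kernel_module P X g)"
proof -
  obtain F1 g1 where F1: "F1 \<in> \<F>" "mod_epi R F1 g1 X" "resdim_le n (kernel_module F1 X g1)"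
    using X by auto
  note lX = LModD(1)[OF resdim_LMod[OF X]] and PL = F_LMod[OF P(1)] and FL = F_LMod[OF F1(1)]
  note lP = LModD(1)[OF PL] and lF = LModD(1)[OF FL] and gh = mod_epi_hom[OF P(2)] and g1h = mod_epi_hom[OF F1(2)]
  obtain E p q where E: "E \<in> LMod U R" and pb: "is_pullback E p q F1 g1 P g"
    by (rule pullback_exists[OF lF LMod_small[OF FL] lP LMod_small[OF PL] lX g1h gh])
  note lE = LModD(1)[OF E] and pq = pullback_homs[OF pb]
  have p: "mod_epi R E p F1" by (rule pullback_epi[OF pb g1h P(2)])
  have q: "mod_epi R E q P" by (rule pullback_epi[OF pullback_flip[OF pb] gh F1(2)])
  have kq: "mod_iso R (kernel_module E P q) (kernel_module F1 X g1)"
    by (rule pullback_kernel_iso[OF pullback_flip[OF pb] lE lP lF lX gh g1h])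
  have "resdim_le n (kernel_module E P q)"
    by (rule resdim_iso[OF F1(3) mod_iso_sym[OF kq left_module_kernel[OF lE lP pq(2)]] kernel_LMod[OF E lP pq(2)]])
  then have "resdim_le n E" using ext E q resdim_F[OF P(1)] unfolding extension_closed_def by blast
  then have "resdim_le n (kernel_module E F1 p)" by (rule resdim_kernel_of_epi_to_F[OF _ F1(1) p])
  moreover have "mod_iso R (kernel_module E F1 p) (kernel_module P X g)"
    by (rule pullback_kernel_iso[OF pb lE lF lP lX g1h gh])
  ultimately show ?thesis by (rule resdim_iso[OF _ _ kernel_LMod[OF PL lX gh]])
qed

text \<open>A cover of \<open>E\<close> is also one of \<open>B\<close>, and its kernel over \<open>B\<close> is an extension of the kernel of \<open>E \<rightarrow> B\<close> by
  its kernel over \<open>E\<close>.\<close>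

lemma resdim_quotient_if_extension_closed:
  assumes ext: "extension_closed n" and E: "resdim_le (Suc n) E" and B: "B \<in> LMod U R"
    and g: "mod_epi R E g B" and K: "resdim_le n (kernel_module E B g)"
  shows "resdim_le (Suc n) B"
proof -
  obtain P q where P: "P \<in> \<F>" "mod_epi R P q E" "resdim_le n (kernel_module P E q)"
    using E by auto
  note lE = LModD(1)[OF resdim_LMod[OF E]] and lB = LModD(1)[OF B]
  note gq = mod_epi_comp[OF P(2) g] and kr = kernel_restrict[OF lE lB P(2) mod_epi_hom[OF g]]
  have "resdim_le n (kernel_module P B (\<lambda>x. g (q x)))"
    using ext kernel_LMod[OF F_LMod[OF P(1)] lB mod_epi_hom[OF gq]] kr(1) K P(3)
    unfolding extension_closed_def kr(2)[symmetric] by blast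
  then show ?thesis using B P(1) gq by auto
qed

text \<open>For a cover \<open>P \<rightarrow> E\<close>, the kernel of \<open>P \<rightarrow> B\<close> maps onto the kernel of \<open>E \<rightarrow> B\<close>, so the latter is a quotient
  as in the preceding lemma.\<close>

lemma resdim_kernel_if_extension_closed:
  assumes ext: "\<And>m. m \<le> n \<Longrightarrow> extension_closed m"
    and E: "resdim_le n E" and B: "resdim_le (Suc n) B" and g: "mod_epi R E g B"
  shows "resdim_le n (kernel_module E B g)"
proof (cases n)
  case 0
  then show ?thesis using resdim_kernel_of_cover_if_extension_closed[OF ext, of 0 B E g] assms by simp
next
  case (Suc m)
  then obtain P q where P: "P \<in> \<F>" "mod_epi R P q E" "resdim_le m (kernel_module P E q)"
    using E by auto
  note EL = resdim_LMod[OF E] and lB = LModD(1)[OF resdim_LMod[OF B]] and gh = mod_epi_hom[OF g]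
  note kr = kernel_restrict[OF LModD(1)[OF EL] lB P(2) gh]
  have *: "resdim_le (Suc m) (kernel_module P B (\<lambda>x. g (q x)))"
    using resdim_kernel_of_cover_if_extension_closed[OF ext _ P(1) mod_epi_comp[OF P(2) g], of n] B Suc by simp
  show ?thesis
    unfolding Suc
    by (rule resdim_quotient_if_extension_closed[OF ext * kernel_LMod[OF EL lB gh] kr(1)]) (use P(3) kr(2) Suc in simp_all)
qed

text \<open>For a cover \<open>P \<rightarrow> E\<close>, the kernel of \<open>P \<rightarrow> B\<close> has dimension at most \<open>m\<close> and maps onto the kernel of
  \<open>E \<rightarrow> B\<close>, with the same kernel as \<open>P \<rightarrow> E\<close>; the bound for kernels at \<open>m\<close> applies to this map.\<close>

lemma extension_closed: "extension_closed n"
proof (induction n rule: less_induct)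
  case (less n)
  show ?case
  proof (cases n)
    case 0
    then show ?thesis using F_extension unfolding extension_closed_def by simp
  next
    case (Suc m)
    show ?thesis unfolding extension_closed_def Suc
    proof (intro allI impI)
      fix E B g assume E: "E \<in> LMod U R" and g: "mod_epi R E g B" and B: "resdim_le (Suc m) B"
        and K: "resdim_le (Suc m) (kernel_module E B g)"
      obtain P q where P: "P \<in> \<F>" "mod_epi R P q E" by (rule special_precover[OF E])
      note kr = kernel_restrict[OF LModD(1)[OF E] LModD(1)[OF resdim_LMod[OF B]] P(2) mod_epi_hom[OF g]]
      have "resdim_le m (kernel_module P B (\<lambda>x. g (q x)))"
        by (rule resdim_kernel_of_cover_if_extension_closed[OF less B P(1) mod_epi_comp[OF P(2) g]]) (simp add: Suc)
      from resdim_kernel_if_extension_closed[OF less this K kr(1)] have "resdim_le m (kernel_module P E q)"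
        unfolding kr(2) by (simp add: Suc)
      then show "resdim_le (Suc m) E" using E P by auto
    qed
  qed
qed

lemmas resdim_kernel_of_cover = resdim_kernel_of_cover_if_extension_closed[OF extension_closed]

lemma resdim_kernel:
  "\<lbrakk>resdim_le n E; resdim_le n B; mod_epi R E g B\<rbrakk> \<Longrightarrow> resdim_le n (kernel_module E B g)"
  by (rule resdim_kernel_if_extension_closed[OF extension_closed _ resdim_Suc])

lemma resdim_of_resolution:
  assumes "resolution R P d e X" "X \<in> LMod U R" "\<And>i. i \<le> n \<Longrightarrow> P i \<in> \<F>"
    and "\<And>i. i > n \<Longrightarrow> carrier (P i) = {\<zero>\<^bsub>P i\<^esub>}"
  shows "resdim_le n X"
  using assms
proof (induction n arbitrary: P d e X)
  case 0
  note res = 0(1)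
  have e: "mod_epi R (P 0) e X" using res by (simp add: resolution_def mod_epi_def)
  have l: "left_module R (P i)" for i using res by (simp add: resolution_def)
  have d: "d 0 \<in> mod_hom R (P 1) (P 0)" using res by (simp add: resolution_def)
  have "a_kernel (P 0) X e = {\<zero>\<^bsub>P 0\<^esub>}"
    using res 0(4)[of 1] mod_hom_zero[OF l l d] by (simp add: resolution_def)
  then have "mod_iso R (P 0) X"
    by (intro mod_isoI_inj[OF e l LModD(1)[OF 0(2)]]) (auto simp: a_kernel_eq)
  then show ?case using resdim_iso[of 0 "P 0" X] 0(2,3) by simp
next
  case (Suc n)
  note res = Suc.prems(1)
  have e: "mod_epi R (P 0) e X" using res by (simp add: resolution_def mod_epi_def)
  have K: "kernel_module (P 0) X e \<in> LMod U R"
    using kernel_LMod[OF F_LMod LModD(1)[OF Suc.prems(2)] mod_epi_hom[OF e]] Suc.prems(3) by simp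
  have "resolution R (\<lambda>i. P (Suc i)) (\<lambda>i. d (Suc i)) (d 0) (kernel_module (P 0) X e)"
    using res syzygy_epi[OF res, of 0] syzygy_zero[OF res]
    by (auto simp: resolution_def mod_epi_def a_kernel_eq)
  then have "resdim_le n (kernel_module (P 0) X e)"
    using K Suc.prems(3,4) by (intro Suc.IH) auto
  then show ?case using Suc.prems(2,3) e by auto
qed

lemma resdim_of_res_dim_le:
  assumes M: "left_module R M" and dim: "res_dim_le R \<F> n M"
    and iso: "mod_iso R M X" and X: "X \<in> LMod U R"
  shows "resdim_le n X"
proof -
  obtain P d e where res: "resolution R P d e M" and P: "\<forall>i\<le>n. P i \<in> \<F>" "\<forall>i>n. carrier (P i) = {\<zero>\<^bsub>P i\<^esub>}"
    using dim unfolding res_dim_le_def by blast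
  obtain h h' where h: "h \<in> mod_hom R M X" "h' \<in> mod_hom R X M" "\<forall>x\<in>carrier M. h' (h x) = x"
    "\<forall>y\<in>carrier X. h (h' y) = y" by (rule mod_isoE[OF iso M])
  have lX: "left_module R X" by (rule LModD(1)[OF X])
  have e: "mod_epi R (P 0) e M" using res by (simp add: resolution_def mod_epi_def)
  have "mod_epi R M h X" by (rule mod_epiI[OF h(1)]) (use h(4) mod_hom_closed[OF h(2)] in auto)
  then have "mod_epi R (P 0) (\<lambda>x. h (e x)) X" by (rule mod_epi_comp[OF e])
  moreover have "h (e x) = \<zero>\<^bsub>X\<^esub> \<longleftrightarrow> e x = \<zero>\<^bsub>M\<^esub>" if "x \<in> carrier (P 0)" for x
    using h(3) mod_hom_closed[OF mod_epi_hom[OF e] that] mod_hom_zero[OF M lX h(1)]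
      mod_hom_zero[OF lX M h(2)] by metis
  then have "a_kernel (P 0) X (\<lambda>x. h (e x)) = a_kernel (P 0) M e" by (auto simp: a_kernel_eq)
  ultimately have "resolution R P d (\<lambda>x. h (e x)) X"
    using res by (simp add: resolution_def mod_epi_def)
  then show ?thesis using X P by (intro resdim_of_resolution) auto
qed

end

section \<open>Coinduced modules\<close>

lemma restrict_scalars_simps [simp]:
  "carrier (restrict_scalars \<phi> M) = carrier M" "zero (restrict_scalars \<phi> M) = zero M"
  "add (restrict_scalars \<phi> M) = add M" "smult (restrict_scalars \<phi> M) = (\<lambda>r x. \<phi> r \<odot>\<^bsub>M\<^esub> x)"
  by (simp_all add: restrict_scalars_def)

lemma kernel_module_restrict_scalars:
  "kernel_module (restrict_scalars \<phi> M) (restrict_scalars \<phi> N) h = restrict_scalars \<phi> (kernel_module M N h)"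
  by (simp add: kernel_module_def restrict_scalars_def a_kernel_eq)

locale change_of_rings = hereditary_complete_pair U R \<F> \<C>
  for U :: "'u set set" and R :: "'r ring" and \<F> \<C> +
  fixes A :: "'a ring" and \<phi> :: "'r \<Rightarrow> 'a"
  assumes ring_A: "ring A" and small_A: "small U (carrier A)" and powers_A: "powers_small U (carrier A)"
    and hom: "\<phi> \<in> ring_hom R A"
    and A_in_F: "in_class R \<F> (restrict_scalars \<phi> (regular_module A))"
    and coinduced_in_F: "F \<in> \<F> \<Longrightarrow> in_class R \<F> (restrict_scalars \<phi> (coinduced R A \<phi> F))"
begin

sublocale A: small_modules U A
  by (rule small_modules.intro) (fact universe ring_A small_A)+

sublocale RA: ring A by (rule ring_A)

abbreviation res :: "('a, 'm) module \<Rightarrow> ('r, 'm) module" where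
  "res \<equiv> restrict_scalars \<phi>"

abbreviation coind :: "('r, 'm) module \<Rightarrow> ('a, 'a \<Rightarrow> 'm) module" where
  "coind \<equiv> coinduced R A \<phi>"

lemma phi_simps [simp]:
  "r \<in> carrier R \<Longrightarrow> \<phi> r \<in> carrier A"
  "\<lbrakk>r \<in> carrier R; s \<in> carrier R\<rbrakk> \<Longrightarrow> \<phi> (r \<oplus>\<^bsub>R\<^esub> s) = \<phi> r \<oplus>\<^bsub>A\<^esub> \<phi> s"
  "\<lbrakk>r \<in> carrier R; s \<in> carrier R\<rbrakk> \<Longrightarrow> \<phi> (r \<otimes>\<^bsub>R\<^esub> s) = \<phi> r \<otimes>\<^bsub>A\<^esub> \<phi> s"
  "\<phi> \<one>\<^bsub>R\<^esub> = \<one>\<^bsub>A\<^esub>"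
  using hom by (auto simp: ring_hom_def)

lemma left_module_res:
  assumes "left_module A M" shows "left_module R (res M)"
proof -
  interpret M: left_module A M by fact
  have "\<exists>y\<in>carrier M. y \<oplus>\<^bsub>M\<^esub> x = \<zero>\<^bsub>M\<^esub>" if "x \<in> carrier M" for x
    using that M.l_neg by blast
  then show ?thesis
    by (intro left_moduleI) (simp_all add: ring M.smult_closed M.smult_l_distr M.smult_r_distr
        M.smult_assoc1 M.smult_one M.a_ac)
qed

lemma res_LMod: "M \<in> LMod U A \<Longrightarrow> res M \<in> LMod U R"
  by (simp add: LMod_def left_module_res)

lemma mod_hom_res: "h \<in> mod_hom A M N \<Longrightarrow> h \<in> mod_hom R (res M) (res N)"
  by (auto simp: mod_hom_def)

lemma mod_epi_res: "mod_epi A M h N \<Longrightarrow> mod_epi R (res M) h (res N)"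
  by (simp add: mod_epi_def mod_hom_res)

lemma coinduced_simps [simp]:
  "zero (coind M) = (\<lambda>x\<in>carrier A. \<zero>\<^bsub>M\<^esub>)"
  "add (coind M) = (\<lambda>f g. \<lambda>x\<in>carrier A. f x \<oplus>\<^bsub>M\<^esub> g x)"
  "smult (coind M) = (\<lambda>a f. \<lambda>x\<in>carrier A. f (x \<otimes>\<^bsub>A\<^esub> a))"
  by (simp_all add: coinduced_def)

lemma coinduced_carrier: "f \<in> carrier (coind M) \<longleftrightarrow> f \<in> carrier A \<rightarrow>\<^sub>E carrier M \<and>
    (\<forall>x\<in>carrier A. \<forall>y\<in>carrier A. f (x \<oplus>\<^bsub>A\<^esub> y) = f x \<oplus>\<^bsub>M\<^esub> f y) \<and>
    (\<forall>r\<in>carrier R. \<forall>x\<in>carrier A. f (\<phi> r \<otimes>\<^bsub>A\<^esub> x) = r \<odot>\<^bsub>M\<^esub> f x)"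
  by (auto simp: coinduced_def mod_hom_def PiE_def)

lemma coinduced_closed: "\<lbrakk>f \<in> carrier (coind M); a \<in> carrier A\<rbrakk> \<Longrightarrow> f a \<in> carrier M"
  by (auto simp: coinduced_carrier)

lemma coinduced_hom: "f \<in> carrier (coind M) \<Longrightarrow> f \<in> mod_hom R (res (regular_module A)) M"
  by (simp add: coinduced_def)

lemma coinduced_eqI:
  "\<lbrakk>f \<in> carrier (coind M); g \<in> carrier (coind M); \<And>a. a \<in> carrier A \<Longrightarrow> f a = g a\<rbrakk> \<Longrightarrow> f = g"
  by (auto simp: coinduced_carrier intro: PiE_ext)

lemma left_module_coinduced:
  assumes "left_module R M" shows "left_module A (coind M)"
proof -
  interpret M: left_module R M by fact
  have sr: "r \<odot>\<^bsub>M\<^esub> \<zero>\<^bsub>M\<^esub> = \<zero>\<^bsub>M\<^esub>" if "r \<in> carrier R" for r using that by simp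
  show ?thesis
  proof (rule left_moduleI)
    fix f assume f: "f \<in> carrier (coind M)"
    let ?g = "\<lambda>x\<in>carrier A. \<ominus>\<^bsub>M\<^esub> f x"
    have "?g \<in> carrier (coind M)"
      using f by (auto simp: coinduced_carrier PiE_iff M.minus_add M.smult_neg M.a_comm)
    moreover have "?g \<oplus>\<^bsub>coind M\<^esub> f = \<zero>\<^bsub>coind M\<^esub>"
      using f by (auto simp: coinduced_carrier PiE_iff M.l_neg intro!: restrict_ext)
    ultimately show "\<exists>g\<in>carrier (coind M). g \<oplus>\<^bsub>coind M\<^esub> f = \<zero>\<^bsub>coind M\<^esub>" by blast
    show "\<zero>\<^bsub>coind M\<^esub> \<oplus>\<^bsub>coind M\<^esub> f = f" "\<one>\<^bsub>A\<^esub> \<odot>\<^bsub>coind M\<^esub> f = f"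
      using f by (auto simp: coinduced_carrier PiE_iff fun_eq_iff extensional_def)
    fix g assume g: "g \<in> carrier (coind M)"
    show "f \<oplus>\<^bsub>coind M\<^esub> g \<in> carrier (coind M)"
      using f g by (auto simp: coinduced_carrier PiE_iff M.smult_r_distr M.a_ac)
    show "f \<oplus>\<^bsub>coind M\<^esub> g = g \<oplus>\<^bsub>coind M\<^esub> f"
      using f g by (auto simp: coinduced_carrier PiE_iff M.a_comm intro!: restrict_ext)
  next
    fix a f assume "a \<in> carrier A" "f \<in> carrier (coind M)"
    then show "a \<odot>\<^bsub>coind M\<^esub> f \<in> carrier (coind M)"
      by (auto simp: coinduced_carrier PiE_iff RA.l_distr RA.m_assoc)
  next
    fix a b f assume "a \<in> carrier A" "b \<in> carrier A" "f \<in> carrier (coind M)"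
    then show "(a \<oplus>\<^bsub>A\<^esub> b) \<odot>\<^bsub>coind M\<^esub> f = a \<odot>\<^bsub>coind M\<^esub> f \<oplus>\<^bsub>coind M\<^esub> b \<odot>\<^bsub>coind M\<^esub> f"
      "(a \<otimes>\<^bsub>A\<^esub> b) \<odot>\<^bsub>coind M\<^esub> f = a \<odot>\<^bsub>coind M\<^esub> (b \<odot>\<^bsub>coind M\<^esub> f)"
      by (auto simp: coinduced_carrier RA.r_distr RA.m_assoc intro!: restrict_ext)
  qed (auto simp: coinduced_carrier PiE_iff RA.ring_axioms M.a_assoc sr intro!: restrict_ext)
qed

lemma small_coinduced:
  assumes "M \<in> LMod U R" shows "small U (carrier (coind M))"
proof (rule small_subset)
  show "small U (carrier A \<rightarrow>\<^sub>E carrier M)"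
    using powers_A LModD(2)[OF assms] by (simp add: powers_small_def)
  show "carrier (coind M) \<subseteq> carrier A \<rightarrow>\<^sub>E carrier M" by (auto simp: coinduced_carrier)
qed

definition coind_map :: "('m \<Rightarrow> 'n) \<Rightarrow> ('a \<Rightarrow> 'm) \<Rightarrow> 'a \<Rightarrow> 'n" where
  "coind_map g f = (\<lambda>a\<in>carrier A. g (f a))"

lemma coind_map_hom:
  assumes g: "g \<in> mod_hom R M N"
  shows "coind_map g \<in> mod_hom A (coind M) (coind N)"
proof (rule mod_homI)
  note [simp] = mod_hom_closed[OF g] mod_hom_add[OF g] mod_hom_smult[OF g]
  show "coind_map g f \<in> carrier (coind N)" if "f \<in> carrier (coind M)" for f
    using that by (auto simp: coinduced_carrier coind_map_def PiE_iff)
  show "coind_map g (f \<oplus>\<^bsub>coind M\<^esub> h) = coind_map g f \<oplus>\<^bsub>coind N\<^esub> coind_map g h"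
    if "f \<in> carrier (coind M)" "h \<in> carrier (coind M)" for f h
    using that by (auto simp: coinduced_closed coind_map_def intro!: restrict_ext)
  show "coind_map g (a \<odot>\<^bsub>coind M\<^esub> f) = a \<odot>\<^bsub>coind N\<^esub> coind_map g f"
    if "a \<in> carrier A" "f \<in> carrier (coind M)" for a f
    using that by (auto simp: coind_map_def intro!: restrict_ext)
qed

text \<open>The \<open>A\<close>-linear map into a coinduced module that corresponds to the \<open>R\<close>-linear map \<open>f\<close>; conversely, \<open>f\<close>
  is recovered by evaluation at \<open>1\<close>.\<close>

definition transpose :: "('a, 'm) module \<Rightarrow> ('m \<Rightarrow> 'n) \<Rightarrow> 'm \<Rightarrow> 'a \<Rightarrow> 'n" where
  "transpose X f x = (\<lambda>a\<in>carrier A. f (a \<odot>\<^bsub>X\<^esub> x))"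

lemma transpose_hom:
  assumes X: "left_module A X" and f: "f \<in> mod_hom R (res X) M"
  shows "transpose X f \<in> mod_hom A X (coind M)"
proof (rule mod_homI)
  interpret X: left_module A X by fact
  have [simp]: "f x \<in> carrier M" "f (x \<oplus>\<^bsub>X\<^esub> y) = f x \<oplus>\<^bsub>M\<^esub> f y" "f (\<phi> r \<odot>\<^bsub>X\<^esub> x) = r \<odot>\<^bsub>M\<^esub> f x"
    if "x \<in> carrier X" "y \<in> carrier X" "r \<in> carrier R" for x y r
    using that mod_hom_closed[OF f] mod_hom_add[OF f] mod_hom_smult[OF f] by auto
  have cl: "f (a \<odot>\<^bsub>X\<^esub> x) \<in> carrier M" if "a \<in> carrier A" "x \<in> carrier X" for a x
    using that mod_hom_closed[OF f] X.smult_closed by auto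
  have ad: "f (x \<oplus>\<^bsub>X\<^esub> y) = f x \<oplus>\<^bsub>M\<^esub> f y" if "x \<in> carrier X" "y \<in> carrier X" for x y
    using that mod_hom_add[OF f] by auto
  show "transpose X f x \<in> carrier (coind M)" if "x \<in> carrier X" for x
    using that by (auto simp: coinduced_carrier transpose_def X.smult_closed X.smult_l_distr X.smult_assoc1 cl ad)
  show "transpose X f (x \<oplus>\<^bsub>X\<^esub> y) = transpose X f x \<oplus>\<^bsub>coind M\<^esub> transpose X f y"
    if "x \<in> carrier X" "y \<in> carrier X" for x y
    using that by (auto simp: transpose_def X.smult_closed X.smult_r_distr ad intro!: restrict_ext)
  show "transpose X f (a \<odot>\<^bsub>X\<^esub> x) = a \<odot>\<^bsub>coind M\<^esub> transpose X f x" if "a \<in> carrier A" "x \<in> carrier X" for a x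
    using that by (auto simp: transpose_def X.smult_assoc1 intro!: restrict_ext)
qed

lemma transpose_one: "\<lbrakk>left_module A X; x \<in> carrier X\<rbrakk> \<Longrightarrow> transpose X f x \<one>\<^bsub>A\<^esub> = f x"
  by (simp add: transpose_def left_module.smult_one)

lemma eval_hom: "(\<lambda>f. f \<one>\<^bsub>A\<^esub>) \<in> mod_hom R (res (coind M)) M"
proof (rule mod_homI)
  fix r f assume r: "r \<in> carrier R" and "f \<in> carrier (res (coind M))"
  then have "f (\<phi> r \<otimes>\<^bsub>A\<^esub> \<one>\<^bsub>A\<^esub>) = r \<odot>\<^bsub>M\<^esub> f \<one>\<^bsub>A\<^esub>" by (simp add: coinduced_carrier del: RA.r_one)
  then show "(r \<odot>\<^bsub>res (coind M)\<^esub> f) \<one>\<^bsub>A\<^esub> = r \<odot>\<^bsub>M\<^esub> f \<one>\<^bsub>A\<^esub>" using r by simp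
qed (auto simp: coinduced_closed)

text \<open>Under the adjunction, extending \<open>h\<close> amounts to extending \<open>x \<mapsto> h x 1\<close>.\<close>

lemma ext_orth_coinduced:
  assumes X: "X \<in> LMod U A" and orth: "ext_orth U R (res X) C"
  shows "ext_orth U A X (coind C)"
  unfolding ext_orth_def
proof (intro ballI allI impI)
  fix M g h assume M: "M \<in> LMod U A" "mod_epi A M g X" and h: "h \<in> mod_hom A (kernel_module M X g) (coind C)"
  note lM = LModD(1)[OF M(1)] and lX = LModD(1)[OF X]
  interpret M: left_module A M by fact
  interpret X: left_module A X by fact
  have "(\<lambda>x. h x \<one>\<^bsub>A\<^esub>) \<in> mod_hom R (kernel_module (res M) (res X) g) C"
    unfolding kernel_module_restrict_scalars by (rule mod_hom_comp[OF mod_hom_res[OF h] eval_hom])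
  from ext_orthD[OF orth res_LMod[OF M(1)] mod_epi_res[OF M(2)] this]
  obtain k where k: "k \<in> mod_hom R (res M) C" "\<forall>x\<in>carrier M. g x = \<zero>\<^bsub>X\<^esub> \<longrightarrow> k x = h x \<one>\<^bsub>A\<^esub>" by auto
  have t: "transpose M k \<in> mod_hom A M (coind C)" by (rule transpose_hom[OF lM k(1)])
  have "transpose M k x = h x" if x: "x \<in> carrier M" "g x = \<zero>\<^bsub>X\<^esub>" for x
  proof (rule coinduced_eqI)
    show "transpose M k x \<in> carrier (coind C)" by (rule mod_hom_closed[OF t x(1)])
    show hx: "h x \<in> carrier (coind C)" using mod_hom_closed[OF h] x by simp
    fix a assume a: "a \<in> carrier A"
    have "g (a \<odot>\<^bsub>M\<^esub> x) = \<zero>\<^bsub>X\<^esub>" using a x by (simp add: mod_hom_smult[OF mod_epi_hom[OF M(2)]])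
    then have "k (a \<odot>\<^bsub>M\<^esub> x) = h (a \<odot>\<^bsub>M\<^esub> x) \<one>\<^bsub>A\<^esub>" using k(2) a x by (simp add: M.smult_closed)
    also have "\<dots> = h x a" using mod_hom_smult[OF h a, of x] a x by simp
    finally show "transpose M k x a = h x a" using a by (simp add: transpose_def)
  qed
  with t show "\<exists>h'\<in>mod_hom A M (coind C). \<forall>x\<in>carrier M. g x = \<zero>\<^bsub>X\<^esub> \<longrightarrow> h' x = h x" by blast
qed

text \<open>\<open>Ext\<^sup>1\<^sub>R(A, C') = 0\<close> for the kernel \<open>C'\<close> of \<open>g\<close>: maps from \<open>A\<close> to \<open>N\<close> lift to \<open>F\<close>. The lifting is performed on a
  copy \<open>B\<close> of \<open>A\<close> in the universe.\<close>

lemma coind_map_epi: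
  assumes F: "F \<in> LMod U R" and N: "N \<in> LMod U R" and g: "mod_epi R F g N" and K: "kernel_module F N g \<in> \<C>"
  shows "mod_epi A (coind F) (coind_map g) (coind N)"
proof (rule mod_epiI[OF coind_map_hom[OF mod_epi_hom[OF g]]])
  fix t assume t: "t \<in> carrier (coind N)"
  note lF = LModD(1)[OF F] and lN = LModD(1)[OF N] and gh = mod_epi_hom[OF g]
  let ?A = "res (regular_module A)"
  have lA: "left_module R ?A" by (intro left_module_res left_module_regular ring_A)
  obtain B where B: "B \<in> \<F>" "mod_iso R ?A B" using A_in_F unfolding in_class_def by blast
  obtain i j where i: "i \<in> mod_hom R ?A B" and j: "j \<in> mod_hom R B ?A" and ji: "\<forall>x\<in>carrier ?A. j (i x) = x"
    by (rule mod_isoE[OF B(2) lA])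
  note BL = F_LMod[OF B(1)]
  have tj: "(\<lambda>x. t (j x)) \<in> mod_hom R B N" by (rule mod_hom_comp[OF j coinduced_hom[OF t]])
  have id: "mod_epi R B (\<lambda>x. x) B" by (simp add: mod_epi_def mod_hom_id)
  obtain s where s: "s \<in> mod_hom R B F" "\<forall>x\<in>carrier B. g (s x) = t (j x)"
    by (rule lifting[OF LModD(1)[OF BL] F lN g F_C_orth[OF B(1) K] BL id mod_hom_zero_map[OF lF] tj])
      (use mod_hom_zero[OF lF lN gh] mod_hom_zero[OF LModD(1)[OF BL] lN tj] in auto)
  have si: "(\<lambda>x. s (i x)) \<in> mod_hom R ?A F" by (rule mod_hom_comp[OF i s(1)])
  let ?f = "\<lambda>a\<in>carrier A. s (i a)"
  have f: "?f \<in> carrier (coind F)"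
    using mod_hom_closed[OF si] mod_hom_add[OF si] mod_hom_smult[OF si] by (auto simp: coinduced_carrier)
  moreover have "coind_map g ?f = t"
    by (rule coinduced_eqI[OF mod_hom_closed[OF coind_map_hom[OF gh] f] t])
      (use s(2) ji mod_hom_closed[OF i] in \<open>auto simp: coind_map_def\<close>)
  ultimately show "\<exists>f\<in>carrier (coind F). coind_map g f = t" by blast
qed

lemma coind_map_kernel:
  "kernel_module (coind F) (coind N) (coind_map g) = coind (kernel_module F N g)"
proof -
  have "{f \<in> carrier (coind F). coind_map g f = \<zero>\<^bsub>coind N\<^esub>} = carrier (coind (kernel_module F N g))"
    by (auto simp: coinduced_carrier coind_map_def PiE_iff fun_eq_iff split: if_splits)
  then show ?thesis by (simp add: kernel_module_def a_kernel_eq coinduced_def)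
qed

text \<open>Coinduction preserves \<open>\<F>\<close> and turns a special precover into an exact sequence, as its kernel lies in
  \<open>\<C>\<close>; so it carries a resolution by special precovers to a resolution.\<close>

lemma resdim_coinduced:
  assumes "resdim_le n N" "H \<in> LMod U R" "mod_iso R (res (coind N)) H"
  shows "resdim_le n H"
  using assms
proof (induction n arbitrary: N H)
  case 0
  have l: "left_module R (res (coind N))"
    using 0(1) F_LMod LModD(1) by (intro left_module_res left_module_coinduced) auto
  obtain M where M: "M \<in> \<F>" "mod_iso R (res (coind N)) M"
    using coinduced_in_F 0(1) unfolding in_class_def by auto
  have "mod_iso R H M" by (rule mod_iso_trans[OF mod_iso_sym[OF 0(3) l] M(2)])
  then show ?case using F_iso[OF 0(2) _ M(1)] by simp
next
  case (Suc n)
  note NL = resdim_LMod[OF Suc.prems(1)] and HL = Suc.prems(2)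
  note lN = LModD(1)[OF NL] and lH = LModD(1)[OF HL]
  obtain F g where F: "F \<in> \<F>" and g: "mod_epi R F g N" and K: "kernel_module F N g \<in> \<C>"
    by (rule special_precover[OF NL])
  note FL = F_LMod[OF F] and gh = mod_epi_hom[OF g]
  have K': "resdim_le n (kernel_module F N g)" by (rule resdim_kernel_of_cover[OF Suc.prems(1) F g])
  have lCF: "left_module R (res (coind F))" "left_module R (res (coind N))"
    by (intro left_module_res left_module_coinduced LModD(1)[OF FL] lN)+
  obtain M where M: "M \<in> \<F>" "mod_iso R (res (coind F)) M" using coinduced_in_F[OF F] unfolding in_class_def by blast
  obtain i j where i: "i \<in> mod_hom R (res (coind F)) M" and j: "j \<in> mod_hom R M (res (coind F))"
    and ij: "\<forall>x\<in>carrier (res (coind F)). j (i x) = x" "\<forall>y\<in>carrier M. i (j y) = y"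
    by (rule mod_isoE[OF M(2) lCF(1)])
  obtain i' j' where i': "i' \<in> mod_hom R (res (coind N)) H" and j': "j' \<in> mod_hom R H (res (coind N))"
    and ij': "\<forall>x\<in>carrier (res (coind N)). j' (i' x) = x" "\<forall>y\<in>carrier H. i' (j' y) = y"
    by (rule mod_isoE[OF Suc.prems(3) lCF(2)])
  let ?G = "\<lambda>x. i' (coind_map g (j x))"
  have cg: "mod_epi R (res (coind F)) (coind_map g) (res (coind N))"
    by (rule mod_epi_res[OF coind_map_epi[OF FL NL g K]])
  have G: "mod_epi R M ?G H"
    by (rule mod_epi_comp[OF mod_epi_comp[OF mod_epi_iso[OF j i, OF ij(1)] cg] mod_epi_iso[OF i' j', OF ij'(2)]])
  have "mod_iso R (kernel_module (res (coind F)) (res (coind N)) (coind_map g)) (kernel_module M H ?G)"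
  proof (rule mod_iso_kernel[OF i j, OF ij])
    fix x assume x: "x \<in> carrier (res (coind F))"
    have z: "i' \<zero>\<^bsub>res (coind N)\<^esub> = \<zero>\<^bsub>H\<^esub>" "j' \<zero>\<^bsub>H\<^esub> = \<zero>\<^bsub>res (coind N)\<^esub>"
      by (rule mod_hom_zero[OF lCF(2) lH i'], rule mod_hom_zero[OF lH lCF(2) j'])
    have "coind_map g x \<in> carrier (res (coind N))" by (rule mod_hom_closed[OF mod_epi_hom[OF cg] x])
    then show "i' (coind_map g (j (i x))) = \<zero>\<^bsub>H\<^esub> \<longleftrightarrow> coind_map g x = \<zero>\<^bsub>res (coind N)\<^esub>"
      using x ij(1) ij'(1) z by metis
  qed
  then have "mod_iso R (res (coind (kernel_module F N g))) (kernel_module M H ?G)"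
    by (simp add: kernel_module_restrict_scalars coind_map_kernel)
  then have "resdim_le n (kernel_module M H ?G)"
    by (rule Suc.IH[OF K' kernel_LMod[OF F_LMod[OF M(1)] lH mod_epi_hom[OF G]]])
  then show ?case using HL M(1) G by auto
qed

text \<open>The properties of \<open>Q \<rightarrow> N\<close> by which the tower is controlled: the kernel makes the limit cofiltered, the
  factorization through \<open>\<F>\<close> bounds the dimension of the limit of infinitely many steps, and the last clause
  lowers the dimension by one in each of the finitely many steps after the limit.\<close>

definition coinduced_step :: "('a, 'u) module \<Rightarrow> ('a, 'u) module \<Rightarrow> ('u \<Rightarrow> 'u) \<Rightarrow> bool" where
  "coinduced_step N Q q \<longleftrightarrow> N \<in> LMod U A \<and> Q \<in> LMod U A \<and> mod_epi A Q q N \<and>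
     in_class A (coinduced_class U R A \<phi> \<C>) (kernel_module Q N q) \<and>
     (\<exists>F\<in>\<F>. \<exists>u\<in>mod_hom R (res Q) F. \<exists>v\<in>mod_hom R F (res N). \<forall>x\<in>carrier Q. v (u x) = q x) \<and>
     (\<forall>d. resdim_le (Suc d) (res N) \<longrightarrow> resdim_le d (res Q))"

text \<open>\<open>Q\<close> is the pullback of \<open>H(F) \<rightarrow> H(N)\<close> along the unit \<open>\<iota> : N \<rightarrow> H(N)\<close>. The factorization is \<open>Q \<rightarrow> H(F)\<close>,
  followed by evaluation \<open>H(F) \<rightarrow> F\<close>.\<close>

lemma coinduced_step_exists:
  assumes N: "N \<in> LMod U A"
  shows "\<exists>Q q. coinduced_step N Q q"
proof -
  note rN = res_LMod[OF N] and lN = LModD(1)[OF N]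
  note lrN = LModD(1)[OF rN]
  obtain F g where F: "F \<in> \<F>" and g: "mod_epi R F g (res N)" and K: "kernel_module F (res N) g \<in> \<C>"
    by (rule special_precover[OF rN])
  note FL = F_LMod[OF F] and gh = mod_epi_hom[OF g]
  note lF = LModD(1)[OF FL]
  let ?CF = "coind F" and ?CN = "coind (res N)"
  have lCF: "left_module A ?CF" and lCN: "left_module A ?CN"
    by (intro left_module_coinduced lF lrN)+
  define \<iota> where "\<iota> = transpose N (\<lambda>x. x)"
  have \<iota>: "\<iota> \<in> mod_hom A N ?CN" unfolding \<iota>_def by (rule transpose_hom[OF lN mod_hom_id])
  have \<iota>1: "\<iota> x \<one>\<^bsub>A\<^esub> = x" if "x \<in> carrier N" for x unfolding \<iota>_def by (rule transpose_one[OF lN that])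
  have G: "mod_epi A ?CF (coind_map g) ?CN" by (rule coind_map_epi[OF FL rN g K])
  note Gh = mod_epi_hom[OF G]
  obtain Q b q where Q: "Q \<in> LMod U A" and pb: "A.is_pullback Q b q ?CF (coind_map g) N \<iota>"
    by (rule A.pullback_exists[OF lCF small_coinduced[OF FL] lN A.LMod_small[OF N] lCN Gh \<iota>])
  note lQ = LModD(1)[OF Q] and bq = A.pullback_homs[OF pb]
  have q: "mod_epi A Q q N" by (rule A.pullback_epi[OF A.pullback_flip[OF pb] \<iota> G])
  have kL: "kernel_module Q N q \<in> LMod U A" by (rule A.kernel_LMod[OF Q lN bq(2)])
  have "mod_iso A (kernel_module Q N q) (coind (kernel_module F (res N) g))"
    using A.pullback_kernel_iso[OF A.pullback_flip[OF pb] lQ lN lCF lCN \<iota> Gh] by (simp add: coind_map_kernel)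
  then have "kernel_module Q N q \<in> coinduced_class U R A \<phi> \<C>"
    using kL K unfolding coinduced_class_def by blast
  then have ker: "in_class A (coinduced_class U R A \<phi> \<C>) (kernel_module Q N q)"
    unfolding in_class_def using mod_iso_refl by blast
  have fac: "\<exists>F\<in>\<F>. \<exists>u\<in>mod_hom R (res Q) F. \<exists>v\<in>mod_hom R F (res N). \<forall>x\<in>carrier Q. v (u x) = q x"
  proof (intro bexI[OF _ F] bexI[OF _ gh] bexI[OF _ mod_hom_comp[OF mod_hom_res[OF bq(1)] eval_hom]] ballI)
    fix x assume x: "x \<in> carrier Q"
    have "g (b x \<one>\<^bsub>A\<^esub>) = coind_map g (b x) \<one>\<^bsub>A\<^esub>" by (simp add: coind_map_def)
    also have "\<dots> = q x" using A.pullback_comm[OF pb x] \<iota>1 mod_hom_closed[OF bq(2) x] by simp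
    finally show "g (b x \<one>\<^bsub>A\<^esub>) = q x" .
  qed
  have "resdim_le d (res Q)" if d: "resdim_le (Suc d) (res N)" for d
  proof -
    have lrCF: "left_module R (res ?CF)" and lrCN: "left_module R (res ?CN)"
      by (intro left_module_res lCF lCN)+
    obtain M where M: "M \<in> \<F>" "mod_iso R (res ?CF) M" using coinduced_in_F[OF F] unfolding in_class_def by blast
    note ModM = F_LMod[OF M(1)]
    note lM = LModD(1)[OF ModM]
    obtain i j where i: "i \<in> mod_hom R (res ?CF) M" and j: "j \<in> mod_hom R M (res ?CF)"
      and ij: "\<forall>x\<in>carrier (res ?CF). j (i x) = x" "\<forall>y\<in>carrier M. i (j y) = y"
      by (rule mod_isoE[OF M(2) lrCF])
    have sm: "small U (carrier (res ?CN))" using small_coinduced[OF rN] by simp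
    obtain H i' j' where H: "H \<in> LMod U R" and i': "i' \<in> mod_hom R (res ?CN) H" and j': "j' \<in> mod_hom R H (res ?CN)"
      and ij': "\<forall>x\<in>carrier (res ?CN). j' (i' x) = x" "\<forall>y\<in>carrier H. i' (j' y) = y"
      by (rule small_copy[OF lrCN sm])
    note lH = LModD(1)[OF H]
    interpret H: left_module R H by fact
    have "mod_iso R (res ?CN) H" by (rule mod_isoI[OF i' j']) (use ij' in auto)
    then have dH: "resdim_le (Suc d) H" by (rule resdim_coinduced[OF d H])
    let ?e = "\<lambda>y. j' y \<one>\<^bsub>A\<^esub>"
    have e: "?e \<in> mod_hom R H (res N)" by (rule mod_hom_comp[OF j' eval_hom])
    have \<iota>R: "\<iota> \<in> mod_hom R (res N) (res ?CN)" by (rule mod_hom_res[OF \<iota>])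
    have i\<iota>: "(\<lambda>x. i' (\<iota> x)) \<in> mod_hom R (res N) H" by (rule mod_hom_comp[OF \<iota>R i'])
    have ei: "?e (i' (\<iota> x)) = x" if "x \<in> carrier N" for x
      using ij'(1) mod_hom_closed[OF \<iota> that] \<iota>1[OF that] by simp
    have epi_e: "mod_epi R H ?e (res N)"
      by (rule mod_epiI[OF e]) (use ei mod_hom_closed[OF i\<iota>] in auto)
    let ?T = "kernel_module H (res N) ?e"
    have T: "?T \<in> LMod U R" by (rule kernel_LMod[OF H lrN e])
    have dT: "resdim_le (Suc d) ?T" by (rule resdim_kernel[OF dH d epi_e])
    \<comment> \<open>The projection of \<open>H(N)\<close>, or its copy \<open>H\<close>, onto the complement \<open>?T\<close> of \<open>\<iota> N\<close>.\<close>
    let ?\<pi> = "\<lambda>y. y \<ominus>\<^bsub>H\<^esub> i' (\<iota> (?e y))"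
    have \<pi>H: "?\<pi> \<in> mod_hom R H H" by (rule mod_hom_diff[OF lH mod_hom_id mod_hom_comp[OF e i\<iota>]])
    have \<pi>: "?\<pi> \<in> mod_hom R H ?T"
    proof (rule mod_hom_into_kernel[OF \<pi>H])
      interpret rN: left_module R "res N" by fact
      fix y assume y: "y \<in> carrier H"
      note ey = mod_hom_closed[OF e y]
      have "?e (?\<pi> y) = ?e y \<ominus>\<^bsub>res N\<^esub> ?e (i' (\<iota> (?e y)))"
        using y mod_hom_closed[OF i\<iota> ey] by (simp add: mod_hom_minus[OF lH lrN e])
      also have "\<dots> = \<zero>\<^bsub>res N\<^esub>" using ei[of "?e y"] ey rN.minus_self[OF ey] by simp
      finally show "?e (?\<pi> y) = \<zero>\<^bsub>res N\<^esub>" .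
    qed
    have "mod_epi R H ?\<pi> ?T"
    proof (rule mod_epiI[OF \<pi>])
      fix y assume "y \<in> carrier ?T"
      then have "y \<in> carrier H" "?\<pi> y = y"
        using mod_hom_zero[OF lrN lH i\<iota>] by (auto simp del: coinduced_simps)
      then show "\<exists>x\<in>carrier H. ?\<pi> x = y" by blast
    qed
    moreover have "mod_epi R M (\<lambda>x. i' (coind_map g (j x))) H"
      by (rule mod_epi_comp[OF mod_epi_comp[OF mod_epi_iso[OF j i, OF ij(1)] mod_epi_res[OF G]]
          mod_epi_iso[OF i' j', OF ij'(2)]])
    ultimately have s: "mod_epi R M (\<lambda>x. ?\<pi> (i' (coind_map g (j x)))) ?T" (is "mod_epi R M ?s ?T")
      by (rule mod_epi_comp[rotated])
    have dK: "resdim_le d (kernel_module M ?T ?s)" by (rule resdim_kernel_of_cover[OF dT M(1) s])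
    have KM: "kernel_module M ?T ?s \<in> LMod U R"
      by (rule kernel_LMod[OF ModM LModD(1)[OF T] mod_epi_hom[OF s]])
    \<comment> \<open>The kernel of the composite \<open>?s\<close> consists of the maps whose image in \<open>H(N)\<close> lies in \<open>\<iota> N\<close>, as for \<open>Q\<close>.\<close>
    have sz: "?s y = \<zero>\<^bsub>?T\<^esub> \<longleftrightarrow> coind_map g (j y) = \<iota> (coind_map g (j y) \<one>\<^bsub>A\<^esub>)" if y: "y \<in> carrier M" for y
    proof -
      let ?t = "coind_map g (j y)"
      have t: "?t \<in> carrier (res ?CN)"
        by (rule mod_hom_closed[OF mod_hom_comp[OF j mod_hom_res[OF Gh]] y])
      have \<iota>t: "\<iota> (?t \<one>\<^bsub>A\<^esub>) \<in> carrier (res ?CN)"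
        by (rule mod_hom_closed[OF mod_hom_comp[OF eval_hom \<iota>R] t])
      have jt: "j' (i' ?t) = ?t" "j' (i' (\<iota> (?t \<one>\<^bsub>A\<^esub>))) = \<iota> (?t \<one>\<^bsub>A\<^esub>)" using ij'(1) t \<iota>t by blast+
      have "?s y = \<zero>\<^bsub>?T\<^esub> \<longleftrightarrow> i' ?t = i' (\<iota> (?t \<one>\<^bsub>A\<^esub>))"
        using H.minus_eq_zero_iff[OF mod_hom_closed[OF i' t] mod_hom_closed[OF i' \<iota>t]] by (simp add: jt)
      also have "\<dots> \<longleftrightarrow> ?t = \<iota> (?t \<one>\<^bsub>A\<^esub>)" using jt by metis
      finally show ?thesis .
    qed
    have ib: "(\<lambda>x. i (b x)) \<in> mod_hom R (res Q) M" by (rule mod_hom_comp[OF mod_hom_res[OF bq(1)] i])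
    have jib: "j (i (b x)) = b x" if "x \<in> carrier Q" for x using ij(1) mod_hom_closed[OF bq(1) that] by simp
    have ibK: "(\<lambda>x. i (b x)) \<in> mod_hom R (res Q) (kernel_module M ?T ?s)"
    proof (rule mod_hom_into_kernel[OF ib])
      fix x assume x: "x \<in> carrier (res Q)"
      have "coind_map g (j (i (b x))) = \<iota> (q x)" using jib A.pullback_comm[OF pb] x by simp
      moreover from this have "coind_map g (j (i (b x))) \<one>\<^bsub>A\<^esub> = q x"
        using \<iota>1 mod_hom_closed[OF bq(2)] x by simp
      ultimately show "?s (i (b x)) = \<zero>\<^bsub>?T\<^esub>" using sz[OF mod_hom_closed[OF ib x]] by metis
    qed
    have "mod_iso R (res Q) (kernel_module M ?T ?s)"
    proof (rule mod_isoI_inj[OF mod_epiI[OF ibK] left_module_res[OF lQ] LModD(1)[OF KM]])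
      fix y assume "y \<in> carrier (kernel_module M ?T ?s)"
      then have y: "y \<in> carrier M" "?s y = \<zero>\<^bsub>?T\<^esub>" by simp_all
      have jy: "j y \<in> carrier ?CF" using mod_hom_closed[OF j y(1)] by simp
      have "coind_map g (j y) \<one>\<^bsub>A\<^esub> \<in> carrier N"
        using coinduced_closed[OF mod_hom_closed[OF Gh jy]] by simp
      then obtain x where "x \<in> carrier Q" "b x = j y"
        by (rule A.pullback_ex[OF pb jy]) (use sz[OF y(1)] y(2) in blast)
      then show "\<exists>x\<in>carrier (res Q). i (b x) = y" using ij(2) y(1) by (intro bexI[of _ x]) auto
    next
      fix x assume x: "x \<in> carrier (res Q)" and "i (b x) = \<zero>\<^bsub>kernel_module M ?T ?s\<^esub>"
      then have "b x = j \<zero>\<^bsub>M\<^esub>" using jib[of x] by simp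
      then have bx: "b x = \<zero>\<^bsub>?CF\<^esub>" using mod_hom_zero[OF lM lrCF j] by simp
      have "\<iota> (q x) = coind_map g (b x)" using A.pullback_comm[OF pb, of x] x by simp
      also have "\<dots> = \<zero>\<^bsub>?CN\<^esub>" unfolding bx by (rule mod_hom_zero[OF lCF lCN Gh])
      finally have "q x = \<zero>\<^bsub>N\<^esub>" using \<iota>1[of "q x"] mod_hom_closed[OF bq(2)] x by simp
      then show "x = \<zero>\<^bsub>res Q\<^esub>"
        using A.pullback_eqI[OF pb, of x "\<zero>\<^bsub>Q\<^esub>"] x bx mod_hom_zero[OF lQ lCF bq(1)]
          mod_hom_zero[OF lQ lN bq(2)] abelian_monoid.zero_closed[of Q] lQ
        by (simp add: left_module.axioms abelian_group.axioms)
    qed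
    then show ?thesis
      by (rule resdim_iso[OF dK mod_iso_sym[OF _ left_module_res[OF lQ]] res_LMod[OF Q]])
  qed
  then show ?thesis unfolding coinduced_step_def using N Q q ker fac by blast
qed

end

section \<open>Limits of towers and cofiltrations\<close>

text \<open>The composite \<open>G (n + i) \<rightarrow> G n\<close> of maps \<open>g m : G (m + 1) \<rightarrow> G m\<close>.\<close>

primrec descend :: "(nat \<Rightarrow> 'x \<Rightarrow> 'x) \<Rightarrow> nat \<Rightarrow> nat \<Rightarrow> 'x \<Rightarrow> 'x" where
  "descend g n 0 x = x"
| "descend g n (Suc i) x = descend g n i (g (n + i) x)"

lemma descend_hom:
  assumes "\<And>n. g n \<in> mod_hom R (G (Suc n)) (G n)"
  shows "descend g n i \<in> mod_hom R (G (n + i)) (G n)"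
proof (induction i)
  case 0
  have "descend g n 0 = (\<lambda>x. x)" by (simp add: fun_eq_iff)
  then show ?case by (simp add: mod_hom_id)
next
  case (Suc i)
  have "descend g n (Suc i) = (\<lambda>x. descend g n i (g (n + i) x))" by (simp add: fun_eq_iff)
  then show ?case using mod_hom_comp[OF assms[of "n + i"] Suc] by simp
qed

lemma descend_add: "descend g l i (descend g (l + i) j x) = descend g l (i + j) x"
  by (induction j arbitrary: x) (simp_all add: add.assoc)

lemma descend_cone:
  assumes "\<And>n x. x \<in> carrier L \<Longrightarrow> g n (\<pi> (Suc n) x) = \<pi> n x" "x \<in> carrier L"
  shows "descend g n i (\<pi> (n + i) x) = \<pi> n x"
  using assms by (induction i) auto

context small_modules
begin

definition is_limit ::
  "('r, 'l) module \<Rightarrow> (nat \<Rightarrow> 'l \<Rightarrow> 'x) \<Rightarrow> (nat \<Rightarrow> ('r, 'x) module) \<Rightarrow> (nat \<Rightarrow> 'x \<Rightarrow> 'x) \<Rightarrow> bool" where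
  "is_limit L \<pi> G g \<longleftrightarrow> (\<forall>n. \<pi> n \<in> mod_hom R L (G n)) \<and> (\<forall>n. \<forall>x\<in>carrier L. g n (\<pi> (Suc n) x) = \<pi> n x) \<and>
     (\<forall>x\<in>carrier L. \<forall>y\<in>carrier L. (\<forall>n. \<pi> n x = \<pi> n y) \<longrightarrow> x = y) \<and>
     (\<forall>x. (\<forall>n. x n \<in> carrier (G n) \<and> g n (x (Suc n)) = x n) \<longrightarrow> (\<exists>y\<in>carrier L. \<forall>n. \<pi> n y = x n))"

lemma limit_hom: "is_limit L \<pi> G g \<Longrightarrow> \<pi> n \<in> mod_hom R L (G n)"
  and limit_cone: "\<lbrakk>is_limit L \<pi> G g; x \<in> carrier L\<rbrakk> \<Longrightarrow> g n (\<pi> (Suc n) x) = \<pi> n x"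
  and limit_eqI: "\<lbrakk>is_limit L \<pi> G g; x \<in> carrier L; y \<in> carrier L; \<And>n. \<pi> n x = \<pi> n y\<rbrakk> \<Longrightarrow> x = y"
  by (simp_all add: is_limit_def)

lemma limit_ex:
  assumes "is_limit L \<pi> G g" "\<And>n. x n \<in> carrier (G n)" "\<And>n. g n (x (Suc n)) = x n"
  obtains y where "y \<in> carrier L" "\<forall>n. \<pi> n y = x n"
  using assms unfolding is_limit_def by metis

text \<open>A product of countably many modules of the universe may be too large for it, so the smallness of
  the limit is a hypothesis.\<close>

lemma limit_exists:
  assumes G: "\<And>n. left_module R (G n)" and g: "\<And>n. g n \<in> mod_hom R (G (Suc n)) (G n)"
    and sm: "small U {x. \<forall>n. x n \<in> carrier (G n) \<and> g n (x (Suc n)) = x n}"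
  obtains L \<pi> where "L \<in> LMod U R" "is_limit L \<pi> G g"
proof -
  let ?D = "prod_module UNIV G"
  let ?S = "{x. \<forall>n. x n \<in> carrier (G n) \<and> g n (x (Suc n)) = x n}"
  let ?P = "?D\<lparr>carrier := ?S\<rparr>"
  interpret G: left_module R "G n" for n by (rule G)
  interpret D: left_module R ?D by (rule left_module_prod[OF ring G])
  have P: "left_module R ?P"
    by (rule D.left_module_subset)
      (auto simp: mod_hom_zero[OF G G g] mod_hom_add[OF g] mod_hom_smult[OF g] G.smult_closed)
  have "small U (carrier ?P)" using sm by simp
  from small_copy[OF P this] obtain L h h' where L: "L \<in> LMod U R" and h: "h \<in> mod_hom R ?P L" and
    h': "h' \<in> mod_hom R L ?P" "\<forall>x\<in>carrier ?P. h' (h x) = x" "\<forall>y\<in>carrier L. h (h' y) = y" .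
  have h'S: "h' x \<in> ?S" if "x \<in> carrier L" for x using mod_hom_closed[OF h'(1) that] by simp
  have hS: "h x \<in> carrier L" "h' (h x) = x" if "x \<in> ?S" for x
    using mod_hom_closed[OF h, of x] h'(2) that by simp_all
  have "is_limit L (\<lambda>n x. h' x n) G g"
    unfolding is_limit_def
  proof (intro conjI allI ballI impI)
    fix n
    have "(\<lambda>x. x n) \<in> mod_hom R ?P (G n)" by (auto simp: mod_hom_def)
    then show "(\<lambda>x. h' x n) \<in> mod_hom R L (G n)" by (rule mod_hom_comp[OF h'(1)])
  next
    fix x y assume "x \<in> carrier L" "y \<in> carrier L" "\<forall>n. h' x n = h' y n"
    then show "x = y" using h'(3) by (metis ext)
  next
    fix x assume "\<forall>n. x n \<in> carrier (G n) \<and> g n (x (Suc n)) = x n"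
    then show "\<exists>y\<in>carrier L. \<forall>n. h' y n = x n" using hS[of x] by (intro bexI[of _ "h x"]) auto
  qed (use h'S in auto)
  with L show thesis by (rule that)
qed

text \<open>An \<open>(\<omega> + k)\<close>-cofiltration consists of a tower, its limit, and \<open>k\<close> further steps; its maps are the
  composites of these.\<close>

lemma Cof_omega_plus:
  assumes G: "\<And>n. G n \<in> LMod U R" and G0: "carrier (G 0) = {\<zero>\<^bsub>G 0\<^esub>}"
    and g: "\<And>n. mod_epi R (G (Suc n)) (g n) (G n)"
    and gker: "\<And>n. in_class R \<T> (kernel_module (G (Suc n)) (G n) (g n))"
    and S: "\<And>n. S n \<in> LMod U R" and lim: "is_limit (S 0) \<pi> G g"
    and s: "\<And>n. mod_epi R (S (Suc n)) (s n) (S n)"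
    and sker: "\<And>n. in_class R \<T> (kernel_module (S (Suc n)) (S n) (s n))"
  shows "S k \<in> Cof U R (Omega_plus k) \<T>"
proof -
  note gh = mod_epi_hom[OF g] and sh = mod_epi_hom[OF s]
  define H where "H i = (case i of Fin n \<Rightarrow> G n | Omega_plus n \<Rightarrow> S n)" for i
  define p where "p i j = (case i of Fin m \<Rightarrow> (case j of Fin n \<Rightarrow> descend g n (m - n) | Omega_plus n \<Rightarrow> (\<lambda>x. x))
    | Omega_plus m \<Rightarrow> (case j of Fin n \<Rightarrow> (\<lambda>x. \<pi> n (descend s 0 m x)) | Omega_plus n \<Rightarrow> descend s n (m - n)))"
    for i j
  have H_simps [simp]: "H (Fin n) = G n" "H (Omega_plus n) = S n" for n by (simp_all add: H_def)
  have p_simps [simp]: "p (Fin m) (Fin n) = descend g n (m - n)"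
    "p (Omega_plus m) (Fin n) = (\<lambda>x. \<pi> n (descend s 0 m x))"
    "p (Omega_plus m) (Omega_plus n) = descend s n (m - n)" for m n
    by (simp_all add: p_def)
  have less [simp]: "Fin m < Fin n \<longleftrightarrow> m < n" "Omega_plus m < Omega_plus n \<longleftrightarrow> m < n"
    "Fin m < Omega_plus n" "\<not> Omega_plus m < Fin n" for m n
    by (auto simp: less_ord_2omega_def)
  have osucc: "osucc (Fin n) = Fin (Suc n)" "osucc (Omega_plus n) = Omega_plus (Suc n)" for n
  proof -
    have "Fin (Suc n) \<le> y" if "Fin n < y" for y using that by (cases y) auto
    then show "osucc (Fin n) = Fin (Suc n)" unfolding osucc_def by (intro Least_equality) auto
    have "Omega_plus (Suc n) \<le> y" if "Omega_plus n < y" for y using that by (cases y) auto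
    then show "osucc (Omega_plus n) = Omega_plus (Suc n)" unfolding osucc_def by (intro Least_equality) auto
  qed
  have least: "(LEAST i :: ord_2omega. True) = Fin 0"
  proof (rule Least_equality)
    show "Fin 0 \<le> y" for y by (cases y) auto
  qed simp
  have limit: "limit_ordinal i \<longleftrightarrow> i = Omega_plus 0" for i
  proof
    assume l: "limit_ordinal i"
    show "i = Omega_plus 0"
    proof (cases i)
      case (Fin n)
      show ?thesis
      proof (cases n)
        case 0
        have "\<not> j < Fin 0" for j by (cases j) auto
        then show ?thesis using l Fin 0 by (auto simp: limit_ordinal_def)
      next
        case (Suc m)
        then have "Fin m < i" using Fin by simp
        then obtain l where "Fin m < l" "l < i" using l unfolding limit_ordinal_def by blast
        then show ?thesis by (cases l) (auto simp: Fin Suc)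
      qed
    next
      case (Omega_plus n)
      show ?thesis
      proof (cases n)
        case (Suc m)
        then have "Omega_plus m < i" using Omega_plus by simp
        then obtain l where "Omega_plus m < l" "l < i" using l unfolding limit_ordinal_def by blast
        then show ?thesis by (cases l) (auto simp: Omega_plus Suc)
      qed (simp add: Omega_plus)
    qed
  next
    assume i: "i = Omega_plus 0"
    have "\<exists>l. j < l \<and> l < Omega_plus 0" if "j < Omega_plus 0" for j
      using that by (cases j) (auto intro!: exI[of _ "Fin (Suc _)"])
    moreover have "Fin 0 < Omega_plus 0" by simp
    ultimately show "limit_ordinal i" unfolding limit_ordinal_def i by blast
  qed
  have dg: "descend g n i \<in> mod_hom R (G (n + i)) (G n)" for n i by (rule descend_hom[of g R G, OF gh])
  have ds: "descend s n i \<in> mod_hom R (S (n + i)) (S n)" for n i by (rule descend_hom[of s R S, OF sh])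
  note lh = limit_hom[OF lim] and lc = limit_cone[OF lim]
  have p: "p i j \<in> mod_hom R (H i) (H j)" if "j < i" for i j
    using that dg[of _ "_ - _"] ds[of _ "_ - _"] mod_hom_comp[OF ds[of 0] lh]
    by (cases i; cases j) (auto simp: less_imp_le, (metis le_add_diff_inverse less_imp_le)+)
  have pp: "p j l (p i j x) = p i l x" if "j < i" "l < j" "x \<in> carrier (H i)" for i j l x
  proof (cases j)
    case (Fin b)
    with that(2) obtain c where l: "l = Fin c" "c < b" by (cases l) auto
    show ?thesis
    proof (cases i)
      case (Fin a)
      then show ?thesis using that l \<open>j = Fin b\<close> descend_add[of g c "b - c" "a - b" x] by auto
    next
      case (Omega_plus a)
      have "descend s 0 a x \<in> carrier (S 0)" using mod_hom_closed[OF ds[of 0 a]] that(3) Omega_plus by simp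
      then show ?thesis
        using descend_cone[of "S 0" g \<pi> "descend s 0 a x" c "b - c"] lc l \<open>j = Fin b\<close> Omega_plus by simp
    qed
  next
    case (Omega_plus b)
    with that(1) obtain a where i: "i = Omega_plus a" "b < a" by (cases i) auto
    show ?thesis
    proof (cases l)
      case (Fin c)
      then show ?thesis using that i \<open>j = Omega_plus b\<close> descend_add[of s 0 b "a - b" x] by auto
    next
      case (Omega_plus c)
      then show ?thesis using that i \<open>j = Omega_plus b\<close> descend_add[of s c "b - c" "a - b" x] by auto
    qed
  qed
  have bij: "bij_betw (\<lambda>x. \<lambda>j\<in>{..<Omega_plus 0}. p (Omega_plus 0) j x) (carrier (H (Omega_plus 0)))
      (inverse_limit H p (Omega_plus 0))" (is "bij_betw ?f _ _")
    unfolding bij_betw_def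
  proof
    show "inj_on ?f (carrier (H (Omega_plus 0)))"
    proof (rule inj_onI)
      fix x y assume xy: "x \<in> carrier (H (Omega_plus 0))" "y \<in> carrier (H (Omega_plus 0))" and eq: "?f x = ?f y"
      have "\<pi> n x = \<pi> n y" for n using fun_cong[OF eq, of "Fin n"] by simp
      then show "x = y" using limit_eqI[OF lim] xy by simp
    qed
    show "?f ` carrier (H (Omega_plus 0)) = inverse_limit H p (Omega_plus 0)"
    proof
      show "?f ` carrier (H (Omega_plus 0)) \<subseteq> inverse_limit H p (Omega_plus 0)"
        using mod_hom_closed[OF p] pp by (auto simp: inverse_limit_def split: if_splits)
      show "inverse_limit H p (Omega_plus 0) \<subseteq> ?f ` carrier (H (Omega_plus 0))"
      proof
        fix y assume y: "y \<in> inverse_limit H p (Omega_plus 0)"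
        have c: "y (Fin n) \<in> carrier (G n)" for n
          using y PiE_mem[of y "{..<Omega_plus 0}" "\<lambda>j. carrier (H j)" "Fin n"] by (simp add: inverse_limit_def)
        have "p (Fin (Suc n)) (Fin n) (y (Fin (Suc n))) = y (Fin n)" for n
          using y unfolding inverse_limit_def by (auto simp del: p_simps)
        then have "g n (y (Fin (Suc n))) = y (Fin n)" for n by simp
        then obtain z where z: "z \<in> carrier (S 0)" "\<forall>n. \<pi> n z = y (Fin n)"
          using limit_ex[OF lim, of "\<lambda>n. y (Fin n)"] c by blast
        have "?f z j = y j" for j
          using z(2) y by (cases j) (auto simp: inverse_limit_def PiE_iff extensional_def)
        then have "y = ?f z" by auto
        then show "y \<in> ?f ` carrier (H (Omega_plus 0))" using z(1) by auto
      qed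
    qed
  qed
  have HL: "H i \<in> LMod U R" for i using G S by (cases i) auto
  have surj: "p (osucc i) i ` carrier (H (osucc i)) = carrier (H i)" for i
    using g s by (cases i) (auto simp: osucc mod_epi_def)
  have ker: "in_class R \<T> (kernel_module (H (osucc i)) (H i) (p (osucc i) i))" for i
  proof (cases i)
    case (Fin n)
    have "p (osucc i) i = g n" by (simp add: fun_eq_iff osucc Fin)
    then show ?thesis using gker[of n] by (simp add: osucc Fin)
  next
    case (Omega_plus n)
    have "p (osucc i) i = s n" by (simp add: fun_eq_iff osucc Omega_plus)
    then show ?thesis using sker[of n] by (simp add: osucc Omega_plus)
  qed
  have "cofiltration U R (Omega_plus k) (S k) H p"
    unfolding cofiltration_def Let_def least using HL p pp G0 bij surj limit by simp
  then show ?thesis unfolding Cof_def using S ker by blast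
qed

text \<open>In the pullback of a tower along a map into its base, the fibre products \<open>E\<close> and \<open>E'\<close> over two consecutive
  stages form a pullback square with these stages, and therefore the step \<open>E' \<rightarrow> E\<close> has the kernel of \<open>q\<close>.\<close>

lemma pullback_along_step:
  assumes pb: "is_pullback E a b H f Q \<tau>" and pb': "is_pullback E' a' b' H f Q' (\<lambda>x. \<tau> (q x))"
    and E: "left_module R E" and E': "left_module R E'" and H: "left_module R H"
    and Q: "left_module R Q" and Q': "left_module R Q'" and q: "mod_epi R Q' q Q"
  obtains e where "mod_epi R E' e E" "\<forall>x\<in>carrier E'. a (e x) = a' x" "\<forall>x\<in>carrier E'. b (e x) = q (b' x)"
    "mod_iso R (kernel_module E' E e) (kernel_module Q' Q q)"
proof -
  note ab = pullback_homs[OF pb] and ab' = pullback_homs[OF pb'] and qh = mod_epi_hom[OF q]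
  interpret E: left_module R E by fact
  interpret H: left_module R H by fact
  interpret Q: left_module R Q by fact
  interpret E': left_module R E' by fact
  obtain e where e: "e \<in> mod_hom R E' E" "\<forall>x\<in>carrier E'. a (e x) = a' x" "\<forall>x\<in>carrier E'. b (e x) = q (b' x)"
    by (rule pullback_universal[OF pb E E' ab'(1) mod_hom_comp[OF ab'(2) qh]])
      (use pullback_comm[OF pb'] in auto)
  have epi: "mod_epi R E' e E"
  proof (rule mod_epiI[OF e(1)])
    fix x assume x: "x \<in> carrier E"
    obtain y where y: "y \<in> carrier Q'" "q y = b x" by (rule mod_epiE[OF q mod_hom_closed[OF ab(2) x]])
    obtain z where z: "z \<in> carrier E'" "a' z = a x" "b' z = y"
      by (rule pullback_ex[OF pb' mod_hom_closed[OF ab(1) x] y(1)]) (use pullback_comm[OF pb x] y(2) in auto)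
    have "e z = x" by (rule pullback_eqI[OF pb mod_hom_closed[OF e(1) z(1)] x]) (use e z y in auto)
    then show "\<exists>z\<in>carrier E'. e z = x" using z(1) by blast
  qed
  have ker: "e x = \<zero>\<^bsub>E\<^esub> \<longleftrightarrow> a' x = \<zero>\<^bsub>H\<^esub> \<and> q (b' x) = \<zero>\<^bsub>Q\<^esub>" if x: "x \<in> carrier E'" for x
  proof
    assume "e x = \<zero>\<^bsub>E\<^esub>"
    then show "a' x = \<zero>\<^bsub>H\<^esub> \<and> q (b' x) = \<zero>\<^bsub>Q\<^esub>"
      using e(2,3) x mod_hom_zero[OF E H ab(1)] mod_hom_zero[OF E Q ab(2)] by metis
  next
    assume "a' x = \<zero>\<^bsub>H\<^esub> \<and> q (b' x) = \<zero>\<^bsub>Q\<^esub>"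
    then show "e x = \<zero>\<^bsub>E\<^esub>"
      using e(2,3) x mod_hom_zero[OF E H ab(1)] mod_hom_zero[OF E Q ab(2)]
      by (intro pullback_eqI[OF pb mod_hom_closed[OF e(1) x]]) auto
  qed
  have \<tau>0: "\<tau> (q y) = f \<zero>\<^bsub>H\<^esub>" if "q y = \<zero>\<^bsub>Q\<^esub>" for y
    using pullback_comm[OF pb, of "\<zero>\<^bsub>E\<^esub>"] mod_hom_zero[OF E H ab(1)] mod_hom_zero[OF E Q ab(2)] that by simp
  have "mod_iso R (kernel_module E' E e) (kernel_module Q' Q q)"
  proof (rule mod_isoI_inj)
    show "mod_epi R (kernel_module E' E e) b' (kernel_module Q' Q q)"
    proof (rule mod_epiI)
      show "b' \<in> mod_hom R (kernel_module E' E e) (kernel_module Q' Q q)"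
        using ker by (intro mod_hom_into_kernel mod_hom_on_kernel ab'(2)) auto
      fix y assume "y \<in> carrier (kernel_module Q' Q q)"
      then have y: "y \<in> carrier Q'" "q y = \<zero>\<^bsub>Q\<^esub>" by auto
      obtain x where "x \<in> carrier E'" "a' x = \<zero>\<^bsub>H\<^esub>" "b' x = y"
        by (rule pullback_ex[OF pb' H.zero_closed y(1)]) (use \<tau>0[OF y(2)] in auto)
      then show "\<exists>x\<in>carrier (kernel_module E' E e). b' x = y" using ker y(2) by auto
    qed
    show "left_module R (kernel_module E' E e)" "left_module R (kernel_module Q' Q q)"
      by (rule left_module_kernel[OF E' E e(1)], rule left_module_kernel[OF Q' Q qh])
    fix x assume "x \<in> carrier (kernel_module E' E e)" "b' x = \<zero>\<^bsub>kernel_module Q' Q q\<^esub>"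
    then show "x = \<zero>\<^bsub>kernel_module E' E e\<^esub>"
      using ker[of x] mod_hom_zero[OF E' H ab'(1)] mod_hom_zero[OF E' Q' ab'(2)]
      by (auto intro!: pullback_eqI[OF pb'])
  qed
  with epi e show thesis by (intro that) auto
qed

text \<open>Fibre products commute with limits of towers.\<close>

lemma pullback_limit:
  assumes lim: "is_limit L \<pi> Q q" and E: "\<And>n. left_module R (E n)" and EL: "left_module R EL"
    and pb: "\<And>n. is_pullback (E n) (a n) (b n) H f (Q n) (\<tau> n)"
    and pbL: "is_pullback EL a' b' H f L \<sigma>"
    and \<tau>: "\<And>n x. x \<in> carrier (Q (Suc n)) \<Longrightarrow> \<tau> (Suc n) x = \<tau> n (q n x)"
    and \<sigma>: "\<And>n x. x \<in> carrier L \<Longrightarrow> \<tau> n (\<pi> n x) = \<sigma> x"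
    and e: "\<And>n. e n \<in> mod_hom R (E (Suc n)) (E n)"
    and ae: "\<And>n x. x \<in> carrier (E (Suc n)) \<Longrightarrow> a n (e n x) = a (Suc n) x"
    and be: "\<And>n x. x \<in> carrier (E (Suc n)) \<Longrightarrow> b n (e n x) = q n (b (Suc n) x)"
  obtains \<rho> where "is_limit EL \<rho> E e"
proof -
  note ab' = pullback_homs[OF pbL] and lh = limit_hom[OF lim]
  have "\<exists>\<rho>\<in>mod_hom R EL (E n). \<forall>x\<in>carrier EL. a n (\<rho> x) = a' x \<and> b n (\<rho> x) = \<pi> n (b' x)" for n
  proof -
    have "f (a' x) = \<tau> n (\<pi> n (b' x))" if "x \<in> carrier EL" for x
      using pullback_comm[OF pbL that] \<sigma>[OF mod_hom_closed[OF ab'(2) that]] by simp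
    from pullback_universal[OF pb E EL ab'(1) mod_hom_comp[OF ab'(2) lh] this]
    obtain \<rho> where "\<rho> \<in> mod_hom R EL (E n)" "\<forall>x\<in>carrier EL. a n (\<rho> x) = a' x"
      "\<forall>x\<in>carrier EL. b n (\<rho> x) = \<pi> n (b' x)" .
    then show ?thesis by blast
  qed
  then obtain \<rho> where \<rho>: "\<And>n. \<rho> n \<in> mod_hom R EL (E n)"
    "\<And>n x. x \<in> carrier EL \<Longrightarrow> a n (\<rho> n x) = a' x" "\<And>n x. x \<in> carrier EL \<Longrightarrow> b n (\<rho> n x) = \<pi> n (b' x)"
    by metis
  have "is_limit EL \<rho> E e"
    unfolding is_limit_def
  proof (intro conjI allI ballI impI \<rho>(1))
    fix n x assume x: "x \<in> carrier EL"
    note c = mod_hom_closed[OF \<rho>(1) x]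
    show "e n (\<rho> (Suc n) x) = \<rho> n x"
      by (rule pullback_eqI[OF pb[of n] mod_hom_closed[OF e c] c])
        (simp_all add: ae be c \<rho>(2,3)[OF x] limit_cone[OF lim mod_hom_closed[OF ab'(2) x]])
  next
    fix x y assume x: "x \<in> carrier EL" and y: "y \<in> carrier EL" and eq: "\<forall>n. \<rho> n x = \<rho> n y"
    show "x = y"
    proof (rule pullback_eqI[OF pbL x y])
      show "a' x = a' y" using \<rho>(2)[OF x, of 0] \<rho>(2)[OF y, of 0] eq by simp
      have "\<pi> n (b' x) = \<pi> n (b' y)" for n using \<rho>(3)[OF x, of n] \<rho>(3)[OF y, of n] eq by simp
      then show "b' x = b' y"
        by (rule limit_eqI[OF lim mod_hom_closed[OF ab'(2) x] mod_hom_closed[OF ab'(2) y]])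
    qed
  next
    fix x assume x: "\<forall>n. x n \<in> carrier (E n) \<and> e n (x (Suc n)) = x n"
    note ab = pullback_homs[OF pb]
    have c: "b n (x n) \<in> carrier (Q n)" for n using mod_hom_closed[OF ab(2)] x by blast
    have a0: "a n (x n) = a 0 (x 0)" for n
    proof (induction n)
      case (Suc n)
      then show ?case using ae[of "x (Suc n)" n] x by metis
    qed simp
    have qb: "q n (b (Suc n) (x (Suc n))) = b n (x n)" for n using be[of "x (Suc n)" n] x by metis
    obtain y where y: "y \<in> carrier L" "\<forall>n. \<pi> n y = b n (x n)"
      by (rule limit_ex[OF lim, of "\<lambda>n. b n (x n)"]) (use c qb in auto)
    have "f (a 0 (x 0)) = \<sigma> y"
      using pullback_comm[OF pb, of "x 0" 0] x y \<sigma>[OF y(1), of 0] by metis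
    moreover have "a 0 (x 0) \<in> carrier H" using mod_hom_closed[OF ab(1)] x by blast
    ultimately obtain z where z: "z \<in> carrier EL" "a' z = a 0 (x 0)" "b' z = y"
      using pullback_ex[OF pbL _ y(1)] by metis
    have "\<rho> n z = x n" for n
      by (rule pullback_eqI[OF pb[of n] mod_hom_closed[OF \<rho>(1) z(1)]])
        (use x a0[of n] y(2) z \<rho>(2,3)[OF z(1)] in auto)
    then show "\<exists>y\<in>carrier EL. \<forall>n. \<rho> n y = x n" using z(1) by blast
  qed
  then show thesis by (rule that)
qed

text \<open>A cofiltration starts with the zero module; prepending it shifts the tower by one, and \<open>1 + \<omega> = \<omega>\<close>.\<close>

lemma limit_prepend_zero:
  assumes lim: "is_limit L \<pi> E e" and L: "left_module R L" and Z: "left_module R Z" and Z0: "carrier Z = {\<zero>\<^bsub>Z\<^esub>}"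
  shows "is_limit L (case_nat (\<lambda>_. \<zero>\<^bsub>Z\<^esub>) \<pi>) (case_nat Z E) (case_nat (\<lambda>_. \<zero>\<^bsub>Z\<^esub>) e)"
  unfolding is_limit_def
proof (intro conjI allI ballI impI)
  fix n show "case_nat (\<lambda>_. \<zero>\<^bsub>Z\<^esub>) \<pi> n \<in> mod_hom R L (case n of 0 \<Rightarrow> Z | Suc m \<Rightarrow> E m)"
    using limit_hom[OF lim] mod_hom_zero_map[OF Z] by (cases n) auto
next
  fix n x assume "x \<in> carrier L"
  then show "(case n of 0 \<Rightarrow> \<lambda>_. \<zero>\<^bsub>Z\<^esub> | Suc m \<Rightarrow> e m) ((case Suc n of 0 \<Rightarrow> \<lambda>_. \<zero>\<^bsub>Z\<^esub> | Suc m \<Rightarrow> \<pi> m) x) =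
      (case n of 0 \<Rightarrow> \<lambda>_. \<zero>\<^bsub>Z\<^esub> | Suc m \<Rightarrow> \<pi> m) x"
    using limit_cone[OF lim] by (cases n) auto
next
  fix x y assume "x \<in> carrier L" "y \<in> carrier L"
    and eq: "\<forall>n. (case n of 0 \<Rightarrow> \<lambda>_. \<zero>\<^bsub>Z\<^esub> | Suc m \<Rightarrow> \<pi> m) x = (case n of 0 \<Rightarrow> \<lambda>_. \<zero>\<^bsub>Z\<^esub> | Suc m \<Rightarrow> \<pi> m) y"
  moreover have "\<pi> n x = \<pi> n y" for n using eq[rule_format, of "Suc n"] by simp
  ultimately show "x = y" using limit_eqI[OF lim] by blast
next
  fix x assume x: "\<forall>n. x n \<in> carrier (case n of 0 \<Rightarrow> Z | Suc m \<Rightarrow> E m) \<and>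
      (case n of 0 \<Rightarrow> \<lambda>_. \<zero>\<^bsub>Z\<^esub> | Suc m \<Rightarrow> e m) (x (Suc n)) = x n"
  have "x (Suc n) \<in> carrier (E n) \<and> e n (x (Suc (Suc n))) = x (Suc n)" for n
    using x[rule_format, of "Suc n"] by simp
  then obtain y where y: "y \<in> carrier L" "\<forall>n. \<pi> n y = x (Suc n)"
    using limit_ex[OF lim, of "\<lambda>n. x (Suc n)"] by blast
  have "(case n of 0 \<Rightarrow> \<lambda>_. \<zero>\<^bsub>Z\<^esub> | Suc m \<Rightarrow> \<pi> m) y = x n" for n
    using x[rule_format, of 0] y(2) by (cases n) auto
  then show "\<exists>y\<in>carrier L. \<forall>n. (case n of 0 \<Rightarrow> \<lambda>_. \<zero>\<^bsub>Z\<^esub> | Suc m \<Rightarrow> \<pi> m) y = x n" using y(1) by blast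
qed

end

section \<open>The tower of coinduced covers\<close>

locale change_of_rings_finite_dimension = change_of_rings U R \<F> \<C> A \<phi>
  for U :: "'u set set" and R :: "'r ring" and \<F> \<C> and A :: "'a ring" and \<phi> +
  fixes k :: nat
  assumes product_dim: "\<And>F :: nat \<Rightarrow> ('r, 'u) module. (\<And>i. F i \<in> \<F>) \<Longrightarrow>
     res_dim_le R \<F> k (prod_module UNIV F)"
begin

lemma coinduced_stepD:
  assumes "coinduced_step N Q q"
  shows "N \<in> LMod U A" "Q \<in> LMod U A" "mod_epi A Q q N"
    "in_class A (coinduced_class U R A \<phi> \<C>) (kernel_module Q N q)"
    "resdim_le (Suc d) (res N) \<Longrightarrow> resdim_le d (res Q)"
  using assms by (simp_all add: coinduced_step_def)

lemma coinduced_tower_exists: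
  assumes N: "N \<in> LMod U A"
  obtains Q q where "Q 0 = N" "\<forall>n. coinduced_step (Q n) (Q (Suc n)) (q n)"
proof -
  have "\<forall>N\<in>LMod U A. \<exists>Q q. coinduced_step N Q q" using coinduced_step_exists by blast
  then obtain S s where S: "\<And>N. N \<in> LMod U A \<Longrightarrow> coinduced_step N (S N) (s N)" by metis
  define Q where "Q n = (S ^^ n) N" for n
  have "Q n \<in> LMod U A" for n
    unfolding Q_def using N coinduced_stepD(2)[OF S] by (induction n) auto
  then have "coinduced_step (Q n) (Q (Suc n)) (s (Q n))" for n using S by (simp add: Q_def)
  moreover have "Q 0 = N" by (simp add: Q_def)
  ultimately show thesis by (intro that[of Q "\<lambda>n. s (Q n)"]) auto
qed

text \<open>The universe need not be closed under countable unions, hence a priori not under products of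
  countable families. But a resolution of the product exhibits it as an image of a small module.\<close>

lemma small_product:
  assumes "\<And>i. F i \<in> \<F>"
  shows "small U (carrier (prod_module (UNIV :: nat set) F))"
proof -
  obtain P d e where res: "resolution R P d e (prod_module UNIV F)" and P: "P 0 \<in> \<F>"
    using product_dim[of F] assms unfolding res_dim_le_def by blast
  have "e ` carrier (P 0) = carrier (prod_module UNIV F)" using res by (simp add: resolution_def)
  then show ?thesis using small_image[OF LMod_small[OF F_LMod[OF P]], of e] by metis
qed

text \<open>With \<open>Q (n + 1) \<rightarrow> F n \<rightarrow> Q n\<close>, given by \<open>u n\<close> and \<open>v n\<close>, the limit of the \<open>Q n\<close> is identified with the
  kernel of \<open>D = 1 - w\<close> on the product of the \<open>F n\<close>, where \<open>w\<close> is the shift along the composites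
  \<open>u n \<circ> v (n + 1)\<close>: a sequence \<open>y\<close> in the limit corresponds to \<open>n \<mapsto> u n (y (n + 1))\<close>. This also
  shows that the limit is small.\<close>

lemma coinduced_tower_limit:
  assumes step: "\<And>n. coinduced_step (Q n) (Q (Suc n)) (q n)"
  obtains L \<pi> where "L \<in> LMod U A" "A.is_limit L \<pi> Q q" "resdim_le k (res L)"
proof -
  note QL = coinduced_stepD(1)[OF step] and q = coinduced_stepD(3)[OF step]
  note lQ = LModD(1)[OF QL] and qh = mod_epi_hom[OF q]
  note lrQ = left_module_res[OF lQ] and rqh = mod_hom_res[OF qh]
  have "\<exists>F u v. F \<in> \<F> \<and> u \<in> mod_hom R (res (Q (Suc n))) F \<and> v \<in> mod_hom R F (res (Q n)) \<and>
      (\<forall>x\<in>carrier (Q (Suc n)). v (u x) = q n x)" for n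
    using step[of n] unfolding coinduced_step_def by blast
  then obtain F u v where F: "\<And>n. F n \<in> \<F>" and u: "\<And>n. u n \<in> mod_hom R (res (Q (Suc n))) (F n)"
    and v: "\<And>n. v n \<in> mod_hom R (F n) (res (Q n))"
    and vu: "\<And>n x. x \<in> carrier (Q (Suc n)) \<Longrightarrow> v n (u n x) = q n x" by metis
  note lF = LModD(1)[OF F_LMod[OF F]]
  interpret F: left_module R "F n" for n by (rule lF)
  interpret Q: left_module A "Q n" for n by (rule lQ)
  have uc [simp]: "u n x \<in> carrier (F n)" if "x \<in> carrier (Q (Suc n))" for n x
    using mod_hom_closed[OF u] that by simp
  have vc [simp]: "v n x \<in> carrier (Q n)" if "x \<in> carrier (F n)" for n x
    using mod_hom_closed[OF v] that by simp
  let ?P = "prod_module (UNIV :: nat set) F"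
  have lP: "left_module R ?P" by (rule left_module_prod[OF ring lF])
  interpret P: left_module R ?P by (rule lP)
  have sP: "small U (carrier ?P)" by (rule small_product[OF F])
  have mem: "x \<in> (\<Pi>\<^sub>E n\<in>UNIV. carrier (F n)) \<longleftrightarrow> (\<forall>n. x n \<in> carrier (F n))" for x by (auto simp: PiE_UNIV_domain)
  have vw: "v n (u n (v (Suc n) x)) = q n (v (Suc n) x)" if "x \<in> carrier (F (Suc n))" for n x
    using vu that by simp
  let ?S = "{y. \<forall>n. y n \<in> carrier (Q n) \<and> q n (y (Suc n)) = y n}"
  have "small U ?S"
  proof (rule small_inj[OF sP, where f = "\<lambda>y n. u n (y (Suc n))"])
    show "inj_on (\<lambda>y n. u n (y (Suc n))) ?S"
    proof (rule inj_onI)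
      fix y z assume y: "y \<in> ?S" and z: "z \<in> ?S" and eq: "(\<lambda>n. u n (y (Suc n))) = (\<lambda>n. u n (z (Suc n)))"
      have "y n = v n (u n (y (Suc n)))" "z n = v n (u n (z (Suc n)))" for n
        using y z vu[of "y (Suc n)" n] vu[of "z (Suc n)" n] by auto
      then show "y = z" using eq by (metis ext)
    qed
  qed (auto simp: mem)
  then obtain L \<pi> where L: "L \<in> LMod U A" and lim: "A.is_limit L \<pi> Q q"
    by (rule A.limit_exists[of Q q, OF lQ qh])
  note lL = LModD(1)[OF L] and \<pi> = A.limit_hom[OF lim]
  define D where "D x = (\<lambda>n. x n \<ominus>\<^bsub>F n\<^esub> u n (v (Suc n) (x (Suc n))))" for x
  have Dh: "D \<in> mod_hom R ?P ?P"
  proof -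
    have c: "(\<lambda>x. x n \<ominus>\<^bsub>F n\<^esub> u n (v (Suc n) (x (Suc n)))) \<in> mod_hom R ?P (F n)" for n
    proof -
      have p: "(\<lambda>x. x m) \<in> mod_hom R ?P (F m)" for m by (rule mod_homI) (auto simp: mem)
      show ?thesis by (rule mod_hom_diff[OF lF p mod_hom_comp[OF mod_hom_comp[OF p v] u]])
    qed
    show ?thesis
    proof (rule mod_homI)
      show "D x \<in> carrier ?P" if "x \<in> carrier ?P" for x
        using mod_hom_closed[OF c that] unfolding prod_module_simps mem D_def by blast
      show "D (x \<oplus>\<^bsub>?P\<^esub> y) = D x \<oplus>\<^bsub>?P\<^esub> D y" if "x \<in> carrier ?P" "y \<in> carrier ?P" for x y
        using mod_hom_add[OF c that] by (simp add: D_def fun_eq_iff)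
      show "D (r \<odot>\<^bsub>?P\<^esub> x) = r \<odot>\<^bsub>?P\<^esub> D x" if "r \<in> carrier R" "x \<in> carrier ?P" for r x
        using mod_hom_smult[OF c that] by (simp add: D_def fun_eq_iff)
    qed
  qed
  have epi_D: "mod_epi R ?P D ?P"
  proof (rule mod_epiI[OF Dh])
    fix z assume "z \<in> carrier ?P"
    then have z: "z n \<in> carrier (F n)" for n by (simp add: mem)
    have "\<exists>y'. y' \<in> carrier (Q (Suc n)) \<and> q n y' = y \<ominus>\<^bsub>Q n\<^esub> v n (z n)" if "y \<in> carrier (Q n)" for n y
    proof -
      have "y \<ominus>\<^bsub>Q n\<^esub> v n (z n) \<in> carrier (Q n)" using that z by simp
      then show ?thesis using mod_epiE[OF q] by metis
    qed
    \<comment> \<open>A solution of \<open>D x = z\<close> is \<open>x n = z n + u n (y (n + 1))\<close>, provided that \<open>y n\<close> is the image of \<open>x n\<close> in \<open>Q n\<close>;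
      this is a recursive condition on \<open>y\<close>, which can be met as the maps \<open>q n\<close> are surjective.\<close>
    then have "\<exists>y. \<forall>n. y n \<in> carrier (Q n) \<and> q n (y (Suc n)) = y n \<ominus>\<^bsub>Q n\<^esub> v n (z n)"
      by (intro dependent_nat_choice) auto
    then obtain y where y: "\<And>n. y n \<in> carrier (Q n)" "\<And>n. q n (y (Suc n)) = y n \<ominus>\<^bsub>Q n\<^esub> v n (z n)"
      by blast
    define x where "x n = z n \<oplus>\<^bsub>F n\<^esub> u n (y (Suc n))" for n
    have vx: "v n (x n) = y n" for n
    proof -
      have "v n (x n) = v n (z n) \<oplus>\<^bsub>Q n\<^esub> v n (u n (y (Suc n)))"
        using mod_hom_add[OF v[of n], of "z n" "u n (y (Suc n))"] z y(1) by (simp add: x_def)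
      also have "\<dots> = y n" using vu[OF y(1)] y z by (simp add: Q.add_minus_cancel)
      finally show ?thesis .
    qed
    have "D x n = z n" for n
      using z[of n] y(1)[of "Suc n"] vx[of "Suc n"]
      by (simp add: D_def) (simp add: x_def F.minus_eq F.a_assoc F.r_neg)
    moreover have "x \<in> carrier ?P" using z y(1) by (simp add: mem x_def)
    ultimately show "\<exists>x\<in>carrier ?P. D x = z" by (metis ext)
  qed
  have D0: "D x = \<zero>\<^bsub>?P\<^esub> \<longleftrightarrow> (\<forall>n. x n = u n (v (Suc n) (x (Suc n))))" if "x \<in> carrier ?P" for x
    using that by (simp add: D_def fun_eq_iff mem F.minus_eq_zero_iff)
  let ?h = "\<lambda>y n. u n (\<pi> (Suc n) y)"
  have \<pi>c [simp]: "\<pi> n y \<in> carrier (Q n)" if "y \<in> carrier L" for n y using mod_hom_closed[OF \<pi>] that .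
  have vh: "v n (?h y n) = \<pi> n y" if "y \<in> carrier L" for n y
    using that vu A.limit_cone[OF lim] by simp
  have h: "?h \<in> mod_hom R (res L) (kernel_module ?P ?P D)"
  proof (rule mod_hom_into_kernel)
    have c: "(\<lambda>y. u n (\<pi> (Suc n) y)) \<in> mod_hom R (res L) (F n)" for n
      by (rule mod_hom_comp[OF mod_hom_res[OF \<pi>] u])
    show "?h \<in> mod_hom R (res L) ?P"
      by (rule mod_homI)
        (use mod_hom_closed[OF c] mod_hom_add[OF c] mod_hom_smult[OF c] in \<open>auto simp: mem fun_eq_iff\<close>)
    fix y assume "y \<in> carrier (res L)"
    then show "D (?h y) = \<zero>\<^bsub>?P\<^esub>" using vh by (subst D0) (auto simp: mem)
  qed
  have iso: "mod_iso R (res L) (kernel_module ?P ?P D)"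
  proof (rule mod_isoI_inj[OF mod_epiI[OF h] left_module_res[OF lL] left_module_kernel[OF lP lP Dh]])
    fix x assume "x \<in> carrier (kernel_module ?P ?P D)"
    then have x: "x \<in> carrier ?P" "\<And>n. x n = u n (v (Suc n) (x (Suc n)))" using D0 by auto
    have xc: "x n \<in> carrier (F n)" for n using x(1) by (simp add: mem)
    have qv: "q n (v (Suc n) (x (Suc n))) = v n (x n)" for n using vw[OF xc] x(2)[of n] by metis
    obtain y where "y \<in> carrier L" "\<forall>n. \<pi> n y = v n (x n)"
      by (rule A.limit_ex[OF lim, of "\<lambda>n. v n (x n)"]) (use xc qv in auto)
    moreover from this have "?h y n = x n" for n using x(2)[of n] by metis
    ultimately show "\<exists>y\<in>carrier (res L). ?h y = x" by (intro bexI[of _ y] ext) auto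
  next
    fix y assume y: "y \<in> carrier (res L)" and "?h y = \<zero>\<^bsub>kernel_module ?P ?P D\<^esub>"
    then have "?h y n = \<zero>\<^bsub>F n\<^esub>" for n by (simp add: fun_eq_iff)
    then have "\<pi> n y = \<pi> n \<zero>\<^bsub>L\<^esub>" for n
      using vh[of y n] y mod_hom_zero[OF lF lrQ v] mod_hom_zero[OF lL lQ \<pi>] by simp
    then show "y = \<zero>\<^bsub>res L\<^esub>"
      using A.limit_eqI[OF lim, of y "\<zero>\<^bsub>L\<^esub>"] y left_module_zero_closed[OF lL] by simp
  qed
  obtain M i j where M: "M \<in> LMod U R" and i: "i \<in> mod_hom R ?P M" and j: "j \<in> mod_hom R M ?P"
    and ij: "\<forall>x\<in>carrier ?P. j (i x) = x" "\<forall>y\<in>carrier M. i (j y) = y"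
    by (rule small_copy[OF lP sP])
  note lM = LModD(1)[OF M]
  have "mod_iso R ?P M" by (rule mod_isoI[OF i j]) (use ij in auto)
  then have dM: "resdim_le k M" by (rule resdim_of_res_dim_le[OF lP product_dim[OF F] _ M])
  let ?E = "\<lambda>x. i (D (j x))"
  have E: "mod_epi R M ?E M"
    by (rule mod_epi_comp[OF mod_epi_comp[OF mod_epi_iso[OF j i, OF ij(1)] epi_D] mod_epi_iso[OF i j, OF ij(2)]])
  have KM: "kernel_module M M ?E \<in> LMod U R" by (rule kernel_LMod[OF M lM mod_epi_hom[OF E]])
  have "mod_iso R (kernel_module ?P ?P D) (kernel_module M M ?E)"
  proof (rule mod_iso_kernel[OF i j, OF ij])
    fix x assume x: "x \<in> carrier ?P"
    have "D x \<in> carrier ?P" by (rule mod_hom_closed[OF Dh x])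
    then show "i (D (j (i x))) = \<zero>\<^bsub>M\<^esub> \<longleftrightarrow> D x = \<zero>\<^bsub>?P\<^esub>"
      using ij(1) x mod_hom_zero[OF lP lM i] mod_hom_zero[OF lM lP j] by metis
  qed
  then have "mod_iso R (res L) (kernel_module M M ?E)" by (rule mod_iso_trans[OF iso])
  then have "resdim_le k (res L)"
    using resdim_iso[OF resdim_kernel[OF dM dM E] mod_iso_sym res_LMod[OF L]] left_module_res[OF lL] by blast
  with L lim show thesis by (rule that)
qed

text \<open>The fibre products of \<open>H\<close> with the stages of the tower form a cofiltration; its bottom factor is the
  fibre product with \<open>Q 0 = N\<close>, which is \<open>H\<close> itself.\<close>

lemma special_cover_exists:
  assumes N: "N \<in> LMod U A" and H: "H \<in> coinduced_class U R A \<phi> \<C>" and f: "f \<in> mod_hom A H N"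
  obtains Q \<tau> E a b where "Q \<in> underlying_in U A \<phi> \<F>" "mod_epi A Q \<tau> N"
    "E \<in> Cof U A (Omega_plus k) (coinduced_class U R A \<phi> \<C>)" "A.is_pullback E a b H f Q \<tau>"
proof -
  have HL: "H \<in> LMod U A" using H by (simp add: coinduced_class_def)
  note lH = LModD(1)[OF HL] and lN = LModD(1)[OF N]
  obtain Q q where Q0: "Q 0 = N" and Q': "\<forall>n. coinduced_step (Q n) (Q (Suc n)) (q n)"
    by (rule coinduced_tower_exists[OF N])
  note Q = Q'[rule_format]
  obtain L \<pi> where L: "L \<in> LMod U A" and lim: "A.is_limit L \<pi> Q q" and dL: "resdim_le k (res L)"
    by (rule coinduced_tower_limit[of Q q, OF Q])
  obtain S s where S0: "S 0 = L" and S': "\<forall>n. coinduced_step (S n) (S (Suc n)) (s n)"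
    by (rule coinduced_tower_exists[OF L])
  note S = S'[rule_format]
  note QL = coinduced_stepD(1)[OF Q] and SL = coinduced_stepD(1)[OF S]
  note lQ = LModD(1)[OF QL] and lS = LModD(1)[OF SL]
  note q = coinduced_stepD(3)[OF Q] and s = coinduced_stepD(3)[OF S]
  have "resdim_le (k - n) (res (S n))" if "n \<le> k" for n
    using that
  proof (induction n)
    case 0
    then show ?case using dL S0 by simp
  next
    case (Suc n)
    then have "k - n = Suc (k - Suc n)" by simp
    then show ?case using Suc coinduced_stepD(5)[OF S] by simp
  qed
  from this[of k] have Sk: "S k \<in> underlying_in U A \<phi> \<F>"
    using SL by (simp add: underlying_in_def)
  define \<tau> where "\<tau> n = descend q 0 n" for n
  define \<sigma> where "\<sigma> n x = \<pi> 0 (descend s 0 n x)" for n x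
  have \<tau>_simps: "\<tau> 0 x = x" "\<tau> (Suc n) x = \<tau> n (q n x)" for n x by (simp_all add: \<tau>_def)
  have \<sigma>_simps: "\<sigma> 0 x = \<pi> 0 x" "\<sigma> (Suc n) x = \<sigma> n (s n x)" for n x by (simp_all add: \<sigma>_def)
  have \<tau>: "\<tau> n \<in> mod_hom A (Q n) N" for n
    using descend_hom[of q A Q 0 n, OF mod_epi_hom[OF q]] by (simp add: \<tau>_def Q0)
  have \<pi>0: "mod_epi A L (\<pi> 0) N"
  proof (rule mod_epiI)
    show "\<pi> 0 \<in> mod_hom A L N" using A.limit_hom[OF lim, of 0] Q0 by simp
    fix y assume y: "y \<in> carrier N"
    have "\<exists>x. x \<in> carrier (Q (Suc n)) \<and> q n x = z" if "z \<in> carrier (Q n)" for n z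
      using mod_epiE[OF q that] by metis
    then have "\<exists>x. \<forall>n. (x n \<in> carrier (Q n) \<and> (n = 0 \<longrightarrow> x n = y)) \<and> q n (x (Suc n)) = x n"
      using y Q0 by (intro dependent_nat_choice) auto
    then obtain x where x: "\<And>n. x n \<in> carrier (Q n)" "x 0 = y" "\<And>n. q n (x (Suc n)) = x n" by blast
    obtain z where "z \<in> carrier L" "\<forall>n. \<pi> n z = x n" by (rule A.limit_ex[OF lim x(1,3)])
    then show "\<exists>z\<in>carrier L. \<pi> 0 z = y" using x(2) by blast
  qed
  have \<sigma>: "mod_epi A (S n) (\<sigma> n) N" for n
  proof (induction n)
    case 0
    have "\<sigma> 0 = \<pi> 0" by (simp add: fun_eq_iff \<sigma>_simps)
    then show ?case using \<pi>0 S0 by simp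
  next
    case (Suc n)
    have "\<sigma> (Suc n) = (\<lambda>x. \<sigma> n (s n x))" by (simp add: fun_eq_iff \<sigma>_simps)
    then show ?case using mod_epi_comp[OF s Suc] by simp
  qed
  have "\<exists>E a b. E \<in> LMod U A \<and> A.is_pullback E a b H f (Q n) (\<tau> n)" for n
    using A.pullback_exists[OF lH A.LMod_small[OF HL] lQ A.LMod_small[OF QL] lN f \<tau>] by metis
  then obtain E a b where E: "\<And>n. E n \<in> LMod U A" and pb: "\<And>n. A.is_pullback (E n) (a n) (b n) H f (Q n) (\<tau> n)"
    by metis
  have "\<exists>E a b. E \<in> LMod U A \<and> A.is_pullback E a b H f (S n) (\<sigma> n)" for n
    using A.pullback_exists[OF lH A.LMod_small[OF HL] lS A.LMod_small[OF SL] lN f mod_epi_hom[OF \<sigma>]] by metis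
  then obtain E' a' b' where E': "\<And>n. E' n \<in> LMod U A"
    and pb': "\<And>n. A.is_pullback (E' n) (a' n) (b' n) H f (S n) (\<sigma> n)"
    by metis
  note lE = LModD(1)[OF E] and lE' = LModD(1)[OF E']
  have in_iso: "in_class A \<T> M" if "mod_iso A M M'" "in_class A \<T> M'" for \<T> and M M' :: "('a, 'u) module"
    using that mod_iso_trans unfolding in_class_def by blast
  have "\<exists>e. mod_epi A (E (Suc n)) e (E n) \<and> (\<forall>x\<in>carrier (E (Suc n)). a n (e x) = a (Suc n) x) \<and>
      (\<forall>x\<in>carrier (E (Suc n)). b n (e x) = q n (b (Suc n) x)) \<and>
      in_class A (coinduced_class U R A \<phi> \<C>) (kernel_module (E (Suc n)) (E n) e)" for n
  proof -
    have "\<tau> (Suc n) = (\<lambda>x. \<tau> n (q n x))" by (simp add: fun_eq_iff \<tau>_simps)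
    with pb[of "Suc n"] have pS: "A.is_pullback (E (Suc n)) (a (Suc n)) (b (Suc n)) H f (Q (Suc n)) (\<lambda>x. \<tau> n (q n x))"
      by simp
    show ?thesis
      by (rule A.pullback_along_step[OF pb pS lE lE lH lQ lQ q]) (use in_iso coinduced_stepD(4)[OF Q] in blast)
  qed
  then obtain e where e: "\<And>n. mod_epi A (E (Suc n)) (e n) (E n)"
    and ae: "\<And>n x. x \<in> carrier (E (Suc n)) \<Longrightarrow> a n (e n x) = a (Suc n) x"
    and be: "\<And>n x. x \<in> carrier (E (Suc n)) \<Longrightarrow> b n (e n x) = q n (b (Suc n) x)"
    and ek: "\<And>n. in_class A (coinduced_class U R A \<phi> \<C>) (kernel_module (E (Suc n)) (E n) (e n))" by metis
  have "\<exists>e. mod_epi A (E' (Suc n)) e (E' n) \<and>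
      in_class A (coinduced_class U R A \<phi> \<C>) (kernel_module (E' (Suc n)) (E' n) e)" for n
  proof -
    have "\<sigma> (Suc n) = (\<lambda>x. \<sigma> n (s n x))" by (simp add: fun_eq_iff \<sigma>_simps)
    with pb'[of "Suc n"] have pS: "A.is_pullback (E' (Suc n)) (a' (Suc n)) (b' (Suc n)) H f (S (Suc n)) (\<lambda>x. \<sigma> n (s n x))"
      by simp
    show ?thesis
      by (rule A.pullback_along_step[OF pb' pS lE' lE' lH lS lS s]) (use in_iso coinduced_stepD(4)[OF S] in blast)
  qed
  then obtain e' where e': "\<And>n. mod_epi A (E' (Suc n)) (e' n) (E' n)"
    and ek': "\<And>n. in_class A (coinduced_class U R A \<phi> \<C>) (kernel_module (E' (Suc n)) (E' n) (e' n))" by metis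
  have \<tau>\<pi>: "\<tau> n (\<pi> n x) = \<sigma> 0 x" if "x \<in> carrier L" for n x
    using descend_cone[of L q \<pi> x 0 n] A.limit_cone[OF lim] that by (simp add: \<tau>_def \<sigma>_simps)
  have pb0: "A.is_pullback (E' 0) (a' 0) (b' 0) H f L (\<sigma> 0)" using pb'[of 0] S0 by simp
  obtain \<rho> where \<rho>: "A.is_limit (E' 0) \<rho> E e"
    by (rule A.pullback_limit[where E = E and a = a and b = b and \<tau> = \<tau> and e = e,
          OF lim lE lE' pb pb0 \<tau>_simps(2) \<tau>\<pi> mod_epi_hom[OF e] ae be])
  let ?Z = "kernel_module H H (\<lambda>x. x)"
  have Z: "?Z \<in> LMod U A" by (rule A.kernel_LMod[OF HL lH mod_hom_id])
  interpret H: left_module A H by (rule lH)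
  have Z0: "carrier ?Z = {\<zero>\<^bsub>?Z\<^esub>}" by auto
  let ?G = "case_nat ?Z E" and ?g = "case_nat (\<lambda>_. \<zero>\<^bsub>?Z\<^esub>) e"
  have lim': "A.is_limit (E' 0) (case_nat (\<lambda>_. \<zero>\<^bsub>?Z\<^esub>) \<rho>) ?G ?g"
    by (rule A.limit_prepend_zero[OF \<rho> lE' LModD(1)[OF Z] Z0])
  have G: "?G n \<in> LMod U A" for n using E Z by (cases n) auto
  have g: "mod_epi A (?G (Suc n)) (?g n) (?G n)" for n
  proof (cases n)
    case 0
    have "mod_epi A (E 0) (\<lambda>_. \<zero>\<^bsub>?Z\<^esub>) ?Z"
      by (rule mod_epiI[OF mod_hom_zero_map[OF LModD(1)[OF Z]]])
        (use Z0 left_module_zero_closed[OF lE, of 0] in auto)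
    then show ?thesis using 0 by simp
  next
    case (Suc m)
    then show ?thesis using e[of m] by simp
  qed
  have gk: "in_class A (coinduced_class U R A \<phi> \<C>) (kernel_module (?G (Suc n)) (?G n) (?g n))" for n
  proof (cases n)
    case 0
    let ?K = "kernel_module (E 0) ?Z (\<lambda>_. \<zero>\<^bsub>?Z\<^esub>)"
    note a0 = A.pullback_homs(1)[OF pb[of 0]] and b0 = A.pullback_homs(2)[OF pb[of 0]]
    have K: "left_module A ?K" by (rule left_module_kernel[OF lE LModD(1)[OF Z] mod_hom_zero_map[OF LModD(1)[OF Z]]])
    have "mod_iso A ?K H"
    proof (rule mod_isoI_inj[OF _ K lH])
      have "mod_epi A (E 0) (a 0) H"
      proof (rule mod_epiI[OF a0])
        fix y assume y: "y \<in> carrier H"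
        have "f y \<in> carrier (Q 0)" using mod_hom_closed[OF f y] Q0 by simp
        then show "\<exists>x\<in>carrier (E 0). a 0 x = y"
          using A.pullback_ex[OF pb[of 0] y, of "f y"] \<tau>_simps(1) by metis
      qed
      then show "mod_epi A ?K (a 0) H" by (auto simp: mod_epi_def mod_hom_on_kernel)
      fix x assume "x \<in> carrier ?K" and ax: "a 0 x = \<zero>\<^bsub>H\<^esub>"
      then have x: "x \<in> carrier (E 0)" by simp
      have "b 0 x = f (a 0 x)" using A.pullback_comm[OF pb[of 0] x] \<tau>_simps(1) by simp
      then have "b 0 x = \<zero>\<^bsub>Q 0\<^esub>" using ax mod_hom_zero[OF lH lN f] Q0 by simp
      then show "x = \<zero>\<^bsub>?K\<^esub>"
        using A.pullback_eqI[OF pb[of 0] x, of "\<zero>\<^bsub>E 0\<^esub>"] ax mod_hom_zero[OF lE lH a0] mod_hom_zero[OF lE lQ b0]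
          left_module_zero_closed[OF lE, of 0] by simp
    qed
    then show ?thesis using H 0 unfolding in_class_def by auto
  next
    case (Suc m)
    then show ?thesis using ek[of m] by simp
  qed
  have "E' k \<in> Cof U A (Omega_plus k) (coinduced_class U R A \<phi> \<C>)"
    by (rule A.Cof_omega_plus[OF G _ g gk E' lim' e' ek']) (use Z0 in simp)
  then show thesis using that Sk \<sigma>[of k] pb'[of k] by blast
qed

section \<open>The cotorsion pair over the larger ring\<close>

abbreviation \<F>\<^sub>A :: "('a, 'u) module set" where
  "\<F>\<^sub>A \<equiv> underlying_in U A \<phi> \<F>"

abbreviation Cof\<^sub>A :: "('a, 'u) module set" where
  "Cof\<^sub>A \<equiv> Cof U A (Omega_plus k) (coinduced_class U R A \<phi> \<C>)"

abbreviation \<C>\<^sub>A :: "('a, 'u) module set" where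
  "\<C>\<^sub>A \<equiv> summands U A Cof\<^sub>A"

lemma FA_LMod: "X \<in> \<F>\<^sub>A \<Longrightarrow> X \<in> LMod U A"
  by (simp add: underlying_in_def)

lemma FA_kernel:
  assumes X: "X \<in> \<F>\<^sub>A" and Y: "Y \<in> \<F>\<^sub>A" and g: "mod_epi A X g Y"
  shows "kernel_module X Y g \<in> \<F>\<^sub>A"
proof -
  have "kernel_module (res X) (res Y) g \<in> \<F>"
    using X Y by (intro F_kernel mod_epi_res[OF g]) (auto simp: underlying_in_def)
  then show ?thesis
    using A.kernel_LMod[OF FA_LMod[OF X] LModD(1)[OF FA_LMod[OF Y]] mod_epi_hom[OF g]]
    by (simp add: underlying_in_def kernel_module_restrict_scalars)
qed

lemma FA_Cof_orth:
  assumes X: "X \<in> \<F>\<^sub>A" and N: "N \<in> Cof\<^sub>A"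
  shows "ext_orth U A X N"
proof (rule A.ext_orth_Cof[OF FA_LMod[OF X] N])
  fix T assume "T \<in> coinduced_class U R A \<phi> \<C>"
  then obtain C where T: "T \<in> LMod U A" and C: "C \<in> \<C>" "mod_iso A T (coind C)"
    unfolding coinduced_class_def by blast
  have "ext_orth U R (res X) C" using X C(1) F_C_orth by (simp add: underlying_in_def)
  then show "ext_orth U A X T"
    using ext_orth_iso_right[OF ext_orth_coinduced[OF FA_LMod[OF X]] C(2) LModD(1)[OF T]] by blast
qed

lemma FA_CA_orth:
  assumes X: "X \<in> \<F>\<^sub>A" and Y: "Y \<in> \<C>\<^sub>A"
  shows "ext_orth U A X Y"
proof -
  obtain N E where YL: "Y \<in> LMod U A" and N: "N \<in> LMod U A" and E: "E \<in> Cof\<^sub>A" "mod_iso A (direct_sum Y N) E"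
    using Y unfolding summands_def in_class_def by blast
  note lY = LModD(1)[OF YL] and lN = LModD(1)[OF N]
  interpret Y: left_module A Y by (rule lY)
  interpret N: left_module A N by (rule lN)
  have "ext_orth U A X (direct_sum Y N)"
    by (rule ext_orth_iso_right[OF FA_Cof_orth[OF X E(1)] E(2) left_module_direct_sum[OF lY lN]])
  moreover have "(\<lambda>y. (y, \<zero>\<^bsub>N\<^esub>)) \<in> mod_hom A Y (direct_sum Y N)" "fst \<in> mod_hom A (direct_sum Y N) Y"
    by (auto simp: mod_hom_def)
  ultimately show ?thesis by (rule ext_orth_retract_right) simp
qed

text \<open>A retract is a direct summand, with the kernel of the retraction as complement.\<close>

lemma retract_of_Cof_in_CA:
  assumes Y: "Y \<in> LMod U A" and E: "E \<in> Cof\<^sub>A" and s: "s \<in> mod_hom A Y E" and r: "r \<in> mod_hom A E Y"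
    and rs: "\<And>y. y \<in> carrier Y \<Longrightarrow> r (s y) = y"
  shows "Y \<in> \<C>\<^sub>A"
proof -
  have EL: "E \<in> LMod U A" using E by (simp add: Cof_def)
  note lY = LModD(1)[OF Y] and lE = LModD(1)[OF EL]
  interpret Y: left_module A Y by (rule lY)
  interpret E: left_module A E by (rule lE)
  let ?K = "kernel_module E Y r"
  have K: "?K \<in> LMod U A" by (rule A.kernel_LMod[OF EL lY r])
  note sc = mod_hom_closed[OF s] and rc = mod_hom_closed[OF r]
  let ?D = "direct_sum Y ?K"
  let ?h = "\<lambda>z. s (fst z) \<oplus>\<^bsub>E\<^esub> snd z"
  have "fst \<in> mod_hom A ?D Y" "snd \<in> mod_hom A ?D E" by (auto simp: mod_hom_def)
  then have h: "?h \<in> mod_hom A ?D E" using mod_hom_sum[OF lE mod_hom_comp[OF _ s]] by blast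
  have "mod_iso A ?D E"
  proof (rule mod_isoI_inj[OF mod_epiI[OF h] left_module_direct_sum[OF lY LModD(1)[OF K]] lE])
    fix e assume e: "e \<in> carrier E"
    have "r (e \<ominus>\<^bsub>E\<^esub> s (r e)) = \<zero>\<^bsub>Y\<^esub>" using e rs rc sc by (simp add: mod_hom_minus[OF lE lY r])
    then show "\<exists>z\<in>carrier ?D. ?h z = e"
      using e rc sc by (intro bexI[of _ "(r e, e \<ominus>\<^bsub>E\<^esub> s (r e))"]) (auto simp: E.add_minus_cancel)
  next
    fix z assume "z \<in> carrier ?D" and eq: "?h z = \<zero>\<^bsub>E\<^esub>"
    then obtain y x where z: "z = (y, x)" "y \<in> carrier Y" "x \<in> carrier E" "r x = \<zero>\<^bsub>Y\<^esub>" by auto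
    have "r (?h z) = y" using z rs sc by (simp add: mod_hom_add[OF r])
    then have "y = \<zero>\<^bsub>Y\<^esub>" using eq mod_hom_zero[OF lE lY r] by simp
    then show "z = \<zero>\<^bsub>?D\<^esub>" using eq z mod_hom_zero[OF lY lE s] by simp
  qed
  then show ?thesis unfolding summands_def in_class_def using Y K E by blast
qed

lemma Cof_in_CA: "E \<in> Cof\<^sub>A \<Longrightarrow> E \<in> \<C>\<^sub>A"
  using retract_of_Cof_in_CA[OF _ _ mod_hom_id mod_hom_id, of E] by (simp add: Cof_def)

lemma coinduced_copy:
  assumes C: "C \<in> \<C>"
  obtains H i j where "H \<in> coinduced_class U R A \<phi> \<C>" "i \<in> mod_hom A (coind C) H" "j \<in> mod_hom A H (coind C)"
    "\<forall>x\<in>carrier (coind C). j (i x) = x" "\<forall>y\<in>carrier H. i (j y) = y"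
proof -
  note CL = C_LMod[OF C]
  obtain H i j where H: "H \<in> LMod U A" and i: "i \<in> mod_hom A (coind C) H" and j: "j \<in> mod_hom A H (coind C)"
    and ij: "\<forall>x\<in>carrier (coind C). j (i x) = x" "\<forall>y\<in>carrier H. i (j y) = y"
    by (rule A.small_copy[OF left_module_coinduced[OF LModD(1)[OF CL]] small_coinduced[OF CL]])
  have "mod_iso A H (coind C)" by (rule mod_isoI[OF j i]) (use ij in auto)
  then have "H \<in> coinduced_class U R A \<phi> \<C>" unfolding coinduced_class_def using H C by blast
  then show thesis using i j ij by (rule that)
qed

lemma zero_module_in_C:
  obtains Z where "Z \<in> \<C>" "carrier Z = {\<zero>\<^bsub>Z\<^esub>}"
proof -
  obtain B where "B \<in> \<F>" using A_in_F unfolding in_class_def by blast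
  then have B: "B \<in> LMod U R" by (rule F_LMod)
  interpret B: left_module R B by (rule LModD(1)[OF B])
  let ?Z = "kernel_module B B (\<lambda>x. x)"
  have Z: "?Z \<in> LMod U R" by (rule kernel_LMod[OF B B.left_module_axioms mod_hom_id])
  have Z0: "carrier ?Z = {\<zero>\<^bsub>?Z\<^esub>}" by auto
  have "ext_orth U R X ?Z" for X :: "('r, 'u) module"
    unfolding ext_orth_def
  proof (intro ballI allI impI)
    fix M g h assume h: "h \<in> mod_hom R (kernel_module M X g) ?Z"
    have "h x = \<zero>\<^bsub>?Z\<^esub>" if "x \<in> carrier M" "g x = \<zero>\<^bsub>X\<^esub>" for x
      using mod_hom_closed[OF h, of x] that Z0 by simp
    then show "\<exists>h'\<in>mod_hom R M ?Z. \<forall>x\<in>carrier M. g x = \<zero>\<^bsub>X\<^esub> \<longrightarrow> h' x = h x"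
      using mod_hom_zero_map[OF LModD(1)[OF Z]] by (intro bexI[of _ "\<lambda>_. \<zero>\<^bsub>?Z\<^esub>"]) auto
  qed
  then have "?Z \<in> \<C>" using Z by (simp add: C_iff)
  then show thesis using Z0 by (rule that)
qed

text \<open>The zero module is coinduced from zero, and the fibre product with it is the kernel of \<open>\<tau>\<close>.\<close>

lemma FA_precover:
  assumes N: "N \<in> LMod U A"
  shows "\<exists>E\<in>Cof\<^sub>A. \<exists>Q\<in>\<F>\<^sub>A. \<exists>b \<tau>. short_exact A E b Q \<tau> N"
proof -
  note lN = LModD(1)[OF N]
  obtain Z where Z: "Z \<in> \<C>" "carrier Z = {\<zero>\<^bsub>Z\<^esub>}" by (rule zero_module_in_C)
  obtain H i j where H: "H \<in> coinduced_class U R A \<phi> \<C>" and i: "i \<in> mod_hom A (coind Z) H"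
    and j: "j \<in> mod_hom A H (coind Z)" and ij: "\<forall>y\<in>carrier H. i (j y) = y"
    by (rule coinduced_copy[OF Z(1)])
  have HL: "H \<in> LMod U A" using H by (simp add: coinduced_class_def)
  note lH = LModD(1)[OF HL] and lZ = LModD(1)[OF C_LMod[OF Z(1)]]
  have lCZ: "left_module A (coind Z)" by (rule left_module_coinduced[OF lZ])
  have H0: "y = \<zero>\<^bsub>H\<^esub>" if y: "y \<in> carrier H" for y
  proof -
    have "j y = \<zero>\<^bsub>coind Z\<^esub>"
    proof (rule coinduced_eqI[OF mod_hom_closed[OF j y] left_module_zero_closed[OF lCZ]])
      fix a assume a: "a \<in> carrier A"
      then show "j y a = \<zero>\<^bsub>coind Z\<^esub> a" using coinduced_closed[OF mod_hom_closed[OF j y] a] Z(2) by simp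
    qed
    then show ?thesis using ij y mod_hom_zero[OF lCZ lH i] by metis
  qed
  obtain Q \<tau> E a b where Q: "Q \<in> \<F>\<^sub>A" and \<tau>: "mod_epi A Q \<tau> N" and E: "E \<in> Cof\<^sub>A"
    and pb: "A.is_pullback E a b H (\<lambda>_. \<zero>\<^bsub>N\<^esub>) Q \<tau>"
    by (rule special_cover_exists[OF N H mod_hom_zero_map[OF lN]])
  note ab = A.pullback_homs[OF pb]
  have "inj_on b (carrier E)"
  proof (rule inj_onI)
    fix x y assume xy: "x \<in> carrier E" "y \<in> carrier E" "b x = b y"
    moreover from this have "a x = a y" using H0 mod_hom_closed[OF ab(1)] by metis
    ultimately show "x = y" using A.pullback_eqI[OF pb] by blast
  qed
  moreover have "b ` carrier E = a_kernel Q N \<tau>"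
  proof
    show "b ` carrier E \<subseteq> a_kernel Q N \<tau>"
      using A.pullback_comm[OF pb] mod_hom_closed[OF ab(2)] by (auto simp: a_kernel_eq)
    show "a_kernel Q N \<tau> \<subseteq> b ` carrier E"
    proof
      fix y assume "y \<in> a_kernel Q N \<tau>"
      then have y: "y \<in> carrier Q" "\<zero>\<^bsub>N\<^esub> = \<tau> y" by (auto simp: a_kernel_eq)
      obtain x where "x \<in> carrier E" "b x = y"
        by (rule A.pullback_ex[OF pb left_module_zero_closed[OF lH] y]) 
      then show "y \<in> b ` carrier E" by blast
    qed
  qed
  ultimately have "short_exact A E b Q \<tau> N"
    using ab(2) \<tau> by (simp add: short_exact_def mod_epi_def)
  then show ?thesis using E Q by blast
qed

text \<open>Salce's argument: embed \<open>M\<close> in some \<open>H\<close> coinduced from \<open>\<C>\<close> and pull back an approximation of \<open>H/M\<close> along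
  \<open>H \<rightarrow> H/M\<close>; the kernel of the projection \<open>E \<rightarrow> Q\<close> is \<open>M\<close>. The embedding is the transpose of an \<open>R\<close>-linear
  embedding into a member of \<open>\<C>\<close>, and is injective as that can be recovered by evaluation at \<open>1\<close>.\<close>

lemma FA_preenvelope:
  assumes M: "M \<in> LMod U A"
  shows "\<exists>E\<in>Cof\<^sub>A. \<exists>Q\<in>\<F>\<^sub>A. \<exists>u b. short_exact A M u E b Q"
proof -
  note lM = LModD(1)[OF M]
  obtain C f where C: "C \<in> \<C>" and f: "f \<in> mod_hom R (res M) C" and inj_f: "inj_on f (carrier (res M))"
    by (rule embedding_into_C[OF res_LMod[OF M]])
  obtain H i j where H: "H \<in> coinduced_class U R A \<phi> \<C>" and i: "i \<in> mod_hom A (coind C) H"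
    and ji: "\<forall>x\<in>carrier (coind C). j (i x) = x"
    by (rule coinduced_copy[OF C])
  have HL: "H \<in> LMod U A" using H by (simp add: coinduced_class_def)
  note lH = LModD(1)[OF HL]
  have t: "transpose M f \<in> mod_hom A M (coind C)" by (rule transpose_hom[OF lM f])
  let ?m = "\<lambda>x. i (transpose M f x)"
  have m: "?m \<in> mod_hom A M H" by (rule mod_hom_comp[OF t i])
  have inj_m: "inj_on ?m (carrier M)"
  proof (rule inj_onI)
    fix x y assume xy: "x \<in> carrier M" "y \<in> carrier M" "?m x = ?m y"
    then have "transpose M f x = transpose M f y" using ji mod_hom_closed[OF t] by metis
    then have "f x = f y" using transpose_one[OF lM] xy by metis
    then show "x = y" using inj_onD[OF inj_f] xy by simp
  qed
  obtain N g where N: "N \<in> LMod U A" and g: "mod_epi A H g N" and ker_g: "a_kernel H N g = ?m ` carrier M"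
    by (rule A.quotient_exists[OF M HL m])
  note gh = mod_epi_hom[OF g] and lN = LModD(1)[OF N]
  obtain Q \<tau> E a b where Q: "Q \<in> \<F>\<^sub>A" and \<tau>: "mod_epi A Q \<tau> N" and E: "E \<in> Cof\<^sub>A"
    and pb: "A.is_pullback E a b H g Q \<tau>"
    by (rule special_cover_exists[OF N H gh])
  note ab = A.pullback_homs[OF pb]
  have lE: "left_module A E" and lQ: "left_module A Q" using E FA_LMod[OF Q] LModD(1) by (auto simp: Cof_def)
  have b: "mod_epi A E b Q" by (rule A.pullback_epi[OF A.pullback_flip[OF pb] mod_epi_hom[OF \<tau>] g])
  have gm: "g (?m x) = \<zero>\<^bsub>N\<^esub>" if "x \<in> carrier M" for x
  proof -
    have "?m x \<in> a_kernel H N g" using ker_g that by blast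
    then show ?thesis by (simp add: a_kernel_eq)
  qed
  obtain u where u: "u \<in> mod_hom A M E" "\<forall>x\<in>carrier M. a (u x) = ?m x" "\<forall>x\<in>carrier M. b (u x) = \<zero>\<^bsub>Q\<^esub>"
    by (rule A.pullback_universal[OF pb lE lM m mod_hom_zero_map[OF lQ]])
      (use gm mod_hom_zero[OF lQ lN mod_epi_hom[OF \<tau>]] in auto)
  have "inj_on u (carrier M)"
  proof (rule inj_onI)
    fix x y assume "x \<in> carrier M" "y \<in> carrier M" "u x = u y"
    then show "x = y" using inj_onD[OF inj_m] u(2) by metis
  qed
  moreover have "u ` carrier M = a_kernel E Q b"
  proof
    show "u ` carrier M \<subseteq> a_kernel E Q b" using u(3) mod_hom_closed[OF u(1)] by (auto simp: a_kernel_eq)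
    show "a_kernel E Q b \<subseteq> u ` carrier M"
    proof
      fix e assume "e \<in> a_kernel E Q b"
      then have e: "e \<in> carrier E" "b e = \<zero>\<^bsub>Q\<^esub>" by (auto simp: a_kernel_eq)
      have "g (a e) = \<zero>\<^bsub>N\<^esub>"
        using A.pullback_comm[OF pb e(1)] e(2) mod_hom_zero[OF lQ lN mod_epi_hom[OF \<tau>]] by simp
      then have "a e \<in> ?m ` carrier M"
        using mod_hom_closed[OF ab(1) e(1)] unfolding ker_g[symmetric] by (simp add: a_kernel_eq)
      then obtain x where x: "x \<in> carrier M" "a e = ?m x" by blast
      have "e = u x" by (rule A.pullback_eqI[OF pb e(1) mod_hom_closed[OF u(1) x(1)]]) (use u(2,3) x e in auto)
      then show "e \<in> u ` carrier M" using x(1) by blast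
    qed
  qed
  ultimately have "short_exact A M u E b Q"
    using u(1) b by (simp add: short_exact_def mod_epi_def)
  then show ?thesis using E Q by blast
qed

text \<open>A module orthogonal to \<open>\<F>\<^sub>A\<close> is a direct summand of its special preenvelope.\<close>

lemma CA_iff: "Y \<in> \<C>\<^sub>A \<longleftrightarrow> Y \<in> LMod U A \<and> (\<forall>X\<in>\<F>\<^sub>A. ext_orth U A X Y)"
proof
  assume "Y \<in> \<C>\<^sub>A"
  then show "Y \<in> LMod U A \<and> (\<forall>X\<in>\<F>\<^sub>A. ext_orth U A X Y)" using FA_CA_orth by (auto simp: summands_def)
next
  assume Y: "Y \<in> LMod U A \<and> (\<forall>X\<in>\<F>\<^sub>A. ext_orth U A X Y)"
  then have YL: "Y \<in> LMod U A" by blast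
  obtain E Q u b where E: "E \<in> Cof\<^sub>A" and Q: "Q \<in> \<F>\<^sub>A" and se: "short_exact A Y u E b Q"
    using FA_preenvelope[OF YL] by blast
  have EL: "E \<in> LMod U A" using E by (simp add: Cof_def)
  have u: "u \<in> mod_hom A Y E" and b: "mod_epi A E b Q" and inj: "inj_on u (carrier Y)"
    and im: "u ` carrier Y = carrier (kernel_module E Q b)"
    using se by (simp_all add: short_exact_def mod_epi_def a_kernel_eq)
  have "u \<in> mod_hom A Y (kernel_module E Q b)" by (rule mod_hom_into_kernel[OF u]) (use im in auto)
  then obtain h where h: "h \<in> mod_hom A (kernel_module E Q b) Y" "\<forall>y\<in>carrier Y. h (u y) = y"
    by (rule mod_iso_inverse[OF _ _ LModD(1)[OF YL]]) (use inj im in \<open>simp_all add: bij_betw_def\<close>)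
  obtain r where r: "r \<in> mod_hom A E Y" "\<forall>x\<in>carrier E. b x = \<zero>\<^bsub>Q\<^esub> \<longrightarrow> r x = h x"
    by (rule ext_orthD[OF _ EL b h(1)]) (use Y Q in auto)
  have "r (u y) = y" if "y \<in> carrier Y" for y
  proof -
    have "u y \<in> carrier (kernel_module E Q b)" using im that by blast
    then show ?thesis using r(2) h(2) that by simp
  qed
  then show "Y \<in> \<C>\<^sub>A" by (rule retract_of_Cof_in_CA[OF YL E u r(1)])
qed

text \<open>A module orthogonal to \<open>\<C>\<^sub>A\<close> is a direct summand of its special precover, and \<open>\<F>\<close> is closed under
  direct summands.\<close>

lemma FA_iff: "X \<in> \<F>\<^sub>A \<longleftrightarrow> X \<in> LMod U A \<and> (\<forall>Y\<in>\<C>\<^sub>A. ext_orth U A X Y)"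
proof
  assume "X \<in> \<F>\<^sub>A"
  then show "X \<in> LMod U A \<and> (\<forall>Y\<in>\<C>\<^sub>A. ext_orth U A X Y)" using FA_CA_orth FA_LMod by blast
next
  assume X: "X \<in> LMod U A \<and> (\<forall>Y\<in>\<C>\<^sub>A. ext_orth U A X Y)"
  then have XL: "X \<in> LMod U A" by blast
  note lX = LModD(1)[OF XL]
  obtain E Q b \<tau> where E: "E \<in> Cof\<^sub>A" and Q: "Q \<in> \<F>\<^sub>A" and se: "short_exact A E b Q \<tau> X"
    using FA_precover[OF XL] by blast
  note QL = FA_LMod[OF Q]
  note lQ = LModD(1)[OF QL]
  have b: "b \<in> mod_hom A E Q" and \<tau>: "mod_epi A Q \<tau> X" and inj: "inj_on b (carrier E)"
    and im: "b ` carrier E = carrier (kernel_module Q X \<tau>)"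
    using se by (simp_all add: short_exact_def mod_epi_def a_kernel_eq)
  have lE: "left_module A E" using E LModD(1) by (auto simp: Cof_def)
  have "b \<in> mod_hom A E (kernel_module Q X \<tau>)" by (rule mod_hom_into_kernel[OF b]) (use im in auto)
  then have "mod_iso A E (kernel_module Q X \<tau>)" unfolding mod_iso_def bij_betw_def using inj im by blast
  then have iso: "mod_iso A (kernel_module Q X \<tau>) E" by (rule mod_iso_sym[OF _ lE])
  have orth: "ext_orth U A X (kernel_module Q X \<tau>)"
    by (rule ext_orth_iso_right[OF _ iso left_module_kernel[OF lQ lX mod_epi_hom[OF \<tau>]]])
      (use X Cof_in_CA[OF E] in blast)
  have id: "mod_epi A X (\<lambda>x. x) X" by (simp add: mod_epi_def mod_hom_id)
  obtain s where s: "s \<in> mod_hom A X Q" "\<forall>x\<in>carrier X. \<tau> (s x) = x"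
    by (rule A.lifting[OF lX QL lX \<tau> orth XL id mod_hom_zero_map[OF lQ] mod_hom_id])
      (use mod_hom_zero[OF lQ lX mod_epi_hom[OF \<tau>]] in auto)
  have "res X \<in> \<F>"
    by (rule F_retract[OF res_LMod[OF XL] _ mod_hom_res[OF s(1)] mod_hom_res[OF mod_epi_hom[OF \<tau>]]])
      (use Q s(2) in \<open>auto simp: underlying_in_def\<close>)
  then show "X \<in> \<F>\<^sub>A" using XL by (simp add: underlying_in_def)
qed

lemma hereditary_complete_cotorsion_pair_A: "hereditary_complete_cotorsion_pair U A \<F>\<^sub>A \<C>\<^sub>A"
proof -
  have CL: "Y \<in> LMod U A" if "Y \<in> \<C>\<^sub>A" for Y using that by (simp add: summands_def)
  have Ext: "Ext_vanishes U A 1 X Y \<longleftrightarrow> ext_orth U A X Y" if "X \<in> LMod U A" "Y \<in> LMod U A" for X Y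
    by (rule A.Ext1_vanishes_iff_ext_orth[OF that(1) LModD(1)[OF that(2)]])
  have "Y \<in> \<C>\<^sub>A \<longleftrightarrow> Y \<in> right_perp U A \<F>\<^sub>A" for Y
    unfolding CA_iff right_perp_def using Ext FA_LMod by blast
  moreover have "X \<in> \<F>\<^sub>A \<longleftrightarrow> X \<in> left_perp U A \<C>\<^sub>A" for X
    unfolding FA_iff left_perp_def using Ext CL by blast
  ultimately have "cotorsion_pair U A \<F>\<^sub>A \<C>\<^sub>A" unfolding cotorsion_pair_def by blast
  moreover have "complete_pair U A \<F>\<^sub>A \<C>\<^sub>A"
    unfolding complete_pair_def using FA_precover FA_preenvelope Cof_in_CA by blast
  moreover have "hereditary_pair U A \<F>\<^sub>A \<C>\<^sub>A"
    unfolding hereditary_pair_def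
  proof (intro ballI allI impI)
    fix X Y and n :: nat assume X: "X \<in> \<F>\<^sub>A" and Y: "Y \<in> \<C>\<^sub>A" and n: "1 \<le> n"
    show "Ext_vanishes U A n X Y"
    proof (rule A.Ext_vanishes_if_closed_under_syzygies[OF _ _ _ X LModD(1)[OF CL[OF Y]] n])
      show "\<F>\<^sub>A \<subseteq> LMod U A" using FA_LMod by blast
      show "ext_orth U A X Y" if "X \<in> \<F>\<^sub>A" for X by (rule FA_CA_orth[OF that Y])
      fix P X g assume P: "projective U A P" and X: "X \<in> \<F>\<^sub>A" and g: "mod_epi A P g X"
      have "P \<in> \<F>\<^sub>A"
        unfolding FA_iff using A.projective_LMod[OF P] A.ext_orth_projective[OF P] CL LModD(1) by blast
      then show "kernel_module P X g \<in> \<F>\<^sub>A" using X g by (rule FA_kernel)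
    qed
  qed
  ultimately show ?thesis unfolding hereditary_complete_cotorsion_pair_def by blast
qed

end

theorem theorem2p29:
  fixes U :: "'u set set"
    and R :: "'r ring" and A :: "'a ring" and \<phi> :: "'r \<Rightarrow> 'a"
    and \<F> \<C> :: "('r, 'u) module set"
    and k :: nat
  assumes "universe U"
    and "small U (carrier R)" and "small U (carrier A)" and "powers_small U (carrier A)"
    and "ring R" and "ring A" and "\<phi> \<in> ring_hom R A"
    and "hereditary_complete_cotorsion_pair U R \<F> \<C>"
    and "in_class R \<F> (restrict_scalars \<phi> (regular_module A))"
    and "\<And>F. F \<in> \<F> \<Longrightarrow> in_class R \<F> (restrict_scalars \<phi> (coinduced R A \<phi> F))"
    and "\<And>(I :: nat set) M. (\<And>i. i \<in> I \<Longrightarrow> M i \<in> \<F>) \<Longrightarrow> res_dim_le R \<F> k (prod_module I M)"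
  shows "hereditary_complete_cotorsion_pair U A
           (underlying_in U A \<phi> \<F>)
           (summands U A (Cof U A (Omega_plus k) (coinduced_class U R A \<phi> \<C>)))"
proof -
  interpret change_of_rings_finite_dimension U R \<F> \<C> A \<phi> k
  proof (intro change_of_rings_finite_dimension.intro change_of_rings.intro
      hereditary_complete_pair.intro small_modules.intro hereditary_complete_pair_axioms.intro
      change_of_rings_axioms.intro change_of_rings_finite_dimension_axioms.intro)
    show "res_dim_le R \<F> k (prod_module UNIV F)" if "\<And>i. F i \<in> \<F>" for F :: "nat \<Rightarrow> ('r, 'u) module"
      using assms(11)[of UNIV F] that by blast
  qed (fact assms)+
  show ?thesis by (rule hereditary_complete_cotorsion_pair_A)
qed

end
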